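(* Assume: (1) the domain $\mathcal{W}$ and all risk functions $R_1,\dots,R_m$ are convex; (2) $\max_{\mathbf{w}\in\mathcal{W}} B_w(\mathbf{w},\mathbf{o}_w)\le D^2$; (3) for all $i\in[m]$, $\|\nabla \ell(\mathbf{w};\mathbf{z})\|_{w,*}\le G$ for all $\mathbf{w}\in\mathcal{W}$, $\mathbf{z}\sim\mathcal{P}_i$; (4) for all $i\in[m]$, $0\le\ell(\mathbf{w};\mathbf{z})\le 1$ for all $\mathbf{w}\in\mathcal{W}$, $\mathbf{z}\sim\mathcal{P}_i$; where $D,G>0$ and $m\ge 2$. Run the anytime stochastic approximation algorithm described in the context with $$\eta_t^{(i)}=\frac{D}{G\sqrt t},\qquad \eta_t^w=\frac{2D^2}{\sqrt{(2D^2G^2+2\ln m)t}},\qquad \eta_t^q=\frac{2\ln m}{\sqrt{(2D^2G^2+2\ln m)t}} .$$ Let $\epsilon_\phi(\bar{\mathbf{w}}_t,\bar{\mathbf{q}}_t)=\max_{\mathbf{q}\in\Delta_m}\phi(\bar{\mathbf{w}}_t,\mathbf{q})-\min_{\mathbf{w}\in\mathcal{W}}\phi(\mathbf{w},\bar{\mathbf{q}}_t)$. Then for all $t\in\mathbb{Z}_+$, $$\mathrm{E}\left[\epsilon_\phi(\bar{\mathbf{w}}_t,\bar{\mathbf{q}}_t)\right]\le\frac{(5+3\ln t)\sqrt{2D^2G^2+2\ln m}+2DG\left[3+\ln t+16(1+\sqrt{\ln m})\sqrt{2(1+\ln t)}\right](1+\ln t)}{2(\sqrt{t+1}-1)} .$$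 Furthermore, for every $\delta\in(0,1/2)$, with probability at least $1-2\delta$, simultaneously for all $t\in\mathbb{Z}_+$, $$\epsilon_\phi(\bar{\mathbf{w}}_t,\bar{\mathbf{q}}_t)\le\frac{1}{2(\sqrt{t+1}-1)}\Bigg[\sqrt{2D^2G^2+2\ln m}\left(5+3\ln t+8\sqrt{(1+\ln t)\ln\frac{2t^2}{\delta}}\right)+2DG\left(3+\ln t+16\sqrt{(1+\ln t)\ln\frac{2mt^2}{\delta}}\right)(1+\ln t)\Bigg].$$ Both right-hand sides are $O\left(\frac{\log^2 t+\log^{1/2}m\,\log^{3/2}t}{\sqrt t}\right)$ for $t\ge 2$, where the $O(\cdot)$ constant depends only on $D$, $G$ (and $\delta$ for the second bound).
   Context: $\mathbb{Z}_+=\{1,2,\dots\}$, $[m]=\{1,\dots,m\}$, $\Delta_m=\{\mathbf{q}\in\mathbb{R}^m:\mathbf{q}\ge0,\sum_i q_i=1\}$. $\mathcal{P}_1,\dots,\mathcal{P}_m$ are probability distributions on a sample space $\mathcal{Z}$; $\mathcal{W}$ is a nonempty closed subset of a finite-dimensional real vector space with norm $\|\cdot\|_w$ and dual norm $\|\cdot\|_{w,*}$; $\ell:\mathcal{W}\times\mathcal{Z}\to\mathbb{R}$ is a loss. $R_i(\mathbf{w})=\mathrm{E}_{\mathbf{z}\sim\mathcal{P}_i}[\ell(\mathbf{w};\mathbf{z})]$, $R_i^*=\min_{\mathbf{w}\in\mathcal{W}}R_i(\mathbf{w})$, and $$\phi(\mathbf{w},\mathbf{q})=\sum_{i=1}^m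 q_i[R_i(\mathbf{w})-R_i^*].$$ $\nabla\ell(\mathbf{w};\mathbf{z})$ is the gradient in $\mathbf{w}$, and $\nabla R_i(\mathbf{w})=\mathrm{E}_{\mathbf{z}\sim\mathcal{P}_i}[\nabla\ell(\mathbf{w};\mathbf{z})]$. Mirror descent setup: $\nu_w:\mathcal{W}\to\mathbb{R}$ is a continuous distance-generating function, $1$-strongly convex w.r.t. $\|\cdot\|_w$ and continuously differentiable on the convex set of points of $\mathcal{W}$ where its subdifferential is nonempty (this set contains all iterates below); $B_w(\mathbf{u},\mathbf{v})=\nu_w(\mathbf{u})-[\nu_w(\mathbf{v})+\langle\nabla\nu_w(\mathbf{v}),\mathbf{u}-\mathbf{v}\rangle]$; $\mathbf{o}_w=\arg\min_{\mathbf{w}\in\mathcal{W}}\nu_w(\mathbf{w})$. $B_q$ is the Bregman distance on $\Delta_m$ of the entropy $\nu_q(\mathbf{q})=\sum_i q_i\ln q_i$, i.e. the Kullback–Leibler divergence. All minima written are assumed attained. Algorithm: $\mathbf{w}_1=\mathbf{w}_1^{(1)}=\dots=\mathbf{w}_1^{(m)}=\mathbf{o}_w$, $\mathbf{q}_1=\frac1m\mathbf{1}_m$ ($\mathbf 1_m$ is the all-ones vector). At each round $t=1,2,\dots$, for each $i\in[m]$ draw a fresh independent sample $\mathbf{z}_t^{(i)}\sim\mathcal{P}_i$, set $$\mathbf{w}_{t+1}^{(i)}=\arg\min_{\mathbf{w}\in\mathcal{W}}\{\eta_t^{(i)}\langle\nabla\ell(\mathbf{w}_t^{(i)};\mathbf{z}_t^{(i)}),\mathbf{w}-\mathbf{w}_t^{(i)}\rangle+B_w(\mathbf{w},\mathbf{w}_t^{(i)})\},\qquad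 \bar{\mathbf{w}}_t^{(i)}=\sum_{j=1}^t\frac{\eta_j^{(i)}\mathbf{w}_j^{(i)}}{\sum_{k=1}^t\eta_k^{(i)}},$$ form $$\mathbf{g}_w(\mathbf{w}_t,\mathbf{q}_t)=\sum_{i=1}^m q_{t,i}\nabla\ell(\mathbf{w}_t;\mathbf{z}_t^{(i)}),\qquad \mathbf{g}_q(\mathbf{w}_t,\mathbf{q}_t)=\left[\ell(\mathbf{w}_t;\mathbf{z}_t^{(i)})-\ell(\bar{\mathbf{w}}_t^{(i)};\mathbf{z}_t^{(i)})\right]_{i=1}^m,$$ and update $$\mathbf{w}_{t+1}=\arg\min_{\mathbf{w}\in\mathcal{W}}\{\eta_t^w\langle\mathbf{g}_w(\mathbf{w}_t,\mathbf{q}_t),\mathbf{w}-\mathbf{w}_t\rangle+B_w(\mathbf{w},\mathbf{w}_t)\},$$ $$\mathbf{q}_{t+1}=\arg\min_{\mathbf{q}\in\Delta_m}\{\eta_t^q\langle-\mathbf{g}_q(\mathbf{w}_t,\mathbf{q}_t),\mathbf{q}-\mathbf{q}_t\rangle+B_q(\mathbf{q},\mathbf{q}_t)\}.$$ Outputs: $\bar{\mathbf{w}}_t=\sum_{j=1}^t\frac{\eta_j^w\mathbf{w}_j}{\sum_{k=1}^t\eta_k^w}$ and $\bar{\mathbf{q}}_t=\sum_{j=1}^t\frac{\eta_j^q\mathbf{q}_j}{\sum_{k=1}^t\eta_k^q}$. *)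

theory Defs
  imports "HOL-Probability.Probability" "HOL-Library.Landau_Symbols"
begin

text \<open>
  The ambient finite-dimensional space is a Euclidean space, whose inner product only serves to
  represent linear functionals by vectors; the norm on it is an arbitrary one, given as a function
  \<open>N\<close>, unrelated to the Euclidean norm.
\<close>

definition is_norm :: "('a::real_vector \<Rightarrow> real) \<Rightarrow> bool" where
  "is_norm N \<longleftrightarrow>
     (\<forall>x. 0 \<le> N x) \<and> (\<forall>x. N x = 0 \<longleftrightarrow> x = 0) \<and>
     (\<forall>c x. N (c *\<^sub>R x) = \<bar>c\<bar> * N x) \<and> (\<forall>x y. N (x + y) \<le> N x + N y)"

definition dual_norm :: "('a::euclidean_space \<Rightarrow> real) \<Rightarrow> 'a \<Rightarrow> real" where
  "dual_norm N g = (SUP x\<in>{x. N x \<le> 1}. g \<bullet> x)"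

definition strongly_convex_on ::
    "('a::real_vector \<Rightarrow> real) \<Rightarrow> real \<Rightarrow> 'a set \<Rightarrow> ('a \<Rightarrow> real) \<Rightarrow> bool" where
  "strongly_convex_on N \<alpha> W f \<longleftrightarrow>
     (\<forall>x\<in>W. \<forall>y\<in>W. \<forall>\<theta>\<in>{0..1}.
        f (\<theta> *\<^sub>R x + (1 - \<theta>) *\<^sub>R y)
          \<le> \<theta> * f x + (1 - \<theta>) * f y - \<alpha> / 2 * \<theta> * (1 - \<theta>) * (N (x - y))\<^sup>2)"

text \<open>The function is regarded as a function on \<open>W\<close> only, so that normal vectors of \<open>W\<close> count.\<close>

definition subdifferential ::
    "'a::real_inner set \<Rightarrow> ('a \<Rightarrow> real) \<Rightarrow> 'a \<Rightarrow> 'a set" where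
  "subdifferential W f v = {g. \<forall>u\<in>W. f v + g \<bullet> (u - v) \<le> f u}"

definition subdiff_domain :: "'a::real_inner set \<Rightarrow> ('a \<Rightarrow> real) \<Rightarrow> 'a set" where
  "subdiff_domain W f = {v\<in>W. subdifferential W f v \<noteq> {}}"

text \<open>
  \<open>d\<nu>\<close> is the gradient of \<open>\<nu>\<close>. If \<open>W\<close> has empty interior, it is one of the vectors representing the
  derivative; the choice does not affect the Bregman distance below on \<open>W\<close>.
\<close>

definition distance_generating ::
    "('a::euclidean_space \<Rightarrow> real) \<Rightarrow> 'a set \<Rightarrow> ('a \<Rightarrow> real) \<Rightarrow> ('a \<Rightarrow> 'a) \<Rightarrow> bool" where
  "distance_generating N W \<nu> d\<nu> \<longleftrightarrow>
     continuous_on W \<nu> \<and> strongly_convex_on N 1 W \<nu> \<and>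
     convex (subdiff_domain W \<nu>) \<and>
     (\<forall>v\<in>subdiff_domain W \<nu>. (\<nu> has_derivative (\<lambda>h. d\<nu> v \<bullet> h)) (at v within subdiff_domain W \<nu>)) \<and>
     continuous_on (subdiff_domain W \<nu>) d\<nu>"

definition bregman :: "('a::real_inner \<Rightarrow> real) \<Rightarrow> ('a \<Rightarrow> 'a) \<Rightarrow> 'a \<Rightarrow> 'a \<Rightarrow> real" where
  "bregman \<nu> d\<nu> u v = \<nu> u - (\<nu> v + d\<nu> v \<bullet> (u - v))"

definition prob_simplex :: "nat \<Rightarrow> (nat \<Rightarrow> real) set" where
  "prob_simplex m =
     {q. (\<forall>i\<in>{1..m}. 0 \<le> q i) \<and> (\<Sum>i=1..m. q i) = 1 \<and> (\<forall>i. i \<notin> {1..m} \<longrightarrow> q i = 0)}"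

text \<open>The convention \<open>0 ln 0 = 0\<close> holds automatically, as \<open>0 * x = 0\<close>.\<close>

definition neg_entropy :: "nat \<Rightarrow> (nat \<Rightarrow> real) \<Rightarrow> real" where
  "neg_entropy m q = (\<Sum>i=1..m. q i * ln (q i))"

text \<open>
  The Bregman distance of \<open>neg_entropy\<close>, whose gradient at a positive \<open>v\<close> is \<open>(ln v\<^sub>i + 1)\<^sub>i\<close>. On the
  simplex it is the Kullback-Leibler divergence. It is meaningful for positive \<open>v\<close> only, and all the
  iterates \<open>q t\<close> below are positive.
\<close>

definition bregman_entropy :: "nat \<Rightarrow> (nat \<Rightarrow> real) \<Rightarrow> (nat \<Rightarrow> real) \<Rightarrow> real" where
  "bregman_entropy m u v =
     neg_entropy m u - (neg_entropy m v + (\<Sum>i=1..m. (ln (v i) + 1) * (u i - v i)))"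

definition risk :: "('a \<Rightarrow> 'z \<Rightarrow> real) \<Rightarrow> 'z measure \<Rightarrow> 'a \<Rightarrow> real" where
  "risk \<l> P w = (\<integral>z. \<l> w z \<partial>P)"

text \<open>
  Minima and maxima are rendered as \<open>INF\<close> and \<open>SUP\<close>. Where these definitions are used they are attained:
  a bound on the Bregman distance to a minimiser of a strongly convex function makes a closed \<open>W\<close>
  compact, and the risks are Lipschitz on \<open>W\<close>.
\<close>

definition min_risk :: "'a set \<Rightarrow> ('a \<Rightarrow> 'z \<Rightarrow> real) \<Rightarrow> 'z measure \<Rightarrow> real" where
  "min_risk W \<l> P = (INF w\<in>W. risk \<l> P w)"

definition excess_obj ::
    "nat \<Rightarrow> 'a set \<Rightarrow> ('a \<Rightarrow> 'z \<Rightarrow> real) \<Rightarrow> (nat \<Rightarrow> 'z measure) \<Rightarrow> 'a \<Rightarrow> (nat \<Rightarrow> real) \<Rightarrow> real" where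
  "excess_obj m W \<l> P w q = (\<Sum>i=1..m. q i * (risk \<l> (P i) w - min_risk W \<l> (P i)))"

definition opt_error ::
    "nat \<Rightarrow> 'a set \<Rightarrow> ('a \<Rightarrow> 'z \<Rightarrow> real) \<Rightarrow> (nat \<Rightarrow> 'z measure) \<Rightarrow> 'a \<Rightarrow> (nat \<Rightarrow> real) \<Rightarrow> real" where
  "opt_error m W \<l> P w q =
     (SUP p\<in>prob_simplex m. excess_obj m W \<l> P w p) - (INF v\<in>W. excess_obj m W \<l> P v q)"

definition weighted_avg :: "(nat \<Rightarrow> real) \<Rightarrow> (nat \<Rightarrow> 'a::real_vector) \<Rightarrow> nat \<Rightarrow> 'a" where
  "weighted_avg \<eta> x t = (\<Sum>j=1..t. (\<eta> j / (\<Sum>k=1..t. \<eta> k)) *\<^sub>R x j)"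

text \<open>
  One trajectory of the algorithm, for a fixed realisation \<open>z t i\<close> of the samples: \<open>wi i\<close> is the
  auxiliary sequence for the \<open>i\<close>-th risk, \<open>w\<close> and \<open>q\<close> are the main sequences. Here
  \<open>d\<l> w z\<close> is the gradient of the loss in \<open>w\<close> and \<open>ow\<close> the initial point. Rounds start at 1.
\<close>

definition anytime_sa_trajectory ::
    "nat \<Rightarrow> 'a::euclidean_space set \<Rightarrow> ('a \<Rightarrow> 'z \<Rightarrow> real) \<Rightarrow> ('a \<Rightarrow> 'z \<Rightarrow> 'a) \<Rightarrow>
     ('a \<Rightarrow> real) \<Rightarrow> ('a \<Rightarrow> 'a) \<Rightarrow> 'a \<Rightarrow>
     (nat \<Rightarrow> nat \<Rightarrow> real) \<Rightarrow> (nat \<Rightarrow> real) \<Rightarrow> (nat \<Rightarrow> real) \<Rightarrow>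
     (nat \<Rightarrow> nat \<Rightarrow> 'z) \<Rightarrow>
     (nat \<Rightarrow> nat \<Rightarrow> 'a) \<Rightarrow> (nat \<Rightarrow> 'a) \<Rightarrow> (nat \<Rightarrow> nat \<Rightarrow> real) \<Rightarrow> bool" where
  "anytime_sa_trajectory m W \<l> d\<l> \<nu> d\<nu> ow \<eta>i \<eta>w \<eta>q z wi w q \<longleftrightarrow>
     (\<forall>i\<in>{1..m}. wi i 1 = ow) \<and>
     w 1 = ow \<and>
     q 1 = (\<lambda>i. if i \<in> {1..m} then 1 / real m else 0) \<and>
     (\<forall>t\<ge>1. \<forall>i\<in>{1..m}.
        is_arg_min
          (\<lambda>u. \<eta>i i t * (d\<l> (wi i t) (z t i) \<bullet> (u - wi i t)) + bregman \<nu> d\<nu> u (wi i t))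
          (\<lambda>u. u \<in> W) (wi i (t + 1))) \<and>
     (\<forall>t\<ge>1.
        let gw = (\<Sum>i=1..m. q t i *\<^sub>R d\<l> (w t) (z t i));
            gq = (\<lambda>i. \<l> (w t) (z t i) - \<l> (weighted_avg (\<eta>i i) (wi i) t) (z t i))
        in
          is_arg_min (\<lambda>u. \<eta>w t * (gw \<bullet> (u - w t)) + bregman \<nu> d\<nu> u (w t))
            (\<lambda>u. u \<in> W) (w (t + 1)) \<and>
          is_arg_min (\<lambda>p. \<eta>q t * (\<Sum>i=1..m. - gq i * (p i - q t i)) + bregman_entropy m p (q t))
            (\<lambda>p. p \<in> prob_simplex m) (q (t + 1)))"

definition step_single :: "real \<Rightarrow> real \<Rightarrow> nat \<Rightarrow> real" where
  "step_single D G t = D / (G * sqrt (real t))"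

definition step_w :: "real \<Rightarrow> real \<Rightarrow> nat \<Rightarrow> nat \<Rightarrow> real" where
  "step_w D G m t = 2 * D\<^sup>2 / sqrt ((2 * D\<^sup>2 * G\<^sup>2 + 2 * ln (real m)) * real t)"

definition step_q :: "real \<Rightarrow> real \<Rightarrow> nat \<Rightarrow> nat \<Rightarrow> real" where
  "step_q D G m t = 2 * ln (real m) / sqrt ((2 * D\<^sup>2 * G\<^sup>2 + 2 * ln (real m)) * real t)"

definition expectation_bound :: "real \<Rightarrow> real \<Rightarrow> nat \<Rightarrow> nat \<Rightarrow> real" where
  "expectation_bound D G m t =
     ((5 + 3 * ln (real t)) * sqrt (2 * D\<^sup>2 * G\<^sup>2 + 2 * ln (real m))
       + 2 * D * G * (3 + ln (real t)
           + 16 * (1 + sqrt (ln (real m))) * sqrt (2 * (1 + ln (real t)))) * (1 + ln (real t)))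
     / (2 * (sqrt (real t + 1) - 1))"

definition high_prob_bound :: "real \<Rightarrow> real \<Rightarrow> real \<Rightarrow> nat \<Rightarrow> nat \<Rightarrow> real" where
  "high_prob_bound D G \<delta> m t =
     1 / (2 * (sqrt (real t + 1) - 1)) *
     (sqrt (2 * D\<^sup>2 * G\<^sup>2 + 2 * ln (real m)) *
        (5 + 3 * ln (real t) + 8 * sqrt ((1 + ln (real t)) * ln (2 * (real t)\<^sup>2 / \<delta>)))
      + 2 * D * G *
        (3 + ln (real t) + 16 * sqrt ((1 + ln (real t)) * ln (2 * real m * (real t)\<^sup>2 / \<delta>)))
        * (1 + ln (real t)))"

definition rate :: "nat \<Rightarrow> nat \<Rightarrow> real" where
  "rate m t =
     ((ln (real t))\<^sup>2 + ln (real m) powr (1/2) * ln (real t) powr (3/2)) / sqrt (real t)"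

end

theory Submission
  imports Defs
begin

text \<open>
  Write \<open>r\<^sub>j = 1 / sqrt j\<close>; all step sizes are multiples of \<open>r\<^sub>j\<close>, so all averages use the same
  weights. By convexity in \<open>w\<close> and linearity in \<open>q\<close>, the duality gap times \<open>\<Sum>r\<^sub>j\<close> is at most the
  linearised regret of the two players. That regret splits into the regret against the stochastic
  gradients (mirror descent), the regret of ghost iterates that run mirror descent on the gradient
  noise (which makes the noise terms uniform in the comparison point), a sum of bounded martingale
  differences (Azuma), and the bias \<open>R\<^sub>i(wbar\<^sub>j\<^sup>i) - R\<^sub>i\<^sup>*\<close> of the auxiliary runs, which is itself bounded by
  mirror descent plus a martingale. Predictability holds because the proximal map of a strongly convex
  function is single-valued and continuous, so the iterates are measurable functions of the past.
\<close>

section \<open>Norms and mirror maps\<close>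

text \<open>The maximising \<open>q\<close> and the minimising point of the gap depend on the
  samples, so a martingale against a fixed comparison point is out of reach for the two main
  sequences; the ghosts cure this. The auxiliary runs need none, since a minimiser of a single risk
  is deterministic. The averages \<open>wbi i j\<close> involve no sample of round \<open>j\<close>,
  so evaluating them on that sample is unbiased. \<open>K\<close>, the square root of
  \<open>2 D^2 G^2 + 2 ln m\<close>, balances the players: the step constants
  \<open>2 D^2 / K\<close> and \<open>2 ln m / K\<close> turn the initial distances
  \<open>D^2\<close> and \<open>ln m\<close> both into \<open>K / 2\<close>. The second logarithm
  arises because the bias of round \<open>j\<close> is of order \<open>1 / sqrt j\<close> up to
  logarithms and is weighted by another \<open>1 / sqrt j\<close>. Uniformity in \<open>t\<close> is
  a union bound with weights \<open>1 / t^2\<close>; the mean of the largest of \<open>m\<close>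
  biases comes from exponential moments. A further obstacle is that \<open>\<nu>\<close> is
  differentiable only on the set \<open>S\<close> of points with a subgradient, and only relative to
  \<open>S\<close>, while comparison points range over \<open>W\<close>; this forces a density
  argument.\<close>

locale norm_space =
  fixes N :: "'a::euclidean_space \<Rightarrow> real"
  assumes is_norm: "is_norm N"
begin

lemma N_nonneg [simp]: "0 \<le> N x"
  and N_eq_0 [simp]: "N x = 0 \<longleftrightarrow> x = 0"
  and N_scaleR [simp]: "N (c *\<^sub>R x) = \<bar>c\<bar> * N x"
  and N_add_le: "N (x + y) \<le> N x + N y"
  using is_norm unfolding is_norm_def by blast+

lemma N_0 [simp]: "N 0 = 0"
  by simp

lemma N_minus [simp]: "N (- x) = N x"
  using N_scaleR[of "-1" x] by simp

lemma N_diff_commute: "N (x - y) = N (y - x)"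
  using N_minus[of "x - y"] by simp

lemma N_diff_triangle: "N (x - y) \<le> N (x - z) + N (z - y)"
  using N_add_le[of "x - z" "z - y"] by simp

lemma N_sum_le: "finite A \<Longrightarrow> N (sum f A) \<le> (\<Sum>i\<in>A. N (f i))"
proof (induction A rule: finite_induct)
  case (insert x A)
  then show ?case using N_add_le[of "f x" "sum f A"] by simp
qed simp

text \<open>Together with \<open>norm_le_N\<close> this is the equivalence of \<open>N\<close> with
  the Euclidean norm, which carries compactness, continuity and Lipschitz estimates from one to the
  other.\<close>

lemma N_le_norm: "\<exists>C>0. \<forall>x. N x \<le> C * norm x"
proof (intro exI conjI allI)
  let ?C = "(\<Sum>b\<in>Basis. N b) + 1 :: real"
  show "0 < ?C" using sum_nonneg[of Basis N] by simp
  fix x :: 'a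
  have "N x = N (\<Sum>b\<in>Basis. (x \<bullet> b) *\<^sub>R b)" by (simp add: euclidean_representation)
  also have "\<dots> \<le> (\<Sum>b\<in>Basis. \<bar>x \<bullet> b\<bar> * N b)"
    using N_sum_le[of Basis "\<lambda>b. (x \<bullet> b) *\<^sub>R b"] by simp
  also have "\<dots> \<le> (\<Sum>b\<in>Basis. norm x * N b)"
    by (intro sum_mono mult_right_mono Basis_le_norm) auto
  also have "\<dots> = norm x * (\<Sum>b\<in>Basis. N b)" by (simp add: sum_distrib_left)
  also have "\<dots> \<le> ?C * norm x" by (simp add: algebra_simps)
  finally show "N x \<le> ?C * norm x" .
qed

lemma N_diff_abs_le: "\<bar>N x - N y\<bar> \<le> N (x - y)"
  using N_add_le[of "x - y" y] N_add_le[of "y - x" x] N_diff_commute[of x y] by simp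

lemma continuous_on_N: "continuous_on A N"
proof -
  obtain C where C: "C > 0" "\<And>x. N x \<le> C * norm x" using N_le_norm by blast
  have "C-lipschitz_on A N"
  proof (rule lipschitz_onI)
    fix x y
    show "dist (N x) (N y) \<le> C * dist x y"
      using N_diff_abs_le[of x y] C(2)[of "x - y"] by (simp add: dist_norm)
  qed (use C in simp)
  then show ?thesis by (rule lipschitz_on_continuous_on)
qed

lemma tendsto_N: "(f \<longlongrightarrow> l) F \<Longrightarrow> ((\<lambda>x. N (f x)) \<longlongrightarrow> N l) F"
  using continuous_on_N[of UNIV] by (intro isCont_tendsto_compose[of l N])
    (auto simp: continuous_on_eq_continuous_at)

text \<open>The continuous function \<open>N\<close> attains a positive minimum on the compact
  Euclidean unit sphere; homogeneity extends the bound to all vectors.\<close>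

lemma norm_le_N: "\<exists>k>0. \<forall>x. k * norm x \<le> N x"
proof (cases "sphere (0::'a) 1 = {}")
  case False
  obtain y where y: "y \<in> sphere 0 1" "\<And>x. x \<in> sphere 0 1 \<Longrightarrow> N y \<le> N x"
    using continuous_attains_inf[OF compact_sphere False continuous_on_N] by blast
  have "N y > 0" using y(1) N_nonneg[of y] N_eq_0[of y] by (cases "y = 0") (auto simp: less_le simp del: N_eq_0 N_nonneg)
  moreover have "N y * norm x \<le> N x" for x
  proof (cases "x = 0")
    case False
    then have "N y \<le> N ((1 / norm x) *\<^sub>R x)" by (intro y) simp
    also have "\<dots> = N x / norm x" by (simp only: N_scaleR) simp
    finally show ?thesis using False by (simp add: field_simps)
  qed simp
  ultimately show ?thesis by blast
qed simp

text \<open>The real supremum behind \<open>dual_norm\<close> is meaningful only over a bounded set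
  of values; \<open>norm_le_N\<close> bounds the unit ball of \<open>N\<close> and thereby these
  values.\<close>

lemma inner_le_dual_norm: "g \<bullet> x \<le> dual_norm N g * N x"
proof (cases "x = 0")
  case False
  then have Nx: "N x > 0" using N_nonneg[of x] N_eq_0[of x] by linarith
  obtain k where k: "k > 0" "\<And>x. k * norm x \<le> N x" using norm_le_N by blast
  have bdd: "bdd_above ((\<bullet>) g ` {x. N x \<le> 1})"
  proof (rule bdd_aboveI2)
    fix y assume "y \<in> {x. N x \<le> 1}"
    then have "k * norm y \<le> 1" using k(2)[of y] by simp
    then have "norm y \<le> 1 / k" using k by (simp add: field_simps)
    then have "norm g * norm y \<le> norm g * (1 / k)" by (intro mult_left_mono) auto
    then show "g \<bullet> y \<le> norm g * (1 / k)" using norm_cauchy_schwarz[of g y] by linarith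
  qed
  have "g \<bullet> ((1 / N x) *\<^sub>R x) \<le> dual_norm N g"
    unfolding dual_norm_def using Nx by (intro cSUP_upper[OF _ bdd]) simp
  then show ?thesis using Nx by (simp add: field_simps)
qed simp

lemma abs_inner_le_dual_norm: "dual_norm N g \<le> G \<Longrightarrow> \<bar>g \<bullet> x\<bar> \<le> G * N x"
  using inner_le_dual_norm[of g x] inner_le_dual_norm[of g "- x"]
    mult_right_mono[of "dual_norm N g" G "N x"] by (simp add: abs_le_iff)

end

lemma norm_add_scaleR_power2:
  fixes a b :: "'a::real_inner"
  shows "(norm (a + s *\<^sub>R b))\<^sup>2 = (norm a)\<^sup>2 + 2 * s * (a \<bullet> b) + s\<^sup>2 * (norm b)\<^sup>2"
  by (simp add: power2_norm_eq_inner inner_add_left inner_add_right inner_commute[of b a]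
      power2_eq_square[of s] algebra_simps)

text \<open>A derivative within \<open>A\<close> controls only directions that stay in
  \<open>A\<close>. By convexity the segment to another point of \<open>A\<close> is such a
  direction, and the chain rule along it gives an ordinary right difference quotient. It serves for
  \<open>\<nu>\<close> on \<open>S\<close> and for the loss on \<open>W\<close>.\<close>

lemma directional_derivative_at_right:
  fixes f :: "'a::euclidean_space \<Rightarrow> real"
  assumes "convex A" "x \<in> A" "y \<in> A"
    and "(f has_derivative (\<lambda>h. g \<bullet> h)) (at x within A)"
  shows "((\<lambda>s. (f (x + s *\<^sub>R (y - x)) - f x) / s) \<longlongrightarrow> g \<bullet> (y - x)) (at_right 0)"
proof -
  let ?p = "\<lambda>s. x + s *\<^sub>R (y - x)"
  have sub: "?p ` {0..1} \<subseteq> A"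
  proof
    fix u assume "u \<in> ?p ` {0..1}"
    then obtain s where s: "0 \<le> s" "s \<le> 1" "u = ?p s" by auto
    have "u = (1 - s) *\<^sub>R x + s *\<^sub>R y" using s by (simp add: algebra_simps)
    then show "u \<in> A" using assms s by (simp add: convex_alt)
  qed
  have "(?p has_derivative (\<lambda>s. s *\<^sub>R (y - x))) (at 0 within {0..1})"
    by (auto intro!: derivative_eq_intros)
  moreover have "(f has_derivative (\<lambda>h. g \<bullet> h)) (at (?p 0) within ?p ` {0..1})"
    using has_derivative_subset[OF assms(4) sub] by simp
  ultimately have "(f \<circ> ?p has_derivative ((\<lambda>h. g \<bullet> h) \<circ> (\<lambda>s. s *\<^sub>R (y - x)))) (at 0 within {0..1})"
    by (rule diff_chain_within)
  then have "((\<lambda>s. f (?p s)) has_real_derivative g \<bullet> (y - x)) (at 0 within {0..1})"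
    unfolding has_field_derivative_def o_def
    by (rule has_derivative_eq_rhs) (simp add: fun_eq_iff mult.commute)
  then have "((\<lambda>s. (f (?p s) - f x) / s) \<longlongrightarrow> g \<bullet> (y - x)) (at 0 within {0..1})"
    by (simp add: has_field_derivative_iff)
  moreover have "at (0::real) within {0..1} = at_right 0"
    by (rule at_within_Icc_at_right) simp
  ultimately show ?thesis by simp
qed

section \<open>Mirror maps: density of the points with a subgradient, first-order strong
  convexity\<close>

locale mirror_map = norm_space N for N :: "'a::euclidean_space \<Rightarrow> real" +
  fixes W :: "'a set" and \<nu> :: "'a \<Rightarrow> real" and d\<nu> :: "'a \<Rightarrow> 'a" and ow :: 'a and D :: real
  assumes W_ne: "W \<noteq> {}" and W_closed: "closed W" and W_convex: "convex W"
    and dgf: "distance_generating N W \<nu> d\<nu>"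
    and ow_min: "is_arg_min \<nu> (\<lambda>u. u \<in> W) ow"
    and diameter: "u \<in> W \<Longrightarrow> bregman \<nu> d\<nu> u ow \<le> D\<^sup>2"
    and D_pos: "D > 0"
begin

abbreviation "S \<equiv> subdiff_domain W \<nu>"
abbreviation "B \<equiv> bregman \<nu> d\<nu>"

lemma \<nu>_cont: "continuous_on W \<nu>"
  and S_convex: "convex S"
  and \<nu>_deriv: "v \<in> S \<Longrightarrow> (\<nu> has_derivative (\<lambda>h. d\<nu> v \<bullet> h)) (at v within S)"
  and d\<nu>_cont: "continuous_on S d\<nu>"
  and \<nu>_strong: "x \<in> W \<Longrightarrow> y \<in> W \<Longrightarrow> 0 \<le> s \<Longrightarrow> s \<le> 1 \<Longrightarrow>
    \<nu> (s *\<^sub>R x + (1 - s) *\<^sub>R y) \<le> s * \<nu> x + (1 - s) * \<nu> y - 1 / 2 * s * (1 - s) * (N (x - y))\<^sup>2"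
  using dgf unfolding distance_generating_def strongly_convex_on_def by auto

lemma S_subset: "S \<subseteq> W"
  unfolding subdiff_domain_def by auto

lemma ow_W: "ow \<in> W" and ow_le: "u \<in> W \<Longrightarrow> \<nu> ow \<le> \<nu> u"
  using ow_min unfolding is_arg_min_def by (auto simp: not_less)

lemma segment_in_W:
  "x \<in> W \<Longrightarrow> y \<in> W \<Longrightarrow> 0 \<le> s \<Longrightarrow> s \<le> 1 \<Longrightarrow> x + s *\<^sub>R (y - x) \<in> W"
  using W_convex unfolding convex_alt by (auto simp: algebra_simps)

lemma \<nu>_segment:
  assumes "x \<in> W" "y \<in> W" "0 \<le> s" "s \<le> 1"
  shows "\<nu> (x + s *\<^sub>R (y - x)) \<le> \<nu> x + s * (\<nu> y - \<nu> x) - 1 / 2 * s * (1 - s) * (N (y - x))\<^sup>2"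
proof -
  have "x + s *\<^sub>R (y - x) = s *\<^sub>R y + (1 - s) *\<^sub>R x" by (simp add: algebra_simps)
  then show ?thesis using \<nu>_strong[OF assms(2,1,3,4)] by (simp add: algebra_simps)
qed

text \<open>
  The minimiser of \<open>\<nu> + \<lambda>/2 * dist(_, u)\<^sup>2\<close> admits a subgradient and tends to \<open>u\<close> as \<open>\<lambda>\<close> grows.
\<close>

lemma S_dense: "W \<subseteq> closure S"
proof
  fix u assume u: "u \<in> W"
  show "u \<in> closure S"
    unfolding closure_approachable
  proof (intro allI impI)
    fix e :: real assume e: "e > 0"
    \<comment> \<open>Large enough that the penalty at distance \<open>e\<close> outweighs any
      decrease \<open>\<nu> u - \<nu> ow\<close>; the summand 1 makes \<open>gap\<close> strict and
      \<open>lam\<close> positive.\<close>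
    define lam where "lam = 2 * (\<nu> u - \<nu> ow + 1) / e\<^sup>2"
    have gap: "\<nu> u - \<nu> ow < lam / 2 * e\<^sup>2" using e by (simp add: lam_def)
    have lam: "lam > 0" using ow_le[OF u] e by (simp add: lam_def)
    define F where "F x = \<nu> x + lam / 2 * (norm (x - u))\<^sup>2" for x
    \<comment> \<open>\<open>compact_W\<close> comes later and rests on this lemma, so a minimiser
      is first taken in a ball. It minimises over all of \<open>W\<close> (\<open>glob\<close>),
      because outside the ball the penalty alone exceeds what \<open>\<nu>\<close> can lose.\<close>
    have "compact (W \<inter> cball u e)" using W_closed by (intro closed_Int_compact) auto
    moreover have "u \<in> W \<inter> cball u e" using u e by simp
    moreover have "continuous_on (W \<inter> cball u e) F"
      unfolding F_def by (intro continuous_intros continuous_on_subset[OF \<nu>_cont]) auto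
    ultimately obtain x where x: "x \<in> W \<inter> cball u e" "\<And>y. y \<in> W \<inter> cball u e \<Longrightarrow> F x \<le> F y"
      using continuous_attains_inf[of "W \<inter> cball u e" F] by blast
    have xW: "x \<in> W" using x by simp
    have Fu: "F x \<le> \<nu> u" using x(2)[OF \<open>u \<in> W \<inter> cball u e\<close>] by (simp add: F_def)
    then have "lam / 2 * (norm (x - u))\<^sup>2 < lam / 2 * e\<^sup>2"
      using gap ow_le[OF xW] by (simp add: F_def)
    then have "(norm (x - u))\<^sup>2 < e\<^sup>2" using lam by simp
    then have near: "dist x u < e" using e by (simp add: dist_norm power2_less_imp_less)
    have glob: "F x \<le> F y" if "y \<in> W" for y
    proof (cases "y \<in> cball u e")
      case False
      then have "e \<le> norm (y - u)" by (simp add: dist_norm norm_minus_commute)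
      then have "lam / 2 * e\<^sup>2 \<le> lam / 2 * (norm (y - u))\<^sup>2"
        using e lam by (intro mult_left_mono power_mono) auto
      then show ?thesis using Fu gap ow_le[OF that] by (simp add: F_def)
    qed (use x that in auto)
    have "\<nu> x + (- lam *\<^sub>R (x - u)) \<bullet> (y - x) \<le> \<nu> y" if y: "y \<in> W" for y
    proof -
      \<comment> \<open>Compare with the point moved by \<open>s\<close> towards \<open>y\<close>:
        the first-order terms scale with \<open>s\<close>, the quadratic one with
        \<open>s^2\<close>. Dividing by \<open>s\<close> and letting it tend to 0 leaves the
        subgradient inequality for \<open>- lam *\<^sub>R (x - u)\<close>.\<close>
      have ineq: "\<nu> x - \<nu> y - lam * ((x - u) \<bullet> (y - x)) \<le> s * (lam / 2 * (norm (y - x))\<^sup>2)"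
        if s: "0 < s" "s \<le> 1" for s
      proof -
        let ?y = "x + s *\<^sub>R (y - x)"
        have 1: "F x \<le> F ?y" using s by (intro glob segment_in_W xW y) auto
        have "0 \<le> 1 / 2 * s * (1 - s) * (N (y - x))\<^sup>2" using s by simp
        then have 2: "\<nu> ?y \<le> \<nu> x + s * (\<nu> y - \<nu> x)"
          using \<nu>_segment[OF xW y, of s] s by linarith
        have "?y - u = (x - u) + s *\<^sub>R (y - x)" by simp
        then have 3: "(norm (?y - u))\<^sup>2
            = (norm (x - u))\<^sup>2 + 2 * s * ((x - u) \<bullet> (y - x)) + s\<^sup>2 * (norm (y - x))\<^sup>2"
          using norm_add_scaleR_power2[of "x - u" s "y - x"] by metis
        have "0 \<le> F ?y - F x" using 1 by simp
        also have "\<dots> \<le> s * (\<nu> y - \<nu> x) + lam / 2 * ((norm (?y - u))\<^sup>2 - (norm (x - u))\<^sup>2)"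
          using 2 unfolding F_def right_diff_distrib by linarith
        also have "\<dots> = s * ((\<nu> y - \<nu> x) + lam * ((x - u) \<bullet> (y - x)) + s * (lam / 2 * (norm (y - x))\<^sup>2))"
          unfolding 3 by (simp add: distrib_left power2_eq_square)
        finally show ?thesis using s by (simp add: zero_le_mult_iff)
      qed
      have "((\<lambda>s. s * (lam / 2 * (norm (y - x))\<^sup>2)) \<longlongrightarrow> 0 * (lam / 2 * (norm (y - x))\<^sup>2)) (at_right 0)"
        by (intro tendsto_intros)
      moreover have "eventually (\<lambda>s::real. \<nu> x - \<nu> y - lam * ((x - u) \<bullet> (y - x))
          \<le> s * (lam / 2 * (norm (y - x))\<^sup>2)) (at_right 0)"
        using ineq unfolding eventually_at_right_field by (intro exI[of _ 1]) auto
      ultimately have "\<nu> x - \<nu> y - lam * ((x - u) \<bullet> (y - x)) \<le> 0 * (lam / 2 * (norm (y - x))\<^sup>2)"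
        by (intro tendsto_lowerbound) auto
      then show ?thesis by simp
    qed
    then have "x \<in> S" using xW unfolding subdiff_domain_def subdifferential_def by blast
    then show "\<exists>y\<in>S. dist y u < e" using near by blast
  qed
qed

lemma S_approx:
  assumes "u \<in> W" obtains x where "\<And>n. x n \<in> S" "x \<longlonglongrightarrow> u"
  using S_dense assms closure_sequential[of u S] by blast

text \<open>First-order form of strong convexity: the secant inequality divided by \<open>s\<close>,
  in the limit of \<open>s\<close> tending to 0. The directional derivative is available only
  towards points of \<open>S\<close>.\<close>

lemma bregman_lower_S:
  assumes v: "v \<in> S" and u: "u \<in> S"
  shows "1 / 2 * (N (u - v))\<^sup>2 \<le> B u v"
proof -
  have W: "u \<in> W" "v \<in> W" using u v S_subset by auto
  have "((\<lambda>s. (\<nu> (v + s *\<^sub>R (u - v)) - \<nu> v) / s) \<longlongrightarrow> d\<nu> v \<bullet> (u - v)) (at_right 0)"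
    by (intro directional_derivative_at_right[OF S_convex v u] \<nu>_deriv v)
  moreover have "((\<lambda>s. \<nu> u - \<nu> v - 1 / 2 * (1 - s) * (N (u - v))\<^sup>2)
      \<longlongrightarrow> \<nu> u - \<nu> v - 1 / 2 * (1 - 0) * (N (u - v))\<^sup>2) (at_right 0)"
    by (intro tendsto_intros)
  moreover have "eventually (\<lambda>s. (\<nu> (v + s *\<^sub>R (u - v)) - \<nu> v) / s
      \<le> \<nu> u - \<nu> v - 1 / 2 * (1 - s) * (N (u - v))\<^sup>2) (at_right 0)"
    unfolding eventually_at_right_field
  proof (intro exI[of _ 1] conjI allI impI)
    fix s :: real assume s: "0 < s" "s < 1"
    have "\<nu> (v + s *\<^sub>R (u - v)) - \<nu> v \<le> s * (\<nu> u - \<nu> v - 1 / 2 * (1 - s) * (N (u - v))\<^sup>2)"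
      using \<nu>_segment[OF W(2,1), of s] s by (simp add: algebra_simps)
    then show "(\<nu> (v + s *\<^sub>R (u - v)) - \<nu> v) / s \<le> \<nu> u - \<nu> v - 1 / 2 * (1 - s) * (N (u - v))\<^sup>2"
      using s by (simp add: field_simps)
  qed simp
  ultimately have "d\<nu> v \<bullet> (u - v) \<le> \<nu> u - \<nu> v - 1 / 2 * (1 - 0) * (N (u - v))\<^sup>2"
    by (intro tendsto_le) auto
  then show ?thesis by (simp add: bregman_def)
qed

text \<open>For fixed \<open>v\<close> the Bregman distance is continuous in \<open>u\<close> on
  \<open>W\<close>, so the estimate passes from the dense set \<open>S\<close> to all of
  \<open>W\<close>.\<close>

lemma bregman_lower:
  assumes v: "v \<in> S" and u: "u \<in> W"
  shows "1 / 2 * (N (u - v))\<^sup>2 \<le> B u v"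
proof -
  obtain x where x: "\<And>n. x n \<in> S" "x \<longlonglongrightarrow> u" using S_approx[OF u] by blast
  have "(\<lambda>n. \<nu> (x n)) \<longlonglongrightarrow> \<nu> u"
    using \<nu>_cont x u S_subset unfolding continuous_on_sequentially by (auto simp: o_def)
  then have "(\<lambda>n. B (x n) v) \<longlonglongrightarrow> B u v"
    unfolding bregman_def by (intro tendsto_intros x)
  moreover have "(\<lambda>n. 1 / 2 * (N (x n - v))\<^sup>2) \<longlonglongrightarrow> 1 / 2 * (N (u - v))\<^sup>2"
    by (intro tendsto_intros tendsto_N x)
  ultimately show ?thesis
    using bregman_lower_S[OF v x(1)] by (intro LIMSEQ_le[of _ _ "\<lambda>n. B (x n) v"]) auto
qed

lemma bregman_nonneg: "v \<in> S \<Longrightarrow> u \<in> W \<Longrightarrow> 0 \<le> B u v"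
  using bregman_lower[of v u] zero_le_power2[of "N (u - v)"] by linarith

lemma ow_S: "ow \<in> S"
proof -
  have "0 \<in> subdifferential W \<nu> ow" using ow_le by (simp add: subdifferential_def)
  then show ?thesis using ow_W unfolding subdiff_domain_def by blast
qed

lemma N_diameter: "u \<in> W \<Longrightarrow> N (u - ow) \<le> sqrt 2 * D"
proof -
  assume u: "u \<in> W"
  have "(N (u - ow))\<^sup>2 \<le> 2 * D\<^sup>2" using bregman_lower[OF ow_S u] diameter[OF u] by simp
  also have "\<dots> = (sqrt 2 * D)\<^sup>2" by (simp add: power_mult_distrib)
  finally show ?thesis by (rule power2_le_imp_le) (use D_pos in simp)
qed

lemma N_diameter2: "u \<in> W \<Longrightarrow> v \<in> W \<Longrightarrow> N (u - v) \<le> 2 * sqrt 2 * D"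
  using N_diff_triangle[of u v ow] N_diameter[of u] N_diameter[of v] N_diff_commute[of ow v] by simp

lemma compact_W: "compact W"
proof -
  obtain k where k: "k > 0" "\<And>x. k * norm x \<le> N x" using norm_le_N by blast
  have "norm u \<le> norm ow + sqrt 2 * D / k" if "u \<in> W" for u
  proof -
    have "k * norm (u - ow) \<le> sqrt 2 * D" using k(2)[of "u - ow"] N_diameter[OF that] by linarith
    then have "norm (u - ow) \<le> sqrt 2 * D / k" using k by (simp add: field_simps)
    then show ?thesis using norm_triangle_ineq[of "u - ow" ow] by simp
  qed
  then show ?thesis using W_closed by (auto simp: compact_eq_bounded_closed bounded_iff)
qed

text \<open>Optimality itself exhibits \<open>- c\<close> as a subgradient. Hence every mirror step
  lands where \<open>\<nu>\<close> is differentiable, and the next step is again well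
  behaved.\<close>

lemma linear_argmin_S:
  assumes x: "is_arg_min (\<lambda>u. c \<bullet> u + \<nu> u) (\<lambda>u. u \<in> W) x"
  shows "x \<in> S"
proof -
  have "\<nu> x + (- c) \<bullet> (u - x) \<le> \<nu> u" if "u \<in> W" for u
  proof -
    have "c \<bullet> x + \<nu> x \<le> c \<bullet> u + \<nu> u"
      using x that by (simp add: is_arg_min_def not_less)
    then show ?thesis by (simp add: inner_diff_right)
  qed
  then have "- c \<in> subdifferential W \<nu> x" by (simp add: subdifferential_def)
  then show ?thesis using x unfolding subdiff_domain_def is_arg_min_def by blast
qed

text \<open>First-order optimality: moving from the minimiser towards \<open>u\<close> cannot
  decrease the objective. This differentiates directly for \<open>u\<close> in \<open>S\<close>; for
  other \<open>u\<close> the inequality is a limit, being continuous in \<open>u\<close>.\<close>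

lemma linear_argmin_variational:
  assumes x: "is_arg_min (\<lambda>u. c \<bullet> u + \<nu> u) (\<lambda>u. u \<in> W) x" and u: "u \<in> W"
  shows "0 \<le> (c + d\<nu> x) \<bullet> (u - x)"
proof -
  have xS: "x \<in> S" using linear_argmin_S[OF x] .
  have xW: "x \<in> W" using x by (simp add: is_arg_min_def)
  have min: "c \<bullet> x + \<nu> x \<le> c \<bullet> y + \<nu> y" if "y \<in> W" for y
    using x that by (auto simp: is_arg_min_def not_less)
  have *: "0 \<le> (c + d\<nu> x) \<bullet> (u - x)" if u: "u \<in> S" for u
  proof -
    have "((\<lambda>s. c \<bullet> (u - x) + (\<nu> (x + s *\<^sub>R (u - x)) - \<nu> x) / s)
        \<longlongrightarrow> c \<bullet> (u - x) + d\<nu> x \<bullet> (u - x)) (at_right 0)"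
      by (intro tendsto_intros directional_derivative_at_right[OF S_convex xS u] \<nu>_deriv xS)
    moreover have "eventually (\<lambda>s. 0 \<le> c \<bullet> (u - x) + (\<nu> (x + s *\<^sub>R (u - x)) - \<nu> x) / s) (at_right 0)"
      unfolding eventually_at_right_field
    proof (intro exI[of _ 1] conjI allI impI)
      fix s :: real assume s: "0 < s" "s < 1"
      have "c \<bullet> x + \<nu> x \<le> c \<bullet> (x + s *\<^sub>R (u - x)) + \<nu> (x + s *\<^sub>R (u - x))"
        using s u S_subset by (intro min segment_in_W xW) auto
      then have "0 \<le> s * (c \<bullet> (u - x)) + (\<nu> (x + s *\<^sub>R (u - x)) - \<nu> x)"
        by (simp add: inner_simps)
      then show "0 \<le> c \<bullet> (u - x) + (\<nu> (x + s *\<^sub>R (u - x)) - \<nu> x) / s"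
        using s by (simp add: field_simps)
    qed simp
    ultimately have "0 \<le> c \<bullet> (u - x) + d\<nu> x \<bullet> (u - x)" by (intro tendsto_lowerbound) auto
    then show ?thesis by (simp add: inner_simps)
  qed
  obtain y where y: "\<And>n. y n \<in> S" "y \<longlonglongrightarrow> u" using S_approx[OF u] by blast
  have "(\<lambda>n. (c + d\<nu> x) \<bullet> (y n - x)) \<longlonglongrightarrow> (c + d\<nu> x) \<bullet> (u - x)"
    by (intro tendsto_intros y)
  then show ?thesis using *[OF y(1)] by (intro LIMSEQ_le_const) auto
qed

section \<open>The proximal map and the mirror descent step\<close>

definition prox :: "'a \<Rightarrow> 'a" where
  "prox c = (SOME x. is_arg_min (\<lambda>u. c \<bullet> u + \<nu> u) (\<lambda>u. u \<in> W) x)"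

lemma prox_arg_min: "is_arg_min (\<lambda>u. c \<bullet> u + \<nu> u) (\<lambda>u. u \<in> W) (prox c)"
proof -
  have "\<exists>x\<in>W. \<forall>y\<in>W. c \<bullet> x + \<nu> x \<le> c \<bullet> y + \<nu> y"
    by (intro continuous_attains_inf compact_W W_ne continuous_intros \<nu>_cont)
  then have "\<exists>x. is_arg_min (\<lambda>u. c \<bullet> u + \<nu> u) (\<lambda>u. u \<in> W) x"
    by (auto simp: is_arg_min_def not_less)
  then show ?thesis unfolding prox_def by (rule someI_ex)
qed

lemma prox_S: "prox c \<in> S" and prox_W: "prox c \<in> W"
  using linear_argmin_S[OF prox_arg_min] S_subset by auto

text \<open>The two variational inequalities, each tested at the other minimiser, are added; strong
  monotonicity of \<open>d\<nu>\<close> bounds the result from below. The case \<open>c = c'\<close>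
  gives uniqueness of the minimiser, the general case Lipschitz continuity of
  \<open>prox\<close>.\<close>

lemma linear_argmin_stable:
  assumes x: "is_arg_min (\<lambda>u. c \<bullet> u + \<nu> u) (\<lambda>u. u \<in> W) x"
    and y: "is_arg_min (\<lambda>u. c' \<bullet> u + \<nu> u) (\<lambda>u. u \<in> W) y"
  shows "(N (x - y))\<^sup>2 \<le> norm (c - c') * norm (x - y)"
proof -
  have S: "x \<in> S" "y \<in> S" using linear_argmin_S x y by auto
  have W: "x \<in> W" "y \<in> W" using S S_subset by auto
  have "0 \<le> (c + d\<nu> x) \<bullet> (y - x)" "0 \<le> (c' + d\<nu> y) \<bullet> (x - y)"
    by (intro linear_argmin_variational x y W)+
  moreover have "1 / 2 * (N (x - y))\<^sup>2 \<le> B x y" "1 / 2 * (N (x - y))\<^sup>2 \<le> B y x"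
    using bregman_lower[of y x] bregman_lower[of x y] S W N_diff_commute[of x y] by auto
  ultimately have "(N (x - y))\<^sup>2 \<le> (c - c') \<bullet> (y - x)"
    by (simp add: bregman_def inner_simps)
  then show ?thesis using norm_cauchy_schwarz[of "c - c'" "y - x"] by (simp add: norm_minus_commute)
qed

lemma linear_argmin_unique:
  "is_arg_min (\<lambda>u. c \<bullet> u + \<nu> u) (\<lambda>u. u \<in> W) x \<Longrightarrow> x = prox c"
  using linear_argmin_stable[OF _ prox_arg_min, of c x c] by simp

lemma continuous_on_prox: "continuous_on A prox"
proof -
  obtain k where k: "k > 0" "\<And>x. k * norm x \<le> N x" using norm_le_N by blast
  have "(1 / k\<^sup>2)-lipschitz_on A prox"
  proof (rule lipschitz_onI)
    fix c c'
    let ?d = "norm (prox c - prox c')"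
    have "(k * ?d)\<^sup>2 \<le> (N (prox c - prox c'))\<^sup>2" using k by (intro power_mono) auto
    also have "\<dots> \<le> norm (c - c') * ?d"
      by (intro linear_argmin_stable prox_arg_min)
    finally have "k\<^sup>2 * ?d * ?d \<le> norm (c - c') * ?d" by (simp add: power2_eq_square algebra_simps)
    then have "k\<^sup>2 * ?d \<le> norm (c - c')"
      using mult_right_le_imp_le[of "k\<^sup>2 * ?d" ?d "norm (c - c')"] by (cases "?d > 0") auto
    then show "dist (prox c) (prox c') \<le> 1 / k\<^sup>2 * dist c c'"
      using k by (simp add: dist_norm field_simps)
  qed simp
  then show ?thesis by (rule lipschitz_on_continuous_on)
qed

definition mirror_step :: "real \<Rightarrow> 'a \<Rightarrow> 'a \<Rightarrow> 'a" where
  "mirror_step \<eta> g v = prox (\<eta> *\<^sub>R g - d\<nu> v)"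

lemma mirror_step_S: "mirror_step \<eta> g v \<in> S" and mirror_step_W: "mirror_step \<eta> g v \<in> W"
  unfolding mirror_step_def by (rule prox_S prox_W)+

lemma mirror_step_unique:
  assumes "is_arg_min (\<lambda>u. \<eta> * (g \<bullet> (u - v)) + B u v) (\<lambda>u. u \<in> W) x"
  shows "x = mirror_step \<eta> g v"
proof -
  have "\<eta> * (g \<bullet> (u - v)) + B u v
      = ((\<eta> *\<^sub>R g - d\<nu> v) \<bullet> u + \<nu> u) + (d\<nu> v \<bullet> v - \<nu> v - \<eta> * (g \<bullet> v))" for u
    by (simp add: bregman_def inner_simps algebra_simps)
  then have "is_arg_min (\<lambda>u. (\<eta> *\<^sub>R g - d\<nu> v) \<bullet> u + \<nu> u) (\<lambda>u. u \<in> W) x"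
    using assms by (simp add: is_arg_min_def)
  then show ?thesis unfolding mirror_step_def by (rule linear_argmin_unique)
qed

text \<open>The variational inequality at the new point is the three-point inequality for
  \<open>B\<close>. The remaining term \<open>g \<bullet> (v - x)\<close> is split by Young's
  inequality, and its quadratic part is paid for by \<open>B x v\<close>. The size of
  \<open>g\<close> enters through pairings, so that gradients and noise are treated alike.\<close>

lemma mirror_step_descent:
  assumes v: "v \<in> S" and u: "u \<in> W" and \<eta>: "\<eta> \<ge> 0"
    and g: "\<And>x. \<bar>g \<bullet> x\<bar> \<le> c * N x"
  shows "\<eta> * (g \<bullet> (v - u)) \<le> B u v - B u (mirror_step \<eta> g v) + \<eta>\<^sup>2 * c\<^sup>2 / 2"
proof -
  define x where "x = mirror_step \<eta> g v"
  have xW: "x \<in> W" unfolding x_def by (rule mirror_step_W)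
  have "0 \<le> (\<eta> *\<^sub>R g - d\<nu> v + d\<nu> x) \<bullet> (u - x)"
    unfolding x_def mirror_step_def by (intro linear_argmin_variational prox_arg_min u)
  then have 1: "\<eta> * (g \<bullet> (x - u)) \<le> B u v - B u x - B x v"
    by (simp add: bregman_def inner_simps algebra_simps)
  have 2: "1 / 2 * (N (x - v))\<^sup>2 \<le> B x v" by (rule bregman_lower[OF v xW])
  have 3: "\<eta> * (g \<bullet> (v - x)) \<le> \<eta> * (c * N (x - v))"
    using g[of "v - x"] \<eta> N_diff_commute[of v x] by (intro mult_left_mono) auto
  have "0 \<le> (\<eta> * c - N (x - v))\<^sup>2" by simp
  then have "\<eta> * (c * N (x - v)) \<le> \<eta>\<^sup>2 * c\<^sup>2 / 2 + 1 / 2 * (N (x - v))\<^sup>2"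
    by (simp add: power2_eq_square algebra_simps)
  then have "\<eta> * (g \<bullet> (v - x)) + \<eta> * (g \<bullet> (x - u)) \<le> B u v - B u x + \<eta>\<^sup>2 * c\<^sup>2 / 2"
    using 1 2 3 by linarith
  then show ?thesis unfolding x_def[symmetric] by (simp add: inner_simps algebra_simps)
qed

text \<open>Since each loss is weighted by its own step size, the Bregman distances telescope
  although the steps vary; this is why the averages are weighted by step sizes.\<close>

lemma mirror_descent_regret:
  assumes x1: "x 1 = ow" and step: "\<And>j. j \<ge> 1 \<Longrightarrow> x (Suc j) = mirror_step (\<eta> j) (g j) (x j)"
    and \<eta>: "\<And>j. \<eta> j \<ge> 0" and u: "u \<in> W"
    and g: "\<And>j y. j \<in> {1..t} \<Longrightarrow> \<bar>g j \<bullet> y\<bar> \<le> c * N y"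
  shows "(\<Sum>j=1..t. \<eta> j * (g j \<bullet> (x j - u))) \<le> D\<^sup>2 + (\<Sum>j=1..t. (\<eta> j)\<^sup>2) * c\<^sup>2 / 2"
proof -
  have S: "x j \<in> S" if "j \<ge> 1" for j
  proof (cases "j = 1")
    case False
    then show ?thesis using that step[of "j - 1"] mirror_step_S by (cases j) auto
  qed (use x1 ow_S in simp)
  have "(\<Sum>j=1..t. \<eta> j * (g j \<bullet> (x j - u))) \<le> B u (x 1) - B u (x (Suc t)) + (\<Sum>j=1..t. (\<eta> j)\<^sup>2) * c\<^sup>2 / 2"
    using g
  proof (induction t)
    case (Suc t)
    have "\<eta> (Suc t) * (g (Suc t) \<bullet> (x (Suc t) - u))
        \<le> B u (x (Suc t)) - B u (x (Suc (Suc t))) + (\<eta> (Suc t))\<^sup>2 * c\<^sup>2 / 2"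
      using mirror_step_descent[OF S u \<eta> Suc.prems, of "Suc t" "Suc t" "Suc t"] step[of "Suc t"] by simp
    then show ?case using Suc by (simp add: algebra_simps add_divide_distrib)
  qed simp
  also have "\<dots> \<le> D\<^sup>2 + (\<Sum>j=1..t. (\<eta> j)\<^sup>2) * c\<^sup>2 / 2"
    using diameter[OF u] bregman_nonneg[OF S u, of "Suc t"] x1 by simp
  finally show ?thesis .
qed

end

section \<open>Entropic mirror descent on the simplex\<close>

declare One_nat_def [simp del]

definition kl_div :: "nat \<Rightarrow> (nat \<Rightarrow> real) \<Rightarrow> (nat \<Rightarrow> real) \<Rightarrow> real" where
  "kl_div m p q = (\<Sum>i=1..m. p i * (ln (p i) - ln (q i)))"

text \<open>Exponential weights, with \<open>g\<close> a gain and not a loss. The value 0 outside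
  \<open>{1..m}\<close> makes it an element of \<open>prob_simplex m\<close>, so it can be compared
  with the arg-min as a function.\<close>

definition entropic_step :: "nat \<Rightarrow> real \<Rightarrow> (nat \<Rightarrow> real) \<Rightarrow> (nat \<Rightarrow> real) \<Rightarrow> nat \<Rightarrow> real" where
  "entropic_step m \<eta> g q =
     (\<lambda>i. if i \<in> {1..m} then q i * exp (\<eta> * g i) / (\<Sum>k=1..m. q k * exp (\<eta> * g k)) else 0)"

text \<open>The relative interior of the simplex, where \<open>ln (q i)\<close> has its proper
  meaning; it is the invariant of the iterates.\<close>

definition pos_simplex :: "nat \<Rightarrow> (nat \<Rightarrow> real) set" where
  "pos_simplex m = {q \<in> prob_simplex m. \<forall>i\<in>{1..m}. 0 < q i}"

lemma prob_simplexD: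
  assumes "p \<in> prob_simplex m"
  shows "i \<in> {1..m} \<Longrightarrow> 0 \<le> p i" "(\<Sum>i=1..m. p i) = 1" "i \<notin> {1..m} \<Longrightarrow> p i = 0"
  using assms by (auto simp: prob_simplex_def)

lemma pos_simplexD:
  assumes "q \<in> pos_simplex m"
  shows "q \<in> prob_simplex m" "i \<in> {1..m} \<Longrightarrow> 0 < q i"
  using assms by (auto simp: pos_simplex_def)

lemma prob_simplex_le_1:
  assumes p: "p \<in> prob_simplex m" and i: "i \<in> {1..m}" shows "p i \<le> 1"
proof -
  have "p i \<le> (\<Sum>i=1..m. p i)" by (intro member_le_sum i prob_simplexD(1)[OF p]) auto
  then show ?thesis using prob_simplexD(2)[OF p] by simp
qed

lemma prob_simplex_l1_le_2:
  assumes p: "p \<in> prob_simplex m" and q: "q \<in> prob_simplex m"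
  shows "(\<Sum>i=1..m. \<bar>p i - q i\<bar>) \<le> 2"
proof -
  have "(\<Sum>i=1..m. \<bar>p i - q i\<bar>) \<le> (\<Sum>i=1..m. p i + q i)"
    using prob_simplexD(1)[OF p] prob_simplexD(1)[OF q] by (intro sum_mono) (auto simp: abs_le_iff)
  also have "\<dots> = 2" using prob_simplexD(2)[OF p] prob_simplexD(2)[OF q] by (simp add: sum.distrib)
  finally show ?thesis .
qed

text \<open>Both parts come from \<open>ln s \<le> s - 1\<close> at \<open>s = y / x\<close>, with
  equality only at \<open>s = 1\<close>. The case \<open>x = 0\<close> is separate: the left side is
  then \<open>- y\<close> and the right side 0.\<close>

lemma mult_ln_ratio_ge:
  fixes x y :: real
  assumes "0 \<le> x" "0 < y"
  shows "x - y \<le> x * (ln x - ln y)"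
    and "x * (ln x - ln y) = x - y \<Longrightarrow> x = y"
proof -
  have *: "x * (ln x - ln y) - (x - y) = x * ((y / x - 1) - ln (y / x))" if "x > 0"
    using assms that by (simp add: ln_div field_simps)
  show "x - y \<le> x * (ln x - ln y)"
  proof (cases "x = 0")
    case False
    then have "ln (y / x) \<le> y / x - 1" using assms by (intro ln_le_minus_one) simp
    then have "0 \<le> x * ((y / x - 1) - ln (y / x))" using assms by simp
    then show ?thesis using * False assms by simp
  qed (use assms in simp)
  show "x = y" if "x * (ln x - ln y) = x - y"
  proof (cases "x = 0")
    case False
    then have "ln (y / x) = y / x - 1" using * that assms by auto
    then have "y / x = 1" using assms False by (intro ln_eq_minus_one) auto
    then show ?thesis using False by simp
  qed (use assms that in simp)
qed

text \<open>Both vectors sum to 1, so subtracting \<open>p i - q i\<close> from each summand leaves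
  the total unchanged and makes every summand nonnegative. A zero total then forces equality in each
  coordinate.\<close>

lemma kl_div_nonneg:
  assumes p: "p \<in> prob_simplex m" and q: "q \<in> pos_simplex m"
  shows "0 \<le> kl_div m p q" and "kl_div m p q = 0 \<Longrightarrow> p = q"
proof -
  have q': "q \<in> prob_simplex m" using q by (rule pos_simplexD)
  have eq: "kl_div m p q = (\<Sum>i=1..m. p i * (ln (p i) - ln (q i)) - (p i - q i))"
    using prob_simplexD(2)[OF p] prob_simplexD(2)[OF q'] by (simp add: kl_div_def sum_subtractf)
  have nn: "0 \<le> p i * (ln (p i) - ln (q i)) - (p i - q i)" if "i \<in> {1..m}" for i
    using mult_ln_ratio_ge(1)[of "p i" "q i"] prob_simplexD(1)[OF p that] pos_simplexD(2)[OF q that] by simp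
  show "0 \<le> kl_div m p q" unfolding eq by (intro sum_nonneg nn)
  assume "kl_div m p q = 0"
  then have z: "\<forall>i\<in>{1..m}. p i * (ln (p i) - ln (q i)) - (p i - q i) = 0"
    unfolding eq using nn by (subst (asm) sum_nonneg_eq_0_iff) auto
  show "p = q"
  proof
    fix i show "p i = q i"
    proof (cases "i \<in> {1..m}")
      case True
      then show ?thesis
        using mult_ln_ratio_ge(2)[of "p i" "q i"] prob_simplexD(1)[OF p True] pos_simplexD(2)[OF q True] z
        by simp
    qed (use prob_simplexD(3)[OF p] prob_simplexD(3)[OF q'] in auto)
  qed
qed

lemma bregman_entropy_eq_kl_div:
  assumes p: "p \<in> prob_simplex m" and q: "q \<in> prob_simplex m"
  shows "bregman_entropy m p q = kl_div m p q"
proof -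
  have "(\<Sum>i=1..m. (ln (q i) + 1) * (p i - q i))
      = (\<Sum>i=1..m. p i * ln (q i)) - (\<Sum>i=1..m. q i * ln (q i)) + ((\<Sum>i=1..m. p i) - (\<Sum>i=1..m. q i))"
    by (simp add: sum.distrib[symmetric] sum_subtractf[symmetric] algebra_simps)
  then show ?thesis
    using prob_simplexD(2)[OF p] prob_simplexD(2)[OF q]
    by (simp add: bregman_entropy_def neg_entropy_def kl_div_def algebra_simps sum_subtractf)
qed

lemma uniform_pos_simplex: "m \<ge> 1 \<Longrightarrow> (\<lambda>i. if i \<in> {1..m} then 1 / real m else 0) \<in> pos_simplex m"
  by (auto simp: pos_simplex_def prob_simplex_def)

text \<open>The counterpart of the diameter bound \<open>D\<^sup>2\<close>: entropy terms are
  nonpositive, so only the logarithm of the uniform weights remains.\<close>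

lemma kl_div_uniform_le:
  assumes p: "p \<in> prob_simplex m" and m: "m \<ge> 1"
  shows "kl_div m p (\<lambda>i. if i \<in> {1..m} then 1 / real m else 0) \<le> ln (real m)"
proof -
  have "kl_div m p (\<lambda>i. if i \<in> {1..m} then 1 / real m else 0) = (\<Sum>i=1..m. p i * (ln (p i) + ln (real m)))"
    unfolding kl_div_def using m by (intro sum.cong) (auto simp: ln_div)
  also have "\<dots> \<le> (\<Sum>i=1..m. p i * ln (real m))"
  proof (intro sum_mono mult_left_mono)
    fix i assume i: "i \<in> {1..m}"
    have "ln (p i) \<le> 0" using prob_simplex_le_1[OF p i] prob_simplexD(1)[OF p i]
      by (cases "p i = 0") auto
    then show "ln (p i) + ln (real m) \<le> ln (real m)" by simp
    show "0 \<le> p i" using prob_simplexD(1)[OF p i] .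
  qed
  also have "\<dots> = ln (real m)" using prob_simplexD(2)[OF p] by (simp add: sum_distrib_right[symmetric])
  finally show ?thesis .
qed

section \<open>The exponential weights update\<close>

context
  fixes m :: nat and q :: "nat \<Rightarrow> real" and \<eta> :: real and g :: "nat \<Rightarrow> real"
  assumes q: "q \<in> pos_simplex m"
begin

lemma exp_weight_sum_pos: "0 < (\<Sum>k=1..m. q k * exp (\<eta> * g k))"
proof -
  have "m \<noteq> 0" using prob_simplexD(2)[OF pos_simplexD(1)[OF q]] by (cases m) auto
  then show ?thesis using pos_simplexD(2)[OF q] by (intro sum_pos) auto
qed

lemma entropic_step_pos_simplex: "entropic_step m \<eta> g q \<in> pos_simplex m"
proof -
  have "(\<Sum>i=1..m. entropic_step m \<eta> g q i) = 1"
    using exp_weight_sum_pos by (simp add: entropic_step_def sum_divide_distrib[symmetric])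
  moreover have "0 < entropic_step m \<eta> g q i" if "i \<in> {1..m}" for i
    using exp_weight_sum_pos pos_simplexD(2)[OF q that] that by (simp add: entropic_step_def)
  moreover have "entropic_step m \<eta> g q i = 0" if "i \<notin> {1..m}" for i
    using that unfolding entropic_step_def by (rule if_not_P)
  ultimately show ?thesis
    unfolding pos_simplex_def prob_simplex_def by (auto simp: less_imp_le)
qed

text \<open>The logarithm of the new weight is \<open>ln (q i) + \<eta> * g i\<close> minus the
  log-partition value, so the divergence changes by an exact expression affine in \<open>p\<close>.
  Both the closed form of the arg-min and the regret estimate are read off from it.\<close>

lemma kl_div_entropic_step:
  assumes p: "p \<in> prob_simplex m"
  shows "kl_div m p (entropic_step m \<eta> g q)
    = kl_div m p q - \<eta> * (\<Sum>i=1..m. g i * p i) + ln (\<Sum>k=1..m. q k * exp (\<eta> * g k))"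
proof -
  let ?Z = "\<Sum>k=1..m. q k * exp (\<eta> * g k)"
  have "kl_div m p (entropic_step m \<eta> g q) = (\<Sum>i=1..m. p i * (ln (p i) - ln (q i)) - \<eta> * (g i * p i) + p i * ln ?Z)"
    unfolding kl_div_def
  proof (intro sum.cong refl)
    fix i assume i: "i \<in> {1..m}"
    have "ln (entropic_step m \<eta> g q i) = ln (q i) + \<eta> * g i - ln ?Z"
      using i exp_weight_sum_pos pos_simplexD(2)[OF q i] by (simp add: entropic_step_def ln_div ln_mult)
    then show "p i * (ln (p i) - ln (entropic_step m \<eta> g q i))
        = p i * (ln (p i) - ln (q i)) - \<eta> * (g i * p i) + p i * ln ?Z"
      by (simp only: right_diff_distrib distrib_left) simp
  qed
  also have "\<dots> = kl_div m p q - \<eta> * (\<Sum>i=1..m. g i * p i) + (\<Sum>i=1..m. p i) * ln ?Z"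
    unfolding kl_div_def sum.distrib sum_subtractf by (simp add: sum_distrib_left sum_distrib_right)
  finally show ?thesis using prob_simplexD(2)[OF p] by simp
qed

text \<open>On the simplex the objective equals the divergence to the claimed minimiser plus a
  constant, so the equality case of \<open>kl_div_nonneg\<close> identifies the arg-min without
  Lagrange multipliers.\<close>

lemma entropic_step_unique:
  assumes x: "is_arg_min (\<lambda>p. \<eta> * (\<Sum>i=1..m. - g i * (p i - q i)) + bregman_entropy m p q)
    (\<lambda>p. p \<in> prob_simplex m) x"
  shows "x = entropic_step m \<eta> g q"
proof -
  let ?s = "entropic_step m \<eta> g q"
  let ?C = "\<eta> * (\<Sum>i=1..m. g i * q i) - ln (\<Sum>k=1..m. q k * exp (\<eta> * g k))"
  have obj: "\<eta> * (\<Sum>i=1..m. - g i * (p i - q i)) + bregman_entropy m p q = kl_div m p ?s + ?C"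
    if p: "p \<in> prob_simplex m" for p
  proof -
    have "(\<Sum>i=1..m. - g i * (p i - q i)) = (\<Sum>i=1..m. g i * q i) - (\<Sum>i=1..m. g i * p i)"
      by (simp add: sum_subtractf[symmetric] right_diff_distrib)
    then show ?thesis
      using bregman_entropy_eq_kl_div[OF p pos_simplexD(1)[OF q]] kl_div_entropic_step[OF p]
      by (simp only: right_diff_distrib)
  qed
  have xS: "x \<in> prob_simplex m" and sS: "?s \<in> prob_simplex m"
    using x entropic_step_pos_simplex pos_simplexD by (auto simp: is_arg_min_def)
  have "kl_div m x ?s + ?C \<le> kl_div m ?s ?s + ?C"
    unfolding obj[OF xS, symmetric] obj[OF sS, symmetric]
    using x sS by (auto simp: is_arg_min_def not_less)
  moreover have "kl_div m ?s ?s = 0" by (simp add: kl_div_def)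
  ultimately have "kl_div m x ?s = 0"
    using kl_div_nonneg(1)[OF xS entropic_step_pos_simplex] by simp
  then show ?thesis by (rule kl_div_nonneg(2)[OF xS entropic_step_pos_simplex])
qed

text \<open>Hoeffding's lemma for the distribution \<open>q\<close>, obtained from the chord of \<open>exp\<close>.\<close>

lemma ln_exp_weight_sum_le:
  assumes \<eta>: "\<eta> \<ge> 0" and c: "c > 0" and g: "\<And>i. i \<in> {1..m} \<Longrightarrow> \<bar>g i\<bar> \<le> c"
  shows "ln (\<Sum>k=1..m. q k * exp (\<eta> * g k)) \<le> \<eta> * (\<Sum>k=1..m. g k * q k) + \<eta>\<^sup>2 * c\<^sup>2 / 2"
proof -
  note q' = prob_simplexD[OF pos_simplexD(1)[OF q]]
  let ?\<mu> = "\<Sum>k=1..m. g k * q k"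
  \<comment> \<open>\<open>r\<close> is the mean of \<open>g\<close> rescaled from
    \<open>[- c, c]\<close> to \<open>[0, 1]\<close> and \<open>h\<close> is \<open>\<eta>\<close>
    times the interval length; in these terms the bound is
    \<open>ln (1 + r * (exp h - 1)) \<le> h * r + h\<^sup>2 / 8\<close>.\<close>
  define r where "r = (1 + ?\<mu> / c) / 2"
  define h where "h = 2 * \<eta> * c"
  have "- c \<le> ?\<mu>"
  proof -
    have "(\<Sum>k=1..m. - c * q k) \<le> ?\<mu>"
      using g q'(1) by (intro sum_mono mult_right_mono) (auto simp: abs_le_iff, smt (verit))
    then show ?thesis using q'(2) by (simp add: sum_distrib_left[symmetric] sum_negf)
  qed
  then have r: "r \<ge> 0" using c by (simp add: r_def field_simps)
  have chord: "exp (\<eta> * g k) \<le> exp (- (\<eta> * c)) * (1 + (1 + g k / c) / 2 * (exp h - 1))"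
    if k: "k \<in> {1..m}" for k
  proof -
    define y where "y = (1 + g k / c) / 2"
    have gk: "- c \<le> g k" "g k \<le> c" using g[OF k] by auto
    then have y: "0 \<le> y" "y \<le> 1" using c by (auto simp: y_def field_simps)
    have "exp (\<eta> * ((1 - y) *\<^sub>R (- c) + y *\<^sub>R c)) \<le> (1 - y) * exp (\<eta> * (- c)) + y * exp (\<eta> * c)"
      by (rule convex_onD[OF convex_on_exp[OF \<eta>]]) (use y in auto)
    also have "(1 - y) *\<^sub>R (- c) + y *\<^sub>R c = g k" using c by (simp add: y_def field_simps)
    also have "exp (\<eta> * c) = exp (- (\<eta> * c)) * exp h" by (simp add: h_def exp_add[symmetric])
    finally show ?thesis by (simp add: y_def[symmetric] algebra_simps)
  qed
  have "(\<Sum>k=1..m. q k * exp (\<eta> * g k))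
      \<le> (\<Sum>k=1..m. q k * (exp (- (\<eta> * c)) * (1 + (1 + g k / c) / 2 * (exp h - 1))))"
    by (intro sum_mono mult_left_mono chord q'(1))
  also have "\<dots> = exp (- (\<eta> * c)) * ((\<Sum>k=1..m. q k) + ((\<Sum>k=1..m. q k) + ?\<mu> / c) / 2 * (exp h - 1))"
    by (simp add: sum_distrib_left sum_distrib_right sum.distrib[symmetric] sum_divide_distrib algebra_simps)
  also have "\<dots> = exp (- (\<eta> * c)) * (1 + r * (exp h - 1))"
    by (simp add: q'(2) r_def)
  finally have le: "(\<Sum>k=1..m. q k * exp (\<eta> * g k)) \<le> exp (- (\<eta> * c)) * (1 + r * (exp h - 1))" .
  have h: "h \<ge> 0" using \<eta> c by (simp add: h_def)
  have pos: "1 + r * (exp h - 1) > 0" using r h by (intro add_pos_nonneg mult_nonneg_nonneg) auto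
  have "ln (\<Sum>k=1..m. q k * exp (\<eta> * g k)) \<le> ln (exp (- (\<eta> * c)) * (1 + r * (exp h - 1)))"
    using le exp_weight_sum_pos pos by (intro ln_mono) auto
  also have "\<dots> = - (\<eta> * c) + ln (1 + r * (exp h - 1))" using pos by (simp add: ln_mult)
  also have "\<dots> \<le> - (\<eta> * c) + h * r + h\<^sup>2 / 8"
    using Hoeffdings_lemma_aux[OF h r] by simp
  also have "\<dots> = \<eta> * ?\<mu> + \<eta>\<^sup>2 * c\<^sup>2 / 2"
    using c by (simp add: h_def r_def field_simps power2_eq_square)
  finally show ?thesis .
qed

text \<open>Same shape as \<open>mirror_step_descent\<close>: the log-partition estimate takes the
  place of strong convexity, with \<open>c\<close> now bounding the coordinates of
  \<open>g\<close>.\<close>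

lemma entropic_step_descent:
  assumes p: "p \<in> prob_simplex m" and \<eta>: "\<eta> \<ge> 0" and c: "c > 0"
    and g: "\<And>i. i \<in> {1..m} \<Longrightarrow> \<bar>g i\<bar> \<le> c"
  shows "\<eta> * (\<Sum>i=1..m. g i * (p i - q i))
    \<le> kl_div m p q - kl_div m p (entropic_step m \<eta> g q) + \<eta>\<^sup>2 * c\<^sup>2 / 2"
  using ln_exp_weight_sum_le[OF \<eta> c g] kl_div_entropic_step[OF p]
  by (simp add: right_diff_distrib sum_subtractf)

end

lemma entropic_regret:
  assumes m: "m \<ge> 1" and x1: "x 1 = (\<lambda>i. if i \<in> {1..m} then 1 / real m else 0)"
    and step: "\<And>j. j \<ge> 1 \<Longrightarrow> x (Suc j) = entropic_step m (\<eta> j) (g j) (x j)"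
    and \<eta>: "\<And>j. \<eta> j \<ge> 0" and p: "p \<in> prob_simplex m" and c: "c > 0"
    and g: "\<And>j i. j \<in> {1..t} \<Longrightarrow> i \<in> {1..m} \<Longrightarrow> \<bar>g j i\<bar> \<le> c"
  shows "(\<Sum>j=1..t. \<eta> j * (\<Sum>i=1..m. g j i * (p i - x j i))) \<le> ln (real m) + (\<Sum>j=1..t. (\<eta> j)\<^sup>2) * c\<^sup>2 / 2"
proof -
  \<comment> \<open>The run begins at index 1 and nothing is known about \<open>x 0\<close>, hence
    the shifted index.\<close>
  have S: "x (Suc j) \<in> pos_simplex m" for j
  proof (induction j)
    case 0
    then show ?case using uniform_pos_simplex[OF m] unfolding x1 One_nat_def[symmetric] .
  next
    case (Suc j)
    then show ?case using step[of "Suc j"] entropic_step_pos_simplex by simp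
  qed
  have "(\<Sum>j=1..t. \<eta> j * (\<Sum>i=1..m. g j i * (p i - x j i)))
      \<le> kl_div m p (x 1) - kl_div m p (x (Suc t)) + (\<Sum>j=1..t. (\<eta> j)\<^sup>2) * c\<^sup>2 / 2"
    using g
  proof (induction t)
    case (Suc t)
    have g': "\<bar>g (Suc t) i\<bar> \<le> c" if "i \<in> {1..m}" for i using Suc.prems that by simp
    have "\<eta> (Suc t) * (\<Sum>i=1..m. g (Suc t) i * (p i - x (Suc t) i))
        \<le> kl_div m p (x (Suc t)) - kl_div m p (x (Suc (Suc t))) + (\<eta> (Suc t))\<^sup>2 * c\<^sup>2 / 2"
      using entropic_step_descent[OF S[of t] p \<eta>[of "Suc t"] c g'] step[of "Suc t"] by simp
    then show ?case using Suc by (simp add: algebra_simps add_divide_distrib)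
  qed (simp add: One_nat_def)
  also have "\<dots> \<le> ln (real m) + (\<Sum>j=1..t. (\<eta> j)\<^sup>2) * c\<^sup>2 / 2"
    using kl_div_uniform_le[OF p m] kl_div_nonneg(1)[OF p S, of t] x1 by simp
  finally show ?thesis .
qed

section \<open>Bounded martingale differences\<close>

text \<open>Freezing the past: the product rule says that the pair of \<open>\<omega>\<close>,
  observed only through \<open>F\<close>, and \<open>Y \<omega>\<close> has a product law. Tonelli
  then integrates over \<open>Y\<close> with \<open>\<omega>\<close> fixed, which replaces
  conditional expectations.\<close>

lemma (in prob_space) nn_integral_indep_past:
  assumes sp: "space F = space M" and sub: "sets F \<subseteq> sets M" and Y [measurable]: "Y \<in> measurable M B"
    and ind: "\<And>C C'. C \<in> sets F \<Longrightarrow> C' \<in> sets B \<Longrightarrow>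
      prob (C \<inter> (Y -` C' \<inter> space M)) = prob C * prob (Y -` C' \<inter> space M)"
    and h [measurable]: "h \<in> borel_measurable (F \<Otimes>\<^sub>M B)"
  shows "(\<integral>\<^sup>+\<omega>. h (\<omega>, Y \<omega>) \<partial>M) = (\<integral>\<^sup>+\<omega>. \<integral>\<^sup>+y. h (\<omega>, y) \<partial>distr M B Y \<partial>M)"
proof -
  have id [measurable]: "(\<lambda>\<omega>. \<omega>) \<in> measurable M F"
  proof (rule measurableI)
    fix C assume C: "C \<in> sets F"
    then have "(\<lambda>\<omega>. \<omega>) -` C \<inter> space M = C" using sets.sets_into_space[OF C] sp by auto
    then show "(\<lambda>\<omega>. \<omega>) -` C \<inter> space M \<in> sets M" using C sub by auto
  qed (simp add: sp)
  interpret Y: prob_space "distr M B Y" by (rule prob_space_distr) simp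
  interpret I: prob_space "distr M F (\<lambda>\<omega>. \<omega>)" by (rule prob_space_distr) simp
  have prod: "distr M F (\<lambda>\<omega>. \<omega>) \<Otimes>\<^sub>M distr M B Y = distr M (F \<Otimes>\<^sub>M B) (\<lambda>\<omega>. (\<omega>, Y \<omega>))"
  proof (rule pair_measure_eqI)
    show "sets (distr M F (\<lambda>\<omega>. \<omega>) \<Otimes>\<^sub>M distr M B Y) = sets (distr M (F \<Otimes>\<^sub>M B) (\<lambda>\<omega>. (\<omega>, Y \<omega>)))"
      by (simp cong: sets_pair_measure_cong)
  next
    fix C C' assume "C \<in> sets (distr M F (\<lambda>\<omega>. \<omega>))" "C' \<in> sets (distr M B Y)"
    then have C: "C \<in> sets F" and C': "C' \<in> sets B" by auto
    have CM: "C \<inter> space M = C" "C \<in> sets M" using sets.sets_into_space[OF C] sp C sub by auto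
    have "(\<lambda>\<omega>. (\<omega>, Y \<omega>)) -` (C \<times> C') \<inter> space M = C \<inter> (Y -` C' \<inter> space M)" using CM by auto
    then have "emeasure (distr M (F \<Otimes>\<^sub>M B) (\<lambda>\<omega>. (\<omega>, Y \<omega>))) (C \<times> C') = ennreal (prob (C \<inter> (Y -` C' \<inter> space M)))"
      using C C' by (subst emeasure_distr) (auto simp: emeasure_eq_measure)
    also have "\<dots> = emeasure (distr M F (\<lambda>\<omega>. \<omega>)) C * emeasure (distr M B Y) C'"
      using C C' CM by (simp add: ind emeasure_distr emeasure_eq_measure ennreal_mult)
    finally show "emeasure (distr M F (\<lambda>\<omega>. \<omega>)) C * emeasure (distr M B Y) C'
        = emeasure (distr M (F \<Otimes>\<^sub>M B) (\<lambda>\<omega>. (\<omega>, Y \<omega>))) (C \<times> C')" ..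
  qed (rule I.sigma_finite_measure_axioms Y.sigma_finite_measure_axioms)+
  have "(\<integral>\<^sup>+\<omega>. h (\<omega>, Y \<omega>) \<partial>M) = (\<integral>\<^sup>+x. h x \<partial>distr M (F \<Otimes>\<^sub>M B) (\<lambda>\<omega>. (\<omega>, Y \<omega>)))"
    by (subst nn_integral_distr) auto
  also have "\<dots> = (\<integral>\<^sup>+\<omega>. \<integral>\<^sup>+y. h (\<omega>, y) \<partial>distr M B Y \<partial>distr M F (\<lambda>\<omega>. \<omega>))"
    unfolding prod[symmetric] by (subst Y.nn_integral_fst[symmetric]) auto
  also have "\<dots> = (\<integral>\<^sup>+\<omega>. \<integral>\<^sup>+y. h (\<omega>, y) \<partial>distr M B Y \<partial>M)"
    by (rule nn_integral_distr) (auto intro!: Y.borel_measurable_nn_integral)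
  finally show ?thesis .
qed

section \<open>Subgaussian variables: tails, expected maxima, means\<close>

context prob_space
begin

text \<open>One-sided (\<open>l > 0\<close>), as only upper deviations get bounded; with nonnegative
  integrals the integrability of the exponentials is part of the inequality.\<close>

definition subgaussian :: "('a \<Rightarrow> real) \<Rightarrow> real \<Rightarrow> bool" where
  "subgaussian X v \<longleftrightarrow> X \<in> borel_measurable M \<and>
     (\<forall>l>0. (\<integral>\<^sup>+\<omega>. ennreal (exp (l * X \<omega>)) \<partial>M) \<le> ennreal (exp (l\<^sup>2 * v / 2)))"

lemma subgaussian_measurable: "subgaussian X v \<Longrightarrow> X \<in> borel_measurable M"
  and subgaussian_mgf: "subgaussian X v \<Longrightarrow> l > 0 \<Longrightarrow>
    (\<integral>\<^sup>+\<omega>. ennreal (exp (l * X \<omega>)) \<partial>M) \<le> ennreal (exp (l\<^sup>2 * v / 2))"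
  by (auto simp: subgaussian_def)

lemma subgaussian_mono:
  assumes "subgaussian X v" "v \<le> v'" shows "subgaussian X v'"
proof -
  have "exp (l\<^sup>2 * v / 2) \<le> exp (l\<^sup>2 * v' / 2)" for l :: real
    using assms(2) by (simp add: mult_left_mono)
  then show ?thesis
    using assms(1) unfolding subgaussian_def by (meson ennreal_leI order_trans)
qed

text \<open>Chernoff's bound at \<open>l = ?s / v\<close>, which minimises
  \<open>l\<^sup>2 * v / 2 - l * ?s\<close>; the threshold is chosen to make that minimum
  \<open>- L\<close>.\<close>

lemma subgaussian_tail:
  assumes X: "subgaussian X v" and v: "v > 0" and L: "L > 0"
  shows "prob {\<omega> \<in> space M. sqrt (2 * v * L) < X \<omega>} \<le> exp (- L)"
proof -
  note [measurable] = subgaussian_measurable[OF X]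
  let ?s = "sqrt (2 * v * L)" and ?A = "{\<omega> \<in> space M. sqrt (2 * v * L) < X \<omega>}"
  define l where "l = ?s / v"
  have s: "?s > 0" and l: "l > 0" using v L by (auto simp: l_def)
  have s2: "?s\<^sup>2 = 2 * v * L" using v L by simp
  have "ennreal (exp (l * ?s)) * emeasure M ?A = (\<integral>\<^sup>+\<omega>. ennreal (exp (l * ?s)) * indicator ?A \<omega> \<partial>M)"
    by (subst nn_integral_cmult_indicator) auto
  also have "\<dots> \<le> (\<integral>\<^sup>+\<omega>. ennreal (exp (l * X \<omega>)) \<partial>M)"
    using l by (intro nn_integral_mono) (auto simp: indicator_def)
  also have "\<dots> \<le> ennreal (exp (l\<^sup>2 * v / 2))" by (rule subgaussian_mgf[OF X l])
  finally have "ennreal (exp (l * ?s) * prob ?A) \<le> ennreal (exp (l\<^sup>2 * v / 2))"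
    by (simp add: emeasure_eq_measure ennreal_mult)
  then have "exp (l * ?s) * prob ?A \<le> exp (l\<^sup>2 * v / 2)" by (subst (asm) ennreal_le_iff) auto
  moreover have "l * ?s = 2 * L" using v s2 by (simp add: l_def power2_eq_square)
  moreover have "l\<^sup>2 * v / 2 = L" using v s2 by (simp add: l_def power_divide power2_eq_square[of v])
  ultimately have "exp (2 * L) * prob ?A \<le> exp L" by simp
  then have "prob ?A \<le> exp L / exp (2 * L)" by (simp add: field_simps)
  also have "\<dots> = exp (- L)" by (simp add: exp_diff[symmetric])
  finally show ?thesis .
qed

text \<open>The tangent of \<open>ln\<close> at \<open>c\<close>, an upper bound for the expected
  sum of the exponentials, takes the place of Jensen's inequality: it bounds \<open>l * Z\<close> by
  an integrable expression affine in that sum. Which \<open>X i\<close> dominates \<open>Z\<close>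
  may vary with \<open>\<omega>\<close>.\<close>

lemma expectation_max_subgaussian:
  assumes I: "finite I" "I \<noteq> {}" and X: "\<And>i. i \<in> I \<Longrightarrow> subgaussian (X i) v"
    and Z: "integrable M Z" "AE \<omega> in M. \<exists>i\<in>I. Z \<omega> \<le> X i \<omega>" and l: "l > 0"
  shows "expectation Z \<le> ln (real (card I)) / l + l * v / 2"
proof -
  let ?e = "exp (l\<^sup>2 * v / 2)"
  define c where "c = real (card I) * ?e"
  have card: "real (card I) > 0" using I by (simp add: card_gt_0_iff)
  then have c: "c > 0" by (simp add: c_def)
  have lnc: "ln c = ln (real (card I)) + l\<^sup>2 * v / 2" using card by (simp add: c_def ln_mult)
  have int: "integrable M (\<lambda>\<omega>. exp (l * X i \<omega>))" and ex: "expectation (\<lambda>\<omega>. exp (l * X i \<omega>)) \<le> ?e"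
    if i: "i \<in> I" for i
  proof -
    note [measurable] = subgaussian_measurable[OF X[OF i]]
    have le: "(\<integral>\<^sup>+\<omega>. ennreal (exp (l * X i \<omega>)) \<partial>M) \<le> ennreal ?e" by (rule subgaussian_mgf[OF X[OF i] l])
    show int: "integrable M (\<lambda>\<omega>. exp (l * X i \<omega>))"
      by (rule integrableI_nonneg) (use le_less_trans[OF le ennreal_less_top] in auto)
    show "expectation (\<lambda>\<omega>. exp (l * X i \<omega>)) \<le> ?e"
      using le nn_integral_eq_integral[OF int] by simp
  qed
  have "AE \<omega> in M. l * Z \<omega> \<le> (ln c - 1) + (\<Sum>i\<in>I. exp (l * X i \<omega>)) / c"
    using Z(2)
  proof eventually_elim
    case (elim \<omega>)
    then obtain i where i: "i \<in> I" "Z \<omega> \<le> X i \<omega>" by blast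
    have "l * X i \<omega> - ln c = ln (exp (l * X i \<omega>) / c)" using c by (simp add: ln_div)
    also have "\<dots> \<le> exp (l * X i \<omega>) / c - 1" using c by (intro ln_le_minus_one) simp
    also have "\<dots> \<le> (\<Sum>i\<in>I. exp (l * X i \<omega>)) / c - 1"
      using c I i by (intro diff_right_mono divide_right_mono member_le_sum) auto
    finally show ?case using i(2) l mult_left_mono[of "Z \<omega>" "X i \<omega>" l] by linarith
  qed
  then have "expectation (\<lambda>\<omega>. l * Z \<omega>) \<le> expectation (\<lambda>\<omega>. (ln c - 1) + (\<Sum>i\<in>I. exp (l * X i \<omega>)) / c)"
    using Z int by (intro integral_mono_AE) auto
  also have "\<dots> = (ln c - 1) + (\<Sum>i\<in>I. expectation (\<lambda>\<omega>. exp (l * X i \<omega>))) / c"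
    using int by (simp add: prob_space Bochner_Integration.integral_add Bochner_Integration.integral_sum)
  also have "\<dots> \<le> (ln c - 1) + (\<Sum>i\<in>I. ?e) / c"
    using c ex by (intro add_left_mono divide_right_mono sum_mono) auto
  also have "\<dots> = ln c" using card by (simp add: c_def)
  finally have "l * expectation Z \<le> ln (real (card I)) + l\<^sup>2 * v / 2" by (simp add: lnc)
  then have "expectation Z \<le> (ln (real (card I)) + l\<^sup>2 * v / 2) / l"
    using l by (simp add: field_simps)
  also have "\<dots> = ln (real (card I)) / l + l * v / 2"
    using l by (simp add: add_divide_distrib power2_eq_square)
  finally show ?thesis .
qed

text \<open>The case of a single variable, with \<open>l\<close> tending to 0. It controls the mean
  of anything below a martingale sum from exponential moments alone.\<close>

lemma expectation_subgaussian_le_0: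
  assumes X: "subgaussian X v" and int: "integrable M Y" and le: "AE \<omega> in M. Y \<omega> \<le> X \<omega>"
  shows "expectation Y \<le> 0"
proof (rule field_le_epsilon)
  fix e :: real assume e: "e > 0"
  have "expectation Y \<le> l * v / 2" if "l > 0" for l
    using expectation_max_subgaussian[of "{()}" "\<lambda>_. X" v Y l] X int le that by simp
  \<comment> \<open>The denominator \<open>\<bar>v\<bar> + 1\<close> keeps \<open>l\<close> positive
    and well defined whatever the value and sign of \<open>v\<close>.\<close>
  from this[of "e / (\<bar>v\<bar> + 1)"] have "expectation Y \<le> e * (v / (\<bar>v\<bar> + 1)) / 2" using e by simp
  also have "\<dots> \<le> e * 1 / 2" using e by (intro divide_right_mono mult_left_mono) (auto simp: field_simps)
  finally show "expectation Y \<le> 0 + e" using e by simp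
qed

end

text \<open>\<open>F t\<close> is the information available before the draw \<open>Y t\<close>: that
  draw is independent of \<open>F t\<close>, and only draws with \<open>s < t\<close> are measurable
  in it. Independence is phrased as a product rule on events, the form that
  \<open>nn_integral_indep_past\<close> consumes.\<close>

locale adapted_sampling = prob_space M for M :: "'s measure" +
  fixes F :: "nat \<Rightarrow> 's measure" and B :: "'y measure" and Y :: "nat \<Rightarrow> 's \<Rightarrow> 'y"
  assumes space_F: "space (F t) = space M"
    and F_mono: "s \<le> t \<Longrightarrow> sets (F s) \<subseteq> sets (F t)"
    and F_sub: "sets (F t) \<subseteq> sets M"
    and Y_measurable [measurable]: "t \<ge> 1 \<Longrightarrow> Y t \<in> measurable M B"
    and indep: "t \<ge> 1 \<Longrightarrow> C \<in> sets (F t) \<Longrightarrow> C' \<in> sets B \<Longrightarrow>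
      prob (C \<inter> (Y t -` C' \<inter> space M)) = prob C * prob (Y t -` C' \<inter> space M)"
    and Y_adapted: "1 \<le> s \<Longrightarrow> s < t \<Longrightarrow> Y s \<in> measurable (F t) B"
begin

lemma measurable_F_M: "f \<in> measurable (F t) A \<Longrightarrow> f \<in> measurable M A"
  using F_sub[of t] space_F by (auto simp: measurable_def)

lemma measurable_F_mono: "s \<le> t \<Longrightarrow> f \<in> measurable (F s) A \<Longrightarrow> f \<in> measurable (F t) A"
  using F_mono[of s t] space_F by (auto simp: measurable_def)

text \<open>The increment is a function of the past \<open>\<omega>\<close> and of the fresh draw
  \<open>y\<close> separately. Boundedness and centring are required for each frozen
  \<open>\<omega>\<close> under the law of the draw, so no conditional expectation appears.\<close>

definition martingale_diff :: "nat \<Rightarrow> real \<Rightarrow> ('s \<Rightarrow> 'y \<Rightarrow> real) \<Rightarrow> bool" where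
  "martingale_diff j c f \<longleftrightarrow> (\<lambda>(\<omega>, y). f \<omega> y) \<in> borel_measurable (F j \<Otimes>\<^sub>M B) \<and>
     (\<forall>\<omega>\<in>space M. (AE y in distr M B (Y j). \<bar>f \<omega> y\<bar> \<le> c) \<and> (\<integral>y. f \<omega> y \<partial>distr M B (Y j)) = 0)"

lemma martingale_diff_measurable_F:
  assumes j: "1 \<le> j" "j < t" and f: "martingale_diff j c f"
  shows "(\<lambda>\<omega>. f \<omega> (Y j \<omega>)) \<in> borel_measurable (F t)"
proof -
  have "(\<lambda>(\<omega>, y). f \<omega> y) \<in> borel_measurable (F j \<Otimes>\<^sub>M B)" using f by (simp add: martingale_diff_def)
  moreover have "(\<lambda>\<omega>. (\<omega>, Y j \<omega>)) \<in> measurable (F t) (F j \<Otimes>\<^sub>M B)"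
    using j by (intro measurable_Pair Y_adapted measurable_F_mono[of j t]) auto
  ultimately show ?thesis using measurable_compose by fastforce
qed

text \<open>With the past frozen, \<open>exp (l * S \<omega>)\<close> is a constant factor, and
  Hoeffding's lemma on \<open>[- c, c]\<close> bounds the other factor; the interval length
  \<open>2 * c\<close> turns \<open>1 / 8\<close> into \<open>1 / 2\<close>.\<close>

lemma mgf_step:
  assumes j: "1 \<le> j" and f: "martingale_diff j c f" and S: "S \<in> borel_measurable (F j)" and l: "l > 0"
  shows "(\<integral>\<^sup>+\<omega>. ennreal (exp (l * (S \<omega> + f \<omega> (Y j \<omega>)))) \<partial>M)
    \<le> ennreal (exp (l\<^sup>2 * c\<^sup>2 / 2)) * (\<integral>\<^sup>+\<omega>. ennreal (exp (l * S \<omega>)) \<partial>M)"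
proof -
  let ?Q = "distr M B (Y j)"
  interpret Q: prob_space ?Q by (rule prob_space_distr) (rule Y_measurable[OF j])
  have f_meas [measurable]: "(\<lambda>(\<omega>, y). f \<omega> y) \<in> borel_measurable (F j \<Otimes>\<^sub>M B)"
    using f by (simp add: martingale_diff_def)
  note [measurable] = S measurable_F_M[OF S]
  have inner: "(\<integral>\<^sup>+y. ennreal (exp (l * (S \<omega> + f \<omega> y))) \<partial>?Q)
      \<le> ennreal (exp (l\<^sup>2 * c\<^sup>2 / 2)) * ennreal (exp (l * S \<omega>))" if \<omega>: "\<omega> \<in> space M" for \<omega>
  proof -
    have fm [measurable]: "f \<omega> \<in> borel_measurable B"
      using measurable_compose[OF measurable_Pair1' f_meas, of \<omega>] \<omega> space_F by simp
    have "interval_bounded_random_variable ?Q (f \<omega>) (- c) c"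
    proof
      show "f \<omega> \<in> borel_measurable ?Q" by simp
      show "AE y in ?Q. f \<omega> y \<in> {- c..c}"
        using f \<omega> unfolding martingale_diff_def by (auto elim!: eventually_mono)
    qed
    then have "(\<integral>\<^sup>+y. ennreal (exp (l * f \<omega> y)) \<partial>?Q) \<le> ennreal (exp (l\<^sup>2 * (c - (- c))\<^sup>2 / 8))"
      using f \<omega> l by (intro interval_bounded_random_variable.Hoeffdings_lemma_nn_integral_0)
        (auto simp: martingale_diff_def)
    also have "l\<^sup>2 * (c - (- c))\<^sup>2 / 8 = l\<^sup>2 * c\<^sup>2 / 2" by (simp add: power2_eq_square)
    finally have *: "(\<integral>\<^sup>+y. ennreal (exp (l * f \<omega> y)) \<partial>?Q) \<le> ennreal (exp (l\<^sup>2 * c\<^sup>2 / 2))" .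
    have "(\<integral>\<^sup>+y. ennreal (exp (l * (S \<omega> + f \<omega> y))) \<partial>?Q)
        = (\<integral>\<^sup>+y. ennreal (exp (l * S \<omega>)) * ennreal (exp (l * f \<omega> y)) \<partial>?Q)"
      by (intro nn_integral_cong) (simp add: distrib_left exp_add ennreal_mult)
    also have "\<dots> = ennreal (exp (l * S \<omega>)) * (\<integral>\<^sup>+y. ennreal (exp (l * f \<omega> y)) \<partial>?Q)"
      by (rule nn_integral_cmult) measurable
    also have "\<dots> \<le> ennreal (exp (l * S \<omega>)) * ennreal (exp (l\<^sup>2 * c\<^sup>2 / 2))"
      by (intro mult_left_mono *) simp
    finally show ?thesis by (simp add: mult.commute)
  qed
  have "(\<integral>\<^sup>+\<omega>. ennreal (exp (l * (S \<omega> + f \<omega> (Y j \<omega>)))) \<partial>M)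
      = (\<integral>\<^sup>+\<omega>. \<integral>\<^sup>+y. ennreal (exp (l * (S \<omega> + f \<omega> y))) \<partial>?Q \<partial>M)"
  proof -
    let ?h = "\<lambda>z. ennreal (exp (l * (S (fst z) + f (fst z) (snd z))))"
    have "(\<lambda>z. f (fst z) (snd z)) \<in> borel_measurable (F j \<Otimes>\<^sub>M B)"
      using f_meas by (simp add: case_prod_beta')
    then have "?h \<in> borel_measurable (F j \<Otimes>\<^sub>M B)"
      using measurable_compose[OF measurable_fst S] by measurable
    note eq = nn_integral_indep_past[OF space_F[of j] F_sub[of j] Y_measurable[OF j] _ this]
    show ?thesis using eq[OF indep[OF j]] by (simp only: fst_conv snd_conv)
  qed
  also have "\<dots> \<le> (\<integral>\<^sup>+\<omega>. ennreal (exp (l\<^sup>2 * c\<^sup>2 / 2)) * ennreal (exp (l * S \<omega>)) \<partial>M)"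
    by (intro nn_integral_mono inner)
  also have "\<dots> = ennreal (exp (l\<^sup>2 * c\<^sup>2 / 2)) * (\<integral>\<^sup>+\<omega>. ennreal (exp (l * S \<omega>)) \<partial>M)"
    by (rule nn_integral_cmult) measurable
  finally show ?thesis .
qed

text \<open>Azuma's inequality in moment form: the last increment is peeled off by
  \<open>mgf_step\<close>, which applies because the sum up to \<open>t\<close> is already
  measurable in \<open>F (Suc t)\<close>.\<close>

lemma azuma_subgaussian:
  assumes f: "\<And>j. j \<ge> 1 \<Longrightarrow> martingale_diff j (c j) (f j)"
  shows "subgaussian (\<lambda>\<omega>. \<Sum>j=1..t. f j \<omega> (Y j \<omega>)) (\<Sum>j=1..t. (c j)\<^sup>2)"
proof -
  have meas: "(\<lambda>\<omega>. \<Sum>j=1..t. f j \<omega> (Y j \<omega>)) \<in> borel_measurable (F (Suc t))" for t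
    by (intro borel_measurable_sum martingale_diff_measurable_F[OF _ _ f]) auto
  have "(\<integral>\<^sup>+\<omega>. ennreal (exp (l * (\<Sum>j=1..t. f j \<omega> (Y j \<omega>)))) \<partial>M) \<le> ennreal (exp (l\<^sup>2 * (\<Sum>j=1..t. (c j)\<^sup>2) / 2))"
    if l: "l > 0" for l
  proof (induction t)
    case (Suc t)
    let ?S = "\<lambda>\<omega>. \<Sum>j=1..t. f j \<omega> (Y j \<omega>)"
    have "(\<integral>\<^sup>+\<omega>. ennreal (exp (l * (\<Sum>j=1..Suc t. f j \<omega> (Y j \<omega>)))) \<partial>M)
        = (\<integral>\<^sup>+\<omega>. ennreal (exp (l * (?S \<omega> + f (Suc t) \<omega> (Y (Suc t) \<omega>)))) \<partial>M)"
      by simp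
    also have "\<dots> \<le> ennreal (exp (l\<^sup>2 * (c (Suc t))\<^sup>2 / 2)) * (\<integral>\<^sup>+\<omega>. ennreal (exp (l * ?S \<omega>)) \<partial>M)"
      by (intro mgf_step f meas l) auto
    also have "\<dots> \<le> ennreal (exp (l\<^sup>2 * (c (Suc t))\<^sup>2 / 2)) * ennreal (exp (l\<^sup>2 * (\<Sum>j=1..t. (c j)\<^sup>2) / 2))"
      by (intro mult_left_mono Suc) simp
    also have "\<dots> = ennreal (exp (l\<^sup>2 * (\<Sum>j=1..Suc t. (c j)\<^sup>2) / 2))"
      by (simp add: ennreal_mult[symmetric] exp_add[symmetric] algebra_simps add_divide_distrib)
    finally show ?case .
  qed (simp add: emeasure_space_1)
  then show ?thesis
    unfolding subgaussian_def using measurable_F_M[OF meas, of t] by simp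
qed

end

section \<open>Elementary estimates and the rate\<close>

text \<open>The integral of \<open>1 / sqrt x\<close> over \<open>[1, t + 1]\<close>, hence a lower
  bound for the total weight; it is the common denominator of both final bounds.\<close>

definition avg_den :: "nat \<Rightarrow> real" where
  "avg_den t = 2 * (sqrt (real t + 1) - 1)"

lemma avg_den_pos: "t \<ge> 1 \<Longrightarrow> avg_den t > 0"
  by (simp add: avg_den_def)

lemma avg_den_le_sum: "avg_den t \<le> (\<Sum>j=1..t. 1 / sqrt (real j))"
proof (induction t)
  case (Suc t)
  let ?a = "sqrt (real t + 2)" and ?b = "sqrt (real t + 1)"
  have b: "?b > 0" "?b \<le> ?a" by auto
  have "?a\<^sup>2 = ?b\<^sup>2 + 1" by simp
  moreover have "2 * ?a * ?b \<le> ?a\<^sup>2 + ?b\<^sup>2" by (rule sum_squares_bound)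
  ultimately have "2 * (?a - ?b) * ?b \<le> 1" by (simp add: algebra_simps power2_eq_square)
  then have "2 * (?a - ?b) \<le> 1 / ?b" using b by (simp add: field_simps)
  then show ?case using Suc by (simp add: avg_den_def algebra_simps)
qed (simp add: avg_den_def)

lemma sum_inverse_le: "t \<ge> 1 \<Longrightarrow> (\<Sum>j=1..t. 1 / real j) \<le> 1 + ln (real t)"
proof (induction t rule: dec_induct)
  case (step t)
  have "ln (real t / (real t + 1)) \<le> real t / (real t + 1) - 1"
    using step by (intro ln_le_minus_one) simp
  then have "1 / (real t + 1) \<le> ln (real t + 1) - ln (real t)"
    using step by (simp add: ln_div field_simps)
  then show ?case using step by (simp add: algebra_simps)
qed simp

lemma sqrt_le_avg_den: "t \<ge> 1 \<Longrightarrow> sqrt (real t) \<le> 4 * avg_den t"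
proof -
  assume t: "t \<ge> 1"
  \<comment> \<open>With \<open>x = sqrt (t + 1)\<close> the claim
    \<open>x \<le> 4 * (2 * (x - 1))\<close> is exactly \<open>8 / 7 \<le> x\<close>, and
    \<open>sqrt 2\<close> exceeds \<open>8 / 7\<close>.\<close>
  have "8 / 7 \<le> sqrt (real t + 1)"
    by (rule real_le_rsqrt) (use t in \<open>simp add: power2_eq_square\<close>)
  then have "sqrt (real t + 1) \<le> 4 * avg_den t" unfolding avg_den_def by simp
  moreover have "sqrt (real t) \<le> sqrt (real t + 1)" by simp
  ultimately show ?thesis by (rule order_trans[rotated])
qed

text \<open>Lets additive constants be absorbed into logarithms, at the price
  \<open>1 \<le> 3 / 2 * ln n\<close>.\<close>

lemma ln_real_ge_two_thirds: "n \<ge> 2 \<Longrightarrow> 2 / 3 \<le> ln (real n)"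
  using ln2_ge_two_thirds ln_mono[of 2 "real n"] by linarith

text \<open>The common shape of the two bounds: \<open>A\<close> is of order \<open>ln t\<close>,
  \<open>C\<close> of order \<open>ln t\<close> plus the mixed root, and \<open>\<alpha>\<close>,
  \<open>\<beta>\<close> carry the constants. In \<open>x = sqrt (ln t)\<close> and
  \<open>y = sqrt (ln m)\<close> the numerator of the rate is \<open>x ^ 4 + y * x ^ 3\<close>, and
  the claim becomes a polynomial inequality for \<open>x \<ge> 2 / 3\<close>.\<close>

lemma rate_dominates:
  fixes D G A C \<alpha> \<beta> :: real
  assumes m: "m \<ge> 2" and t: "t \<ge> 2" and DG: "D > 0" "G > 0" and \<alpha>: "0 \<le> \<alpha>" "0 \<le> \<beta>"
    and A: "0 \<le> A" "A \<le> \<alpha> * ln (real t)"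
    and C: "0 \<le> C" "C \<le> \<beta> * (ln (real t) + sqrt (ln (real m)) * sqrt (ln (real t)))"
  shows "\<bar>(sqrt (2 * D\<^sup>2 * G\<^sup>2 + 2 * ln (real m)) * A + 2 * D * G * C * (1 + ln (real t))) / avg_den t\<bar>
    \<le> 4 * (3 * \<alpha> * (D * G + 1) + 6 * D * G * \<beta>) * \<bar>rate m t\<bar>"
proof -
  define x where "x = sqrt (ln (real t))"
  define y where "y = sqrt (ln (real m))"
  define K where "K = sqrt (2 * D\<^sup>2 * G\<^sup>2 + 2 * ln (real m))"
  have Lt: "2 / 3 \<le> ln (real t)" and Lm: "2 / 3 \<le> ln (real m)" using ln_real_ge_two_thirds m t by auto
  have x2: "x\<^sup>2 = ln (real t)" and y2: "y\<^sup>2 = ln (real m)" using Lt Lm by (auto simp: x_def y_def)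
  have x: "2 / 3 \<le> x" unfolding x_def by (rule real_le_rsqrt) (use Lt in \<open>simp add: power2_eq_square\<close>)
  have y: "0 \<le> y" using Lm by (simp add: y_def)
  have K: "K \<le> 2 * (D * G + y)"
    unfolding K_def
  proof (rule real_le_lsqrt)
    have "0 \<le> D * G * y" "0 \<le> y\<^sup>2" "0 \<le> (D * G)\<^sup>2" using DG y by auto
    then show "2 * D\<^sup>2 * G\<^sup>2 + 2 * ln (real m) \<le> (2 * (D * G + y))\<^sup>2"
      unfolding y2[symmetric] by (simp add: power2_eq_square algebra_simps)
  qed (use DG y in simp)
  have K0: "0 \<le> K" using DG Lm by (simp add: K_def)
  let ?r = "x ^ 4 + y * x ^ 3"
  have rate: "rate m t = ?r / sqrt (real t)"
  proof -
    have "ln (real t) powr (3 / 2) = ln (real t) powr (1 + 1 / 2)" by simp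
    also have "\<dots> = ln (real t) * x" using Lt unfolding powr_add by (simp add: powr_half_sqrt x_def)
    also have "\<dots> = x ^ 3" by (simp add: x2[symmetric] power2_eq_square power3_eq_cube)
    finally have "ln (real t) powr (3 / 2) = x ^ 3" .
    moreover have "ln (real m) powr (1 / 2) = y" using Lm by (simp add: powr_half_sqrt y_def)
    moreover have "(ln (real t))\<^sup>2 = x ^ 4" by (simp add: x2[symmetric] power_mult[symmetric])
    ultimately show ?thesis by (simp add: rate_def)
  qed
  \<comment> \<open>Terms of too low a degree are raised to the degree occurring in the rate: a
    missing factor \<open>x\<close> costs \<open>3 / 2\<close>, because
    \<open>x \<ge> 2 / 3\<close>, and a missing \<open>x\<^sup>2\<close> costs the same, because
    \<open>ln t \<ge> 2 / 3\<close>.\<close>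
  have h1: "x\<^sup>2 \<le> 3 / 2 * x ^ 3"
    using mult_right_mono[OF x, of "x\<^sup>2"] by (simp add: power2_eq_square power3_eq_cube)
  have x3: "x ^ 3 \<le> 3 / 2 * x ^ 4"
    using mult_right_mono[OF x, of "x ^ 3"] x by (simp add: power3_eq_cube power4_eq_xxxx)
  have "1 \<le> 3 / 2 * x\<^sup>2" using Lt by (simp add: x2)
  then have x24: "x\<^sup>2 \<le> 3 / 2 * x ^ 4"
    using mult_right_mono[of 1 "3 / 2 * x\<^sup>2" "x\<^sup>2"] by (simp add: power2_eq_square power4_eq_xxxx)
  have r0: "0 \<le> ?r" using x y by simp
  have "K * A \<le> (2 * (D * G + y)) * (\<alpha> * x\<^sup>2)"
    using A x2 K K0 by (intro mult_mono) (use DG y in auto)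
  also have "\<dots> = 2 * \<alpha> * (D * G * x\<^sup>2 + y * x\<^sup>2)" by (simp add: algebra_simps)
  also have "\<dots> \<le> 2 * \<alpha> * (D * G * (3 / 2 * x ^ 4) + y * (3 / 2 * x ^ 3))"
    using \<alpha> DG y x24 h1 by (intro mult_left_mono add_mono) auto
  also have "\<dots> = 3 * \<alpha> * (D * G * x ^ 4 + y * x ^ 3)" by (simp add: algebra_simps)
  also have "\<dots> \<le> 3 * \<alpha> * ((D * G + 1) * ?r)"
  proof (intro mult_left_mono)
    have "0 \<le> D * G * (y * x ^ 3) + x ^ 4" using DG x y by simp
    then show "D * G * x ^ 4 + y * x ^ 3 \<le> (D * G + 1) * ?r" by (simp add: algebra_simps)
  qed (use \<alpha> in simp)
  finally have 1: "K * A \<le> 3 * \<alpha> * (D * G + 1) * ?r" by (simp add: algebra_simps)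
  have "2 * D * G * C * (1 + ln (real t)) \<le> 2 * D * G * (\<beta> * (x\<^sup>2 + y * x)) * (3 * x\<^sup>2)"
  proof (intro mult_mono)
    show "C \<le> \<beta> * (x\<^sup>2 + y * x)" using C by (simp add: x2) (simp add: x_def y_def)
    show "1 + ln (real t) \<le> 3 * x\<^sup>2" using Lt by (simp add: x2)
  qed (use DG C \<alpha> x y Lt in auto)
  also have "\<dots> = 6 * D * G * \<beta> * ?r"
    by (simp add: algebra_simps power2_eq_square power3_eq_cube power4_eq_xxxx)
  finally have 2: "2 * D * G * C * (1 + ln (real t)) \<le> 6 * D * G * \<beta> * ?r" .
  let ?n = "K * A + 2 * D * G * C * (1 + ln (real t))"
  let ?c = "3 * \<alpha> * (D * G + 1) + 6 * D * G * \<beta>"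
  have n: "?n \<le> ?c * ?r" using 1 2 by (simp add: algebra_simps)
  have n0: "0 \<le> ?n" using K0 A C DG Lt by simp
  have st: "sqrt (real t) > 0" and d: "avg_den t > 0" using t avg_den_pos by auto
  have "?n / avg_den t \<le> ?c * ?r / (sqrt (real t) / 4)"
    using n n0 st sqrt_le_avg_den[of t] t by (intro frac_le) auto
  also have "\<dots> = 4 * ?c * rate m t" by (simp add: rate)
  finally have "?n / avg_den t \<le> 4 * ?c * rate m t" .
  moreover have "0 \<le> rate m t" using r0 by (simp add: rate)
  moreover have "0 \<le> ?n / avg_den t" using n0 d by simp
  ultimately show ?thesis unfolding K_def by simp
qed

text \<open>Under the filter \<open>principal ({2..} \<times> {2..})\<close> the estimate holds with
  one constant for all \<open>m\<close> and \<open>t\<close> from 2 on; it is uniform, not merely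
  asymptotic.\<close>

lemma expectation_bound_bigo:
  assumes DG: "D > 0" "G > 0"
  shows "(\<lambda>(m, t). expectation_bound D G m t) \<in> O[principal ({2..} \<times> {2..})](\<lambda>(m, t). rate m t)"
proof (rule bigoI)
  \<comment> \<open>With \<open>1 \<le> 3 / 2 * ?L\<close>: \<open>5 + 3 * ?L\<close> is at most
    \<open>21 / 2 * ?L\<close>, rounded to 11. The root is at most \<open>3 * x\<close>, so
    \<open>16 * 3 = 48\<close>, and \<open>48 * x\<close> is at most \<open>72 * x\<^sup>2\<close>;
    with \<open>3 + ?L\<close> this gives \<open>155 / 2\<close>, rounded to 78.\<close>
  have "norm (expectation_bound D G m t) \<le> 4 * (3 * 11 * (D * G + 1) + 6 * D * G * 78) * norm (rate m t)"
    if mt: "m \<ge> 2" "t \<ge> 2" for m t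
  proof -
    let ?L = "ln (real t)" and ?y = "sqrt (ln (real m))"
    have L: "2 / 3 \<le> ?L" and y: "0 \<le> ?y" using ln_real_ge_two_thirds[of t] ln_real_ge_two_thirds[of m] mt by auto
    define x where "x = sqrt ?L"
    have x2: "x\<^sup>2 = ?L" using L by (simp add: x_def)
    have x: "2 / 3 \<le> x" unfolding x_def by (rule real_le_rsqrt) (use L in \<open>simp add: power2_eq_square\<close>)
    define p where "p = ?y * x"
    define z where "z = 16 * (1 + ?y) * sqrt (2 * (1 + ?L))"
    have s: "sqrt (2 * (1 + ?L)) \<le> 3 * x"
      by (rule real_le_lsqrt) (use L x in \<open>auto simp: power_mult_distrib x2\<close>)
    have "16 * (1 + ?y) * sqrt (2 * (1 + ?L)) \<le> 16 * (1 + ?y) * (3 * x)"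
      using y s by (intro mult_left_mono) auto
    also have "\<dots> = 48 * x + 48 * (?y * x)" by (simp add: algebra_simps)
    also have "48 * x \<le> 72 * x\<^sup>2" using mult_right_mono[OF x, of x] x by (simp add: power2_eq_square)
    finally have "z \<le> 72 * ?L + 48 * p" unfolding x2 by (simp add: p_def z_def)
    moreover have "0 \<le> p" using y x by (simp add: p_def)
    ultimately have "3 + ?L + 16 * (1 + ?y) * sqrt (2 * (1 + ?L)) \<le> 78 * (?L + ?y * sqrt ?L)"
      using L unfolding x_def[symmetric] p_def[symmetric] z_def[symmetric] by (simp add: distrib_left)
    then show ?thesis
      using rate_dominates[of m t D G 11 78 "5 + 3 * ?L" "3 + ?L + 16 * (1 + ?y) * sqrt (2 * (1 + ?L))"]
        mt DG L y by (simp add: expectation_bound_def avg_den_def mult.commute)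
  qed
  then show "\<forall>\<^sub>F z in principal ({2..} \<times> {2..}). norm ((\<lambda>(m, t). expectation_bound D G m t) z)
      \<le> 4 * (3 * 11 * (D * G + 1) + 6 * D * G * 78) * norm ((\<lambda>(m, t). rate m t) z)"
    by (auto simp: eventually_principal)
qed

lemma high_prob_bound_bigo:
  assumes DG: "D > 0" "G > 0" and \<delta>: "0 < \<delta>" "\<delta> < 1 / 2"
  shows "(\<lambda>(m, t). high_prob_bound D G \<delta> m t) \<in> O[principal ({2..} \<times> {2..})](\<lambda>(m, t). rate m t)"
proof -
  \<comment> \<open>Chosen so that \<open>ln (2 * t^2 / \<delta>) \<le> (a * x)\<^sup>2\<close>: the
    constant \<open>ln (2 / \<delta>)\<close> is raised to a multiple of \<open>ln t\<close> by the
    factor \<open>3 / 2\<close>, and the 2 comes from \<open>t^2\<close>.\<close>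
  define a where "a = sqrt (3 / 2 * ln (2 / \<delta>) + 2)"
  have E: "ln (2 / \<delta>) > 0" using \<delta> by simp
  have a2: "a\<^sup>2 = 3 / 2 * ln (2 / \<delta>) + 2" using E by (simp add: a_def)
  have a: "a \<ge> 1" unfolding a_def by (rule real_le_rsqrt) (use E in simp)
  let ?\<alpha> = "11 + 16 * a" and ?\<beta> = "6 + 32 * a"
  show ?thesis
  proof (rule bigoI)
    have "norm (high_prob_bound D G \<delta> m t) \<le> 4 * (3 * ?\<alpha> * (D * G + 1) + 6 * D * G * ?\<beta>) * norm (rate m t)"
      if mt: "m \<ge> 2" "t \<ge> 2" for m t
    proof -
      let ?L = "ln (real t)" and ?y = "sqrt (ln (real m))"
      have L: "2 / 3 \<le> ?L" and Lm: "2 / 3 \<le> ln (real m)"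
        using ln_real_ge_two_thirds[of t] ln_real_ge_two_thirds[of m] mt by auto
      have y: "0 \<le> ?y" using Lm by simp
      define x where "x = sqrt ?L"
      have x2: "x\<^sup>2 = ?L" using L by (simp add: x_def)
      have x: "2 / 3 \<le> x" unfolding x_def by (rule real_le_rsqrt) (use L in \<open>simp add: power2_eq_square\<close>)
      have ln1: "ln (2 * (real t)\<^sup>2 / \<delta>) = ln (2 / \<delta>) + 2 * ?L"
        using mt \<delta> by (simp add: ln_div ln_mult ln_realpow)
      have ln2: "ln (2 * real m * (real t)\<^sup>2 / \<delta>) = ln (real m) + (ln (2 / \<delta>) + 2 * ?L)"
        using mt \<delta> by (simp add: ln_div ln_mult ln_realpow)
      have "ln (2 / \<delta>) * 1 \<le> ln (2 / \<delta>) * (3 / 2 * ?L)" using E L by (intro mult_left_mono) auto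
      then have ax: "ln (2 / \<delta>) + 2 * ?L \<le> (a * x)\<^sup>2"
        unfolding power_mult_distrib a2 x2 by (simp add: algebra_simps)
      have pos: "0 \<le> ln (2 / \<delta>) + 2 * ?L" using E L by simp
      have "(1 + ?L) * ln (2 * (real t)\<^sup>2 / \<delta>) \<le> (4 * x\<^sup>2) * (a * x)\<^sup>2"
        unfolding ln1 using ax L pos by (intro mult_mono) (auto simp: x2)
      also have "\<dots> = (2 * a * x\<^sup>2)\<^sup>2" by (simp add: power2_eq_square)
      finally have s1: "sqrt ((1 + ?L) * ln (2 * (real t)\<^sup>2 / \<delta>)) \<le> 2 * a * x\<^sup>2"
        using a by (intro real_le_lsqrt) auto
      have "ln (real m) + (ln (2 / \<delta>) + 2 * ?L) \<le> ?y\<^sup>2 + (a * x)\<^sup>2" using ax Lm by simp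
      also have "\<dots> \<le> (?y + a * x)\<^sup>2" using y a x by (simp add: power2_sum)
      finally have "(1 + ?L) * ln (2 * real m * (real t)\<^sup>2 / \<delta>) \<le> (4 * x\<^sup>2) * (?y + a * x)\<^sup>2"
        unfolding ln2 using L pos Lm by (intro mult_mono) (auto simp: x2)
      also have "\<dots> = (2 * x * (?y + a * x))\<^sup>2" by (simp add: power2_eq_square)
      finally have "sqrt ((1 + ?L) * ln (2 * real m * (real t)\<^sup>2 / \<delta>)) \<le> 2 * x * (?y + a * x)"
        using a x y by (intro real_le_lsqrt) auto
      also have "\<dots> = 2 * (?y * x) + 2 * a * x\<^sup>2" by (simp add: algebra_simps power2_eq_square)
      also have "\<dots> \<le> 2 * a * (?y * x) + 2 * a * x\<^sup>2"
        using a y x by (intro add_right_mono mult_right_mono) auto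
      finally have s2: "sqrt ((1 + ?L) * ln (2 * real m * (real t)\<^sup>2 / \<delta>)) \<le> 2 * a * (x\<^sup>2 + ?y * x)"
        by (simp add: algebra_simps)
      have A: "5 + 3 * ?L + 8 * sqrt ((1 + ?L) * ln (2 * (real t)\<^sup>2 / \<delta>)) \<le> ?\<alpha> * ?L"
        using s1 L unfolding x2 by (simp add: algebra_simps)
      have C: "3 + ?L + 16 * sqrt ((1 + ?L) * ln (2 * real m * (real t)\<^sup>2 / \<delta>)) \<le> ?\<beta> * (?L + ?y * sqrt ?L)"
      proof -
        have "0 \<le> ?y * x" using y x by simp
        then show ?thesis using s2 L unfolding x2 x_def[symmetric] by (simp add: algebra_simps)
      qed
      have nn: "0 \<le> sqrt ((1 + ?L) * ln (2 * (real t)\<^sup>2 / \<delta>))"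
        "0 \<le> sqrt ((1 + ?L) * ln (2 * real m * (real t)\<^sup>2 / \<delta>))"
        unfolding ln1 ln2 using L Lm pos by auto
      show ?thesis
        using rate_dominates[OF _ _ DG _ _ _ A _ C] mt a nn L
        by (simp add: high_prob_bound_def avg_den_def mult.commute)
    qed
    then show "\<forall>\<^sub>F z in principal ({2..} \<times> {2..}). norm ((\<lambda>(m, t). high_prob_bound D G \<delta> m t) z)
      \<le> 4 * (3 * ?\<alpha> * (D * G + 1) + 6 * D * G * ?\<beta>) * norm ((\<lambda>(m, t). rate m t) z)"
      by (auto simp: eventually_principal)
  qed
qed

section \<open>Risks\<close>

text \<open>The almost sure assumptions as one property of a sample, uniform over \<open>W\<close>:
  the iterates at which it is applied are random, so the exceptional null set must not depend on the
  point.\<close>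

definition (in mirror_map) good_sample ::
    "('a \<Rightarrow> 'z \<Rightarrow> real) \<Rightarrow> ('a \<Rightarrow> 'z \<Rightarrow> 'a) \<Rightarrow> real \<Rightarrow> 'z \<Rightarrow> bool" where
  "good_sample \<l> d\<l> G z \<longleftrightarrow>
     (\<forall>u\<in>W. (\<forall>x. \<bar>d\<l> u z \<bullet> x\<bar> \<le> G * N x) \<and> 0 \<le> \<l> u z \<and> \<l> u z \<le> 1)"

definition grad_risk :: "('a::euclidean_space \<Rightarrow> 'z \<Rightarrow> 'a) \<Rightarrow> 'z measure \<Rightarrow> 'a \<Rightarrow> 'a" where
  "grad_risk d\<l> P u = (\<integral>z. d\<l> u z \<partial>P)"

locale loss_distribution = mirror_map N W \<nu> d\<nu> ow D
  for N :: "'a::euclidean_space \<Rightarrow> real" and W \<nu> d\<nu> ow D +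
  fixes Z Q :: "'z measure" and \<l> :: "'a \<Rightarrow> 'z \<Rightarrow> real" and d\<l> :: "'a \<Rightarrow> 'z \<Rightarrow> 'a" and G :: real
  assumes Q: "prob_space Q" and sets_Q: "sets Q = sets Z"
    and loss_measurable: "(\<lambda>(u, z). \<l> u z) \<in> borel_measurable (restrict_space borel W \<Otimes>\<^sub>M Z)"
    and grad_measurable: "(\<lambda>(u, z). d\<l> u z) \<in> borel_measurable (restrict_space borel W \<Otimes>\<^sub>M Z)"
    and grad: "u \<in> W \<Longrightarrow> z \<in> space Z \<Longrightarrow>
      ((\<lambda>v. \<l> v z) has_derivative (\<lambda>h. d\<l> u z \<bullet> h)) (at u within W)"
    and grad_bound: "AE z in Q. \<forall>u\<in>W. dual_norm N (d\<l> u z) \<le> G"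
    and loss_bound: "AE z in Q. \<forall>u\<in>W. 0 \<le> \<l> u z \<and> \<l> u z \<le> 1"
    and risk_convex: "convex_on W (risk \<l> Q)"
    and G_pos: "G > 0"
begin

interpretation Q: prob_space Q by (rule Q)

lemma space_Q: "space Q = space Z"
  using sets_Q by (rule sets_eq_imp_space_eq)

lemma sets_pair_Q: "sets (A \<Otimes>\<^sub>M Q) = sets (A \<Otimes>\<^sub>M Z)"
  using sets_Q by (intro sets_pair_measure_cong) auto

lemma loss_measurable_Q: "(\<lambda>(u, z). \<l> u z) \<in> borel_measurable (restrict_space borel W \<Otimes>\<^sub>M Q)"
  using loss_measurable measurable_cong_sets[OF sets_pair_Q refl] by blast

lemma grad_measurable_Q: "(\<lambda>(u, z). d\<l> u z) \<in> borel_measurable (restrict_space borel W \<Otimes>\<^sub>M Q)"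
  using grad_measurable measurable_cong_sets[OF sets_pair_Q refl] by blast

lemma Pair_measurable: "u \<in> W \<Longrightarrow> Pair u \<in> measurable Q (restrict_space borel W \<Otimes>\<^sub>M Q)"
  by (rule measurable_Pair1') (simp add: space_restrict_space)

lemma loss_section: "u \<in> W \<Longrightarrow> \<l> u \<in> borel_measurable Q"
  using measurable_compose[OF Pair_measurable loss_measurable_Q, of u] by simp

lemma grad_section: "u \<in> W \<Longrightarrow> d\<l> u \<in> borel_measurable Q"
  using measurable_compose[OF Pair_measurable grad_measurable_Q, of u] by simp

abbreviation "good \<equiv> good_sample \<l> d\<l> G"
lemmas good_def = good_sample_def

lemma AE_good: "AE z in Q. good z"
  using grad_bound loss_bound
  by eventually_elim (use abs_inner_le_dual_norm in \<open>auto simp: good_def\<close>)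

lemma integrable_loss: "u \<in> W \<Longrightarrow> integrable Q (\<l> u)"
  by (rule Q.integrable_const_bound[where B = 1])
    (use AE_good in \<open>auto elim!: eventually_mono simp: good_def intro: loss_section\<close>)

lemma risk_bounds:
  assumes "u \<in> W" shows "0 \<le> risk \<l> Q u" "risk \<l> Q u \<le> 1"
proof -
  show "0 \<le> risk \<l> Q u" unfolding risk_def
    using AE_good assms by (intro integral_nonneg_AE) (auto elim!: eventually_mono simp: good_def)
  show "risk \<l> Q u \<le> 1" unfolding risk_def
    using AE_good assms
    by (intro Q.integral_le_const integrable_loss) (auto elim!: eventually_mono simp: good_def)
qed

text \<open>Testing the pairing bound with the gradient itself bounds its Euclidean norm by a
  constant, so the vector-valued integral exists.\<close>

lemma integrable_grad: "u \<in> W \<Longrightarrow> integrable Q (d\<l> u)"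
proof -
  assume u: "u \<in> W"
  obtain C where C: "C > 0" "\<And>x. N x \<le> C * norm x" using N_le_norm by blast
  have "AE z in Q. norm (d\<l> u z) \<le> G * C"
    using AE_good
  proof eventually_elim
    case (elim z)
    let ?g = "d\<l> u z"
    have "?g \<bullet> ?g \<le> G * N ?g" using elim u by (auto simp: good_def abs_le_iff)
    also have "\<dots> \<le> G * (C * norm ?g)" using C G_pos by (intro mult_left_mono) auto
    finally have "norm ?g * norm ?g \<le> (G * C) * norm ?g" by (simp add: power2_norm_eq_inner[symmetric] power2_eq_square)
    then show ?case using C G_pos mult_right_le_imp_le[of "norm ?g" "norm ?g" "G * C"]
      by (cases "norm ?g > 0") auto
  qed
  then show ?thesis by (intro Q.integrable_const_bound grad_section u)
qed

abbreviation "gr \<equiv> grad_risk d\<l> Q"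

lemma grad_risk_inner: "u \<in> W \<Longrightarrow> gr u \<bullet> x = (\<integral>z. d\<l> u z \<bullet> x \<partial>Q)"
  unfolding grad_risk_def using integrable_grad[of u] by simp

lemma grad_risk_bound: "u \<in> W \<Longrightarrow> \<bar>gr u \<bullet> x\<bar> \<le> G * N x"
proof -
  assume u: "u \<in> W"
  have int: "integrable Q (\<lambda>z. d\<l> u z \<bullet> x)" using integrable_grad[OF u] by simp
  have "\<bar>\<integral>z. d\<l> u z \<bullet> x \<partial>Q\<bar> \<le> (\<integral>z. \<bar>d\<l> u z \<bullet> x\<bar> \<partial>Q)" by (rule integral_abs_bound)
  also have "\<dots> \<le> G * N x"
    using AE_good u int by (intro Q.integral_le_const) (auto elim!: eventually_mono simp: good_def)
  finally show ?thesis using grad_risk_inner[OF u] by simp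
qed

text \<open>Mean value theorem along the segment, which stays in \<open>W\<close>. It provides the
  dominating function for \<open>risk_subgradient\<close> and the continuity of the risk.\<close>

lemma loss_lipschitz:
  assumes z: "good z" "z \<in> space Z" and u: "u \<in> W" and v: "v \<in> W"
  shows "\<bar>\<l> u z - \<l> v z\<bar> \<le> G * N (u - v)"
proof -
  let ?p = "\<lambda>s::real. v + s *\<^sub>R (u - v)"
  have "\<exists>s\<in>{0<..<1}. \<l> (?p 1) z - \<l> (?p 0) z = (\<lambda>h. d\<l> (?p s) z \<bullet> (h *\<^sub>R (u - v))) (1 - 0)"
  proof (rule mvt_simple)
    fix s :: real assume s: "0 \<le> s" "s \<le> 1"
    have sub: "?p ` {0..1} \<subseteq> W" using segment_in_W[OF v u] by auto
    have "(?p has_derivative (\<lambda>h. h *\<^sub>R (u - v))) (at s within {0..1})"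
      by (auto intro!: derivative_eq_intros)
    moreover have "((\<lambda>v. \<l> v z) has_derivative (\<lambda>h. d\<l> (?p s) z \<bullet> h)) (at (?p s) within ?p ` {0..1})"
      using s by (intro has_derivative_subset[OF grad[OF segment_in_W[OF v u] z(2)] sub])
    ultimately have "((\<lambda>v. \<l> v z) \<circ> ?p has_derivative (\<lambda>h. d\<l> (?p s) z \<bullet> h) \<circ> (\<lambda>h. h *\<^sub>R (u - v))) (at s within {0..1})"
      by (rule diff_chain_within)
    then show "((\<lambda>s. \<l> (?p s) z) has_derivative (\<lambda>h. d\<l> (?p s) z \<bullet> (h *\<^sub>R (u - v)))) (at s within {0..1})"
      by (simp only: o_def)
  qed simp
  then obtain s where s: "s \<in> {0<..<1}" "\<l> u z - \<l> v z = d\<l> (?p s) z \<bullet> (u - v)" by auto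
  have "?p s \<in> W" using s by (intro segment_in_W v u) auto
  then show ?thesis using s(2) z by (simp add: good_def)
qed

lemma risk_lipschitz: "u \<in> W \<Longrightarrow> v \<in> W \<Longrightarrow> \<bar>risk \<l> Q u - risk \<l> Q v\<bar> \<le> G * N (u - v)"
proof -
  assume u: "u \<in> W" and v: "v \<in> W"
  have "\<bar>\<integral>z. \<l> u z - \<l> v z \<partial>Q\<bar> \<le> (\<integral>z. \<bar>\<l> u z - \<l> v z\<bar> \<partial>Q)" by (rule integral_abs_bound)
  also have "\<dots> \<le> G * N (u - v)"
  proof (rule Q.integral_le_const)
    show "AE z in Q. \<bar>\<l> u z - \<l> v z\<bar> \<le> G * N (u - v)"
      using AE_good AE_space by eventually_elim (use loss_lipschitz u v space_Q in auto)
  qed (use integrable_loss u v in auto)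
  finally show ?thesis using integrable_loss u v by (simp add: risk_def)
qed

lemma continuous_on_risk: "continuous_on W (risk \<l> Q)"
proof -
  obtain C where C: "C > 0" "\<And>x. N x \<le> C * norm x" using N_le_norm by blast
  have "(G * C)-lipschitz_on W (risk \<l> Q)"
  proof (rule lipschitz_onI)
    fix u v assume uv: "u \<in> W" "v \<in> W"
    have "\<bar>risk \<l> Q u - risk \<l> Q v\<bar> \<le> G * N (u - v)" by (rule risk_lipschitz[OF uv])
    also have "\<dots> \<le> G * (C * norm (u - v))" using C G_pos by (intro mult_left_mono) auto
    finally show "dist (risk \<l> Q u) (risk \<l> Q v) \<le> G * C * dist u v" by (simp add: dist_norm)
  qed (use C G_pos in simp)
  then show ?thesis by (rule lipschitz_on_continuous_on)
qed

text \<open>Convexity is known for the risk, not for the individual losses, so no pointwise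
  subgradient inequality can be integrated. Dominated convergence instead identifies the directional
  derivative of the risk with the averaged gradient, and convexity of the risk bounds its difference
  quotients.\<close>

lemma risk_subgradient:
  assumes u: "u \<in> W" and v: "v \<in> W"
  shows "risk \<l> Q v - risk \<l> Q u \<le> gr v \<bullet> (v - u)"
proof -
  \<comment> \<open>Dominated convergence runs along a sequence; the values in \<open>(0, 1]\<close>
    keep the points \<open>?p n\<close> on the segment and so in \<open>W\<close>.\<close>
  define s where "s n = 1 / (real n + 1)" for n
  have s: "0 < s n" "s n \<le> 1" for n by (auto simp: s_def)
  have s_lim: "filterlim s (at_right 0) sequentially"
  proof -
    have "s \<longlonglongrightarrow> 0" unfolding s_def using LIMSEQ_inverse_real_of_nat by (simp add: inverse_eq_divide add.commute)
    moreover have "s n \<noteq> 0" for n using s(1)[of n] by simp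
    ultimately show ?thesis using s by (auto simp: filterlim_at)
  qed
  let ?p = "\<lambda>n. v + s n *\<^sub>R (u - v)"
  have pW: "?p n \<in> W" for n using s[of n] by (intro segment_in_W u v) auto
  let ?X = "\<lambda>n z. (\<l> (?p n) z - \<l> v z) / s n"
  have "(\<lambda>n. \<integral>z. ?X n z \<partial>Q) \<longlonglongrightarrow> (\<integral>z. d\<l> v z \<bullet> (u - v) \<partial>Q)"
  proof (rule integral_dominated_convergence[where w = "\<lambda>_. G * N (u - v)"])
    show "(\<lambda>z. d\<l> v z \<bullet> (u - v)) \<in> borel_measurable Q" using grad_section[OF v] by simp
    show "?X n \<in> borel_measurable Q" for n using loss_section[OF v] loss_section[OF pW] by simp
    show "integrable Q (\<lambda>_. G * N (u - v))" by simp
    show "AE z in Q. (\<lambda>n. ?X n z) \<longlonglongrightarrow> d\<l> v z \<bullet> (u - v)"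
      using AE_space
    proof eventually_elim
      case (elim z)
      show ?case
        by (rule filterlim_compose[OF directional_derivative_at_right[OF W_convex v u] s_lim])
          (use grad[OF v] elim space_Q in auto)
    qed
    fix n
    show "AE z in Q. norm (?X n z) \<le> G * N (u - v)"
      using AE_good AE_space
    proof eventually_elim
      case (elim z)
      have "\<bar>\<l> (?p n) z - \<l> v z\<bar> \<le> s n * (G * N (u - v))"
        using loss_lipschitz[OF _ _ pW v, of z n] elim space_Q s[of n] by (simp add: mult_ac)
      then show ?case using s[of n] by (simp add: field_simps)
    qed
  qed
  moreover have "(\<integral>z. ?X n z \<partial>Q) \<le> risk \<l> Q u - risk \<l> Q v" for n
  proof -
    have "(\<integral>z. ?X n z \<partial>Q) = (risk \<l> Q (?p n) - risk \<l> Q v) / s n"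
      using integrable_loss[OF pW] integrable_loss[OF v] by (simp add: risk_def)
    moreover have "risk \<l> Q (?p n) \<le> (1 - s n) * risk \<l> Q v + s n * risk \<l> Q u"
    proof -
      have "?p n = (1 - s n) *\<^sub>R v + s n *\<^sub>R u" by (simp add: algebra_simps)
      then show ?thesis using convex_onD[OF risk_convex, of "s n" v u] s[of n] u v by simp
    qed
    ultimately show ?thesis using s[of n] by (simp add: field_simps)
  qed
  ultimately have "(\<integral>z. d\<l> v z \<bullet> (u - v) \<partial>Q) \<le> risk \<l> Q u - risk \<l> Q v"
    by (intro LIMSEQ_le_const2) auto
  then show ?thesis using grad_risk_inner[OF v, of "u - v"] by (simp add: inner_diff_right)
qed

lemma min_risk_attained: "\<exists>u\<in>W. risk \<l> Q u = min_risk W \<l> Q"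
  and min_risk_le: "u \<in> W \<Longrightarrow> min_risk W \<l> Q \<le> risk \<l> Q u"
proof -
  show le: "min_risk W \<l> Q \<le> risk \<l> Q u" if "u \<in> W" for u
    unfolding min_risk_def by (intro cINF_lower bdd_belowI2[of _ 0] risk_bounds that)
  obtain u where u: "u \<in> W" "\<And>v. v \<in> W \<Longrightarrow> risk \<l> Q u \<le> risk \<l> Q v"
    using continuous_attains_inf[OF compact_W W_ne continuous_on_risk] by blast
  have "risk \<l> Q u \<le> min_risk W \<l> Q" unfolding min_risk_def by (intro cINF_greatest W_ne u)
  then show "\<exists>u\<in>W. risk \<l> Q u = min_risk W \<l> Q" using le[OF u(1)] u(1) by force
qed

lemma min_risk_nonneg: "0 \<le> min_risk W \<l> Q"
  using min_risk_attained risk_bounds by force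

lemma risk_measurable:
  assumes "f \<in> borel_measurable A" "\<And>x. x \<in> space A \<Longrightarrow> f x \<in> W"
  shows "(\<lambda>x. risk \<l> Q (f x)) \<in> borel_measurable A"
  by (rule measurable_compose[OF measurable_restrict_space2
        borel_measurable_continuous_on_restrict[OF continuous_on_risk]]) (use assms in auto)

lemma grad_risk_measurable:
  assumes "f \<in> borel_measurable A" "\<And>x. x \<in> space A \<Longrightarrow> f x \<in> W"
  shows "(\<lambda>x. gr (f x)) \<in> borel_measurable A"
proof -
  have "(\<lambda>u. gr u) \<in> borel_measurable (restrict_space borel W)"
    unfolding grad_risk_def by (rule Q.borel_measurable_lebesgue_integral) (rule grad_measurable_Q)
  then show ?thesis
    by (rule measurable_compose[OF measurable_restrict_space2, rotated 2]) (use assms in auto)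
qed

lemma sample_measurable:
  assumes "f \<in> borel_measurable A" "\<And>x. x \<in> space A \<Longrightarrow> f x \<in> W" "g \<in> measurable A Z"
  shows "(\<lambda>x. \<l> (f x) (g x)) \<in> borel_measurable A" "(\<lambda>x. d\<l> (f x) (g x)) \<in> borel_measurable A"
proof -
  have fg: "(\<lambda>x. (f x, g x)) \<in> measurable A (restrict_space borel W \<Otimes>\<^sub>M Z)"
    using assms by (intro measurable_Pair measurable_restrict_space2) auto
  show "(\<lambda>x. \<l> (f x) (g x)) \<in> borel_measurable A" "(\<lambda>x. d\<l> (f x) (g x)) \<in> borel_measurable A"
    using measurable_compose[OF fg loss_measurable] measurable_compose[OF fg grad_measurable] by simp_all
qed

end

section \<open>The algorithm and its noise\<close>

locale anytime_sa = mirror_map N W \<nu> d\<nu> ow D + prob_space M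
  for N :: "'a::euclidean_space \<Rightarrow> real" and W \<nu> d\<nu> ow D and M :: "'s measure" +
  fixes m :: nat and Z :: "'z measure" and P :: "nat \<Rightarrow> 'z measure"
    and \<l> :: "'a \<Rightarrow> 'z \<Rightarrow> real" and d\<l> :: "'a \<Rightarrow> 'z \<Rightarrow> 'a" and G :: real
    and zs :: "nat \<Rightarrow> nat \<Rightarrow> 's \<Rightarrow> 'z" and wi :: "nat \<Rightarrow> nat \<Rightarrow> 's \<Rightarrow> 'a"
    and w :: "nat \<Rightarrow> 's \<Rightarrow> 'a" and q :: "nat \<Rightarrow> 's \<Rightarrow> nat \<Rightarrow> real"
  assumes m: "m \<ge> 2"
    and distribution: "i \<in> {1..m} \<Longrightarrow> loss_distribution N W \<nu> d\<nu> ow D Z (P i) \<l> d\<l> G"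
    and samples_indep: "indep_vars (\<lambda>_. Z) (\<lambda>(t, i). zs t i) ({1..} \<times> {1..m})"
    and samples_distr: "t \<ge> 1 \<Longrightarrow> i \<in> {1..m} \<Longrightarrow> distr M Z (zs t i) = P i"
    and run: "\<omega> \<in> space M \<Longrightarrow>
      anytime_sa_trajectory m W \<l> d\<l> \<nu> d\<nu> ow
        (\<lambda>i. step_single D G) (step_w D G m) (step_q D G m)
        (\<lambda>t i. zs t i \<omega>) (\<lambda>i t. wi i t \<omega>) (\<lambda>t. w t \<omega>) (\<lambda>t. q t \<omega>)"
begin

lemma one_le_m: "1 \<in> {1..m}" "{1..m} \<noteq> {}" and m1: "m \<ge> 1"
  using m by auto

lemma G_pos: "G > 0"
  using loss_distribution.G_pos[OF distribution[OF one_le_m(1)]] .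

section \<open>The filtration of the samples and the law of a fresh round\<close>

definition hist :: "nat \<Rightarrow> 's \<Rightarrow> nat \<times> nat \<Rightarrow> 'z" where
  "hist t \<omega> = (\<lambda>k\<in>{1..<t} \<times> {1..m}. (\<lambda>(t, i). zs t i) k \<omega>)"

text \<open>Generated by the rounds strictly before \<open>t\<close>, that is, by exactly the
  samples that the iterates with index \<open>t\<close> may use.\<close>

definition past :: "nat \<Rightarrow> 's measure" where
  "past t = vimage_algebra (space M) (hist t) (PiM ({1..<t} \<times> {1..m}) (\<lambda>_. Z))"

definition fresh :: "nat \<Rightarrow> 's \<Rightarrow> nat \<Rightarrow> 'z" where
  "fresh t \<omega> = (\<lambda>i\<in>{1..m}. zs t i \<omega>)"

abbreviation "ZZ \<equiv> PiM {1..m} (\<lambda>_. Z)"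

lemma fresh_apply: "i \<in> {1..m} \<Longrightarrow> fresh t \<omega> i = zs t i \<omega>"
  by (simp add: fresh_def)

lemma zs_measurable: "t \<ge> 1 \<Longrightarrow> i \<in> {1..m} \<Longrightarrow> zs t i \<in> measurable M Z"
  using samples_indep unfolding indep_vars_def by force

lemma space_past: "space (past t) = space M"
  by (simp add: past_def)

lemma hist_measurable: "hist t \<in> measurable M (PiM ({1..<t} \<times> {1..m}) (\<lambda>_. Z))"
  unfolding hist_def by (intro measurable_restrict) (auto intro: zs_measurable)

lemma hist_space: "hist t \<in> space M \<rightarrow> space (PiM ({1..<t} \<times> {1..m}) (\<lambda>_. Z))"
  using measurable_space[OF hist_measurable] by blast

lemma zs_past: "1 \<le> s \<Longrightarrow> s < t \<Longrightarrow> i \<in> {1..m} \<Longrightarrow> zs s i \<in> measurable (past t) Z"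
proof -
  assume si: "1 \<le> s" "s < t" "i \<in> {1..m}"
  then have k: "(s, i) \<in> {1..<t} \<times> {1..m}" by simp
  have "(\<lambda>\<omega>. hist t \<omega> (s, i)) \<in> measurable (past t) Z"
    unfolding past_def
    by (rule measurable_compose[OF measurable_vimage_algebra1[OF hist_space] measurable_component_singleton[OF k]])
  then show ?thesis using k by (simp add: hist_def)
qed

lemma id_measurable_past:
  assumes "space A = space M" and zs: "\<And>s i. 1 \<le> s \<Longrightarrow> s < t \<Longrightarrow> i \<in> {1..m} \<Longrightarrow> zs s i \<in> measurable A Z"
  shows "sets (past t) \<subseteq> sets A"
proof
  fix C assume C: "C \<in> sets (past t)"
  have "(\<lambda>\<omega>. \<omega>) \<in> measurable A (past t)"
    unfolding past_def hist_def
    by (intro measurable_vimage_algebra2 measurable_restrict) (auto simp: assms(1) intro: zs)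
  from measurable_sets[OF this C] show "C \<in> sets A"
    using sets.sets_into_space[OF C] by (simp add: assms(1) space_past Int_absorb2)
qed

lemma fresh_past: "1 \<le> s \<Longrightarrow> s < t \<Longrightarrow> fresh s \<in> measurable (past t) ZZ"
  unfolding fresh_def by (intro measurable_restrict zs_past)

lemma fresh_measurable: "t \<ge> 1 \<Longrightarrow> fresh t \<in> measurable M ZZ"
  unfolding fresh_def by (intro measurable_restrict zs_measurable)

text \<open>Disjoint blocks of an independent family are independent. The history is the block of
  earlier rounds, and \<open>fresh t\<close> is the block of round \<open>t\<close> after the
  reindexing \<open>h\<close>, so both events are generated by their blocks.\<close>

lemma past_fresh_indep:
  assumes t: "t \<ge> 1" and C: "C \<in> sets (past t)" and C': "C' \<in> sets ZZ"
  shows "prob (C \<inter> (fresh t -` C' \<inter> space M)) = prob C * prob (fresh t -` C' \<inter> space M)"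
proof -
  let ?A = "{1..<t} \<times> {1..m}" and ?B = "{t} \<times> {1..m}"
  let ?XA = "\<lambda>\<omega>. \<lambda>k\<in>?A. (\<lambda>(t, i). zs t i) k \<omega>" and ?XB = "\<lambda>\<omega>. \<lambda>k\<in>?B. (\<lambda>(t, i). zs t i) k \<omega>"
  have "indep_var (PiM ?A (\<lambda>_. Z)) ?XA (PiM ?B (\<lambda>_. Z)) ?XB"
    by (rule indep_var_restrict[OF samples_indep]) (use t in auto)
  then have ind: "indep_set (sigma_sets (space M) {?XA -` A \<inter> space M | A. A \<in> sets (PiM ?A (\<lambda>_. Z))})
      (sigma_sets (space M) {?XB -` A \<inter> space M | A. A \<in> sets (PiM ?B (\<lambda>_. Z))})"
    unfolding indep_var_eq by blast
  obtain A where A: "A \<in> sets (PiM ?A (\<lambda>_. Z))" "C = hist t -` A \<inter> space M"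
    using C unfolding past_def sets_vimage_algebra2[OF hist_space] by blast
  define h where "h x = (\<lambda>i\<in>{1..m}. x (t, i))" for x :: "nat \<times> nat \<Rightarrow> 'z"
  have h: "h \<in> measurable (PiM ?B (\<lambda>_. Z)) ZZ"
    unfolding h_def by (intro measurable_restrict measurable_component_singleton) auto
  have fh: "fresh t \<omega> = h (?XB \<omega>)" for \<omega> by (auto simp: fresh_def h_def)
  have XB: "?XB \<omega> \<in> space (PiM ?B (\<lambda>_. Z))" if "\<omega> \<in> space M" for \<omega>
    using that measurable_space[OF zs_measurable[OF t]] by (auto simp: space_PiM)
  have 2: "fresh t -` C' \<inter> space M = ?XB -` (h -` C' \<inter> space (PiM ?B (\<lambda>_. Z))) \<inter> space M"
    using XB fh by auto
  have 1: "C = ?XA -` A \<inter> space M" using A(2) by (simp add: hist_def[abs_def])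
  show ?thesis
    unfolding 1 2 by (rule indep_setD[OF ind]) (use A(1) measurable_sets[OF h C'] in blast)+
qed

sublocale adapted_sampling M past ZZ fresh
proof
  show "sets (past s) \<subseteq> sets (past t)" if "s \<le> t" for s t
    using that by (intro id_measurable_past zs_past) (auto simp: space_past)
  show "sets (past t) \<subseteq> sets M" for t
    by (rule id_measurable_past) (auto intro: zs_measurable)
qed (use space_past fresh_measurable past_fresh_indep fresh_past in auto)

lemma distr_fresh:
  assumes "t \<ge> 1" "i \<in> {1..m}" shows "distr (distr M ZZ (fresh t)) Z (\<lambda>y. y i) = P i"
proof -
  have "distr (distr M ZZ (fresh t)) Z (\<lambda>y. y i) = distr M Z ((\<lambda>y. y i) \<circ> fresh t)"
    using assms by (intro distr_distr fresh_measurable measurable_component_singleton)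
  also have "(\<lambda>y. y i) \<circ> fresh t = zs t i" using assms by (auto simp: fresh_def)
  finally show ?thesis using samples_distr assms by simp
qed

lemma sets_P: "i \<in> {1..m} \<Longrightarrow> sets (P i) = sets Z"
  using loss_distribution.sets_Q[OF distribution] .

lemma coordinate_measurable: "i \<in> {1..m} \<Longrightarrow> (\<lambda>y. y i) \<in> measurable (distr M ZZ (fresh t)) Z"
  by simp

lemma integrable_fresh:
  assumes t: "t \<ge> 1" and i: "i \<in> {1..m}" and f: "integrable (P i) (f :: 'z \<Rightarrow> real)"
  shows "integrable (distr M ZZ (fresh t)) (\<lambda>y. f (y i))"
    and "(\<integral>y. f (y i) \<partial>distr M ZZ (fresh t)) = (\<integral>z. f z \<partial>P i)"
proof -
  have fZ: "f \<in> borel_measurable Z"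
    using borel_measurable_integrable[OF f] measurable_cong_sets[OF sets_P[OF i] refl] by blast
  have "integrable (distr (distr M ZZ (fresh t)) Z (\<lambda>y. y i)) f" using f distr_fresh[OF t i] by simp
  then show "integrable (distr M ZZ (fresh t)) (\<lambda>y. f (y i))"
    by (subst (asm) integrable_distr_eq) (use fZ coordinate_measurable[OF i] in auto)
  show "(\<integral>y. f (y i) \<partial>distr M ZZ (fresh t)) = (\<integral>z. f z \<partial>P i)"
    unfolding distr_fresh[OF t i, symmetric]
    by (subst integral_distr) (use fZ coordinate_measurable[OF i] in auto)
qed

text \<open>With the past frozen, every noise term is a sum of functions of one coordinate each, so
  linearity reduces its mean to the marginals \<open>P i\<close>.\<close>

lemma integral_centered_sum:
  assumes t: "t \<ge> 1" and f: "\<And>i. i \<in> {1..m} \<Longrightarrow> integrable (P i) (f i :: 'z \<Rightarrow> real)"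
  shows "(\<integral>y. (\<Sum>i=1..m. (\<integral>z. f i z \<partial>P i) - f i (y i)) \<partial>distr M ZZ (fresh t)) = 0"
proof -
  interpret Q: prob_space "distr M ZZ (fresh t)" by (rule prob_space_distr) (rule fresh_measurable[OF t])
  have "(\<integral>y. (\<Sum>i=1..m. (\<integral>z. f i z \<partial>P i) - f i (y i)) \<partial>distr M ZZ (fresh t))
      = (\<Sum>i=1..m. (\<integral>y. (\<integral>z. f i z \<partial>P i) - f i (y i) \<partial>distr M ZZ (fresh t)))"
    using integrable_fresh(1)[OF t _ f] by (intro Bochner_Integration.integral_sum Bochner_Integration.integrable_diff) auto
  also have "\<dots> = (\<Sum>i=1..m. 0)"
  proof (intro sum.cong refl)
    fix i assume i: "i \<in> {1..m}"
    show "(\<integral>y. (\<integral>z. f i z \<partial>P i) - f i (y i) \<partial>distr M ZZ (fresh t)) = 0"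
      using integrable_fresh[OF t i f[OF i]] Q.prob_space by simp
  qed
  finally show ?thesis by simp
qed

abbreviation "good \<equiv> good_sample \<l> d\<l> G"

lemma AE_good_fresh: "t \<ge> 1 \<Longrightarrow> AE y in distr M ZZ (fresh t). \<forall>i\<in>{1..m}. good (y i)"
proof (intro AE_finite_allI)
  fix i assume t: "t \<ge> 1" and i: "i \<in> {1..m}"
  have "AE z in distr (distr M ZZ (fresh t)) Z (\<lambda>y. y i). good z"
    unfolding distr_fresh[OF t i] by (rule loss_distribution.AE_good[OF distribution[OF i]])
  then show "AE y in distr M ZZ (fresh t). good (y i)"
    by (rule AE_distrD[OF coordinate_measurable[OF i]])
qed simp

text \<open>Countably many rounds and finitely many indices leave one null set; off it all regret
  estimates are deterministic statements about a trajectory.\<close>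

lemma AE_good_samples: "AE \<omega> in M. \<forall>t\<ge>1. \<forall>i\<in>{1..m}. good (fresh t \<omega> i)"
proof -
  have "AE \<omega> in M. t \<ge> 1 \<longrightarrow> (\<forall>i\<in>{1..m}. good (fresh t \<omega> i))" for t
    using AE_distrD[OF fresh_measurable AE_good_fresh, of t] by (cases "t \<ge> 1") auto
  then show ?thesis by (subst AE_all_countable) auto
qed

section \<open>Step sizes, noise, ghosts and the closed form of the iterates\<close>

definition K :: real where "K = sqrt (2 * D\<^sup>2 * G\<^sup>2 + 2 * ln (real m))"

definition r :: "nat \<Rightarrow> real" where "r j = 1 / sqrt (real j)"

lemma ln_m: "2 / 3 \<le> ln (real m)"
  by (rule ln_real_ge_two_thirds[OF m])

lemma K_pos: "K > 0" and K_power2: "K\<^sup>2 = 2 * D\<^sup>2 * G\<^sup>2 + 2 * ln (real m)"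
proof -
  have "2 * D\<^sup>2 * G\<^sup>2 + 2 * ln (real m) > 0" using ln_m by (intro add_nonneg_pos) auto
  then show "K > 0" "K\<^sup>2 = 2 * D\<^sup>2 * G\<^sup>2 + 2 * ln (real m)" by (auto simp: K_def)
qed

lemma r_nonneg: "0 \<le> r j" and r_pos: "j \<ge> 1 \<Longrightarrow> 0 < r j" and r_power2: "(r j)\<^sup>2 = 1 / real j"
  by (auto simp: r_def power_divide)

lemma step_w_r: "step_w D G m j = 2 * D\<^sup>2 / K * r j"
  and step_q_r: "step_q D G m j = 2 * ln (real m) / K * r j"
  and step_single_r: "step_single D G j = D / G * r j"
  by (simp_all add: step_w_def step_q_def step_single_def K_def r_def real_sqrt_mult)

definition wbi :: "nat \<Rightarrow> nat \<Rightarrow> 's \<Rightarrow> 'a" where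
  "wbi i t \<omega> = weighted_avg (step_single D G) (\<lambda>j. wi i j \<omega>) t"

definition grad_w :: "nat \<Rightarrow> 's \<Rightarrow> (nat \<Rightarrow> 'z) \<Rightarrow> 'a" where
  "grad_w t \<omega> y = (\<Sum>i=1..m. q t \<omega> i *\<^sub>R d\<l> (w t \<omega>) (y i))"

definition grad_q :: "nat \<Rightarrow> 's \<Rightarrow> (nat \<Rightarrow> 'z) \<Rightarrow> nat \<Rightarrow> real" where
  "grad_q t \<omega> y i = \<l> (w t \<omega>) (y i) - \<l> (wbi i t \<omega>) (y i)"

definition noise_w :: "nat \<Rightarrow> 's \<Rightarrow> (nat \<Rightarrow> 'z) \<Rightarrow> 'a" where
  "noise_w t \<omega> y = (\<Sum>i=1..m. q t \<omega> i *\<^sub>R (grad_risk d\<l> (P i) (w t \<omega>) - d\<l> (w t \<omega>) (y i)))"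

text \<open>Exact minus observed, as for \<open>noise_w\<close>. The exact value is the risk
  difference to \<open>wbi i t\<close>, not to the minimum; the gap between these two is the bias
  and is not centred.\<close>

definition noise_q :: "nat \<Rightarrow> 's \<Rightarrow> (nat \<Rightarrow> 'z) \<Rightarrow> nat \<Rightarrow> real" where
  "noise_q t \<omega> y i = (risk \<l> (P i) (w t \<omega>) - risk \<l> (P i) (wbi i t \<omega>)) - grad_q t \<omega> y i"

text \<open>
  Ghost iterates: mirror descent on the noise. They are predictable, and they absorb the part of the
  noise that depends on the comparison point.
\<close>

primrec ghost_w :: "nat \<Rightarrow> 's \<Rightarrow> 'a" where
  "ghost_w 0 \<omega> = ow"
| "ghost_w (Suc t) \<omega> = (if t = 0 then ow
     else mirror_step (step_w D G m t) (noise_w t \<omega> (fresh t \<omega>)) (ghost_w t \<omega>))"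

primrec ghost_q :: "nat \<Rightarrow> 's \<Rightarrow> nat \<Rightarrow> real" where
  "ghost_q 0 \<omega> = (\<lambda>i. if i \<in> {1..m} then 1 / real m else 0)"
| "ghost_q (Suc t) \<omega> = (if t = 0 then (\<lambda>i. if i \<in> {1..m} then 1 / real m else 0)
     else entropic_step m (step_q D G m t) (noise_q t \<omega> (fresh t \<omega>)) (ghost_q t \<omega>))"

lemma ghost_w_S: "ghost_w t \<omega> \<in> S" and ghost_w_W: "ghost_w t \<omega> \<in> W"
proof -
  show "ghost_w t \<omega> \<in> S" by (cases t) (auto simp: ow_S mirror_step_S)
  then show "ghost_w t \<omega> \<in> W" using S_subset by auto
qed

lemma ghost_q_pos_simplex: "ghost_q t \<omega> \<in> pos_simplex m"
  by (induction t) (use uniform_pos_simplex[OF m1] entropic_step_pos_simplex in auto)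

lemma run_1:
  assumes "\<omega> \<in> space M"
  shows "i \<in> {1..m} \<Longrightarrow> wi i 1 \<omega> = ow" "w 1 \<omega> = ow"
    "q 1 \<omega> = (\<lambda>i. if i \<in> {1..m} then 1 / real m else 0)"
  using run[OF assms] unfolding anytime_sa_trajectory_def by auto

lemma run_wi:
  assumes \<omega>: "\<omega> \<in> space M" and t: "t \<ge> 1" and i: "i \<in> {1..m}"
  shows "wi i (Suc t) \<omega> = mirror_step (step_single D G t) (d\<l> (wi i t \<omega>) (fresh t \<omega> i)) (wi i t \<omega>)"
  using run[OF \<omega>] t i unfolding anytime_sa_trajectory_def fresh_apply[OF i] Suc_eq_plus1
  by (intro mirror_step_unique) blast

lemma run_w:
  assumes \<omega>: "\<omega> \<in> space M" and t: "t \<ge> 1"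
  shows "w (Suc t) \<omega> = mirror_step (step_w D G m t) (grad_w t \<omega> (fresh t \<omega>)) (w t \<omega>)"
proof -
  have "grad_w t \<omega> (fresh t \<omega>) = (\<Sum>i=1..m. q t \<omega> i *\<^sub>R d\<l> (w t \<omega>) (zs t i \<omega>))"
    unfolding grad_w_def by (intro sum.cong refl) (simp add: fresh_apply)
  then show ?thesis
    using run[OF \<omega>] t unfolding anytime_sa_trajectory_def Let_def Suc_eq_plus1
    by (intro mirror_step_unique) simp
qed

lemma run_q_arg_min:
  assumes \<omega>: "\<omega> \<in> space M" and t: "t \<ge> 1"
  shows "is_arg_min (\<lambda>p. step_q D G m t * (\<Sum>i=1..m. - grad_q t \<omega> (fresh t \<omega>) i * (p i - q t \<omega> i))
    + bregman_entropy m p (q t \<omega>)) (\<lambda>p. p \<in> prob_simplex m) (q (Suc t) \<omega>)"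
proof -
  have "(\<Sum>i=1..m. - grad_q t \<omega> (fresh t \<omega>) i * (p i - q t \<omega> i))
      = (\<Sum>i=1..m. - (\<l> (w t \<omega>) (zs t i \<omega>) - \<l> (wbi i t \<omega>) (zs t i \<omega>)) * (p i - q t \<omega> i))" for p
    unfolding grad_q_def by (intro sum.cong refl) (simp add: fresh_apply)
  then show ?thesis
    using run[OF \<omega>] t unfolding anytime_sa_trajectory_def Let_def Suc_eq_plus1 wbi_def by simp
qed

text \<open>\<open>entropic_step_unique\<close> presupposes a positive current point, so positivity
  is propagated along the run before the closed form \<open>run_q\<close> is available.\<close>

lemma q_pos_simplex:
  assumes \<omega>: "\<omega> \<in> space M" and t: "t \<ge> 1"
  shows "q t \<omega> \<in> pos_simplex m"
  using t
proof (induction t rule: dec_induct)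
  case base
  then show ?case using run_1(3)[OF \<omega>] uniform_pos_simplex[OF m1] by simp
next
  case (step t)
  then show ?case
    using entropic_step_unique[OF _ run_q_arg_min[OF \<omega>]] entropic_step_pos_simplex by simp
qed

lemma run_q:
  assumes \<omega>: "\<omega> \<in> space M" and t: "t \<ge> 1"
  shows "q (Suc t) \<omega> = entropic_step m (step_q D G m t) (grad_q t \<omega> (fresh t \<omega>)) (q t \<omega>)"
  by (rule entropic_step_unique[OF q_pos_simplex[OF \<omega> t] run_q_arg_min[OF \<omega> t]])

lemma w_S:
  assumes \<omega>: "\<omega> \<in> space M" and t: "t \<ge> 1"
  shows "w t \<omega> \<in> S"
  using t by (induction t rule: dec_induct)
    (use run_1(2)[OF \<omega>] ow_S run_w[OF \<omega>] mirror_step_S in auto)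

lemma wi_S:
  assumes \<omega>: "\<omega> \<in> space M" and t: "t \<ge> 1" and i: "i \<in> {1..m}"
  shows "wi i t \<omega> \<in> S"
  using t by (induction t rule: dec_induct)
    (use run_1(1)[OF \<omega> i] ow_S run_wi[OF \<omega> _ i] mirror_step_S in auto)

lemma w_W: "\<omega> \<in> space M \<Longrightarrow> t \<ge> 1 \<Longrightarrow> w t \<omega> \<in> W"
  and wi_W: "\<omega> \<in> space M \<Longrightarrow> t \<ge> 1 \<Longrightarrow> i \<in> {1..m} \<Longrightarrow> wi i t \<omega> \<in> W"
  using w_S wi_S S_subset by blast+

lemma q_simplex: "\<omega> \<in> space M \<Longrightarrow> t \<ge> 1 \<Longrightarrow> q t \<omega> \<in> prob_simplex m"
  using q_pos_simplex pos_simplexD(1) by blast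

lemma weighted_avg_scale:
  "c \<noteq> 0 \<Longrightarrow> weighted_avg (\<lambda>j. c * r j) x t = weighted_avg r x t"
  unfolding weighted_avg_def by (simp add: sum_distrib_left[symmetric])

lemma r_sum_pos: "t \<ge> 1 \<Longrightarrow> 0 < (\<Sum>j=1..t. r j)"
  by (intro sum_pos) (auto intro: r_pos)

lemma weighted_avg_convex:
  assumes t: "t \<ge> 1" and f: "convex_on W f" and x: "\<And>j. j \<in> {1..t} \<Longrightarrow> x j \<in> W"
  shows "(\<Sum>j=1..t. r j) * f (weighted_avg r x t) \<le> (\<Sum>j=1..t. r j * f (x j))"
proof -
  let ?A = "\<Sum>j=1..t. r j"
  have A: "?A > 0" by (rule r_sum_pos[OF t])
  have "f (weighted_avg r x t) \<le> (\<Sum>j=1..t. r j / ?A * f (x j))"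
    unfolding weighted_avg_def
    by (rule convex_on_sum[OF _ _ f]) (use t x A r_nonneg in \<open>auto simp: sum_divide_distrib[symmetric]\<close>)
  then have "?A * f (weighted_avg r x t) \<le> ?A * (\<Sum>j=1..t. r j / ?A * f (x j))"
    using A by (intro mult_left_mono) auto
  also have "\<dots> = (\<Sum>j=1..t. r j * f (x j))" using A by (simp add: sum_distrib_left)
  finally show ?thesis .
qed

lemma weighted_avg_W:
  assumes t: "t \<ge> 1" and x: "\<And>j. j \<in> {1..t} \<Longrightarrow> x j \<in> W"
  shows "weighted_avg r x t \<in> W"
  unfolding weighted_avg_def
  by (rule convex_sum[OF _ W_convex])
    (use t x r_sum_pos[OF t] r_nonneg in \<open>auto simp: sum_divide_distrib[symmetric] intro!: divide_nonneg_pos\<close>)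

lemma wbi_eq: "wbi i t \<omega> = weighted_avg r (\<lambda>j. wi i j \<omega>) t"
  unfolding wbi_def step_single_r[abs_def] using D_pos G_pos by (intro weighted_avg_scale) auto

lemma wbi_W: "\<omega> \<in> space M \<Longrightarrow> t \<ge> 1 \<Longrightarrow> i \<in> {1..m} \<Longrightarrow> wbi i t \<omega> \<in> W"
  unfolding wbi_eq by (intro weighted_avg_W wi_W) auto

end

section \<open>Predictability of the iterates\<close>

lemma (in mirror_map) mirror_step_measurable:
  assumes g: "g \<in> borel_measurable A" and v: "v \<in> borel_measurable A" "\<And>x. x \<in> space A \<Longrightarrow> v x \<in> S"
  shows "(\<lambda>x. mirror_step \<eta> (g x) (v x)) \<in> borel_measurable A"
proof -
  have "(\<lambda>x. d\<nu> (v x)) \<in> borel_measurable A"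
    by (rule measurable_compose[OF measurable_restrict_space2
          borel_measurable_continuous_on_restrict[OF d\<nu>_cont]]) (use v in auto)
  then have "(\<lambda>x. \<eta> *\<^sub>R g x - d\<nu> (v x)) \<in> borel_measurable A" using g by measurable
  then show ?thesis
    unfolding mirror_step_def
    by (rule measurable_compose[OF _ borel_measurable_continuous_onI[OF continuous_on_prox]])
qed

lemma entropic_step_measurable:
  assumes "\<And>i. i \<in> {1..m} \<Longrightarrow> (\<lambda>x. g x i) \<in> borel_measurable A"
    and "\<And>i. i \<in> {1..m} \<Longrightarrow> (\<lambda>x. p x i) \<in> borel_measurable A"
  shows "(\<lambda>x. entropic_step m \<eta> (g x) (p x) i) \<in> borel_measurable A"
proof -
  have [measurable]: "(\<lambda>x. p x k * exp (\<eta> * g x k)) \<in> borel_measurable A" if "k \<in> {1..m}" for k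
    using assms[OF that] by measurable
  show ?thesis unfolding entropic_step_def by (cases "i \<in> {1..m}") auto
qed

context anytime_sa
begin

text \<open>Measurability of the trajectories is derived, not assumed. The recursion holds at every
  point of \<open>space M\<close>, and its right side uses only quantities of round \<open>t\<close>
  and \<open>fresh t\<close>, all measurable in \<open>past (Suc t)\<close>.\<close>

lemma wi_adapted:
  assumes i: "i \<in> {1..m}" and t: "t \<ge> 1"
  shows "wi i t \<in> borel_measurable (past t)"
  using t
proof (induction t rule: dec_induct)
  case base
  have "(\<lambda>\<omega>. ow) \<in> borel_measurable (past 1)" by simp
  then show ?case
    by (subst measurable_cong[where g = "\<lambda>\<omega>. ow"]) (use run_1(1)[OF _ i] space_past in auto)
next
  case (step t)
  have v: "wi i t \<in> borel_measurable (past (Suc t))"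
    using measurable_F_mono[OF _ step.IH] by simp
  have "(\<lambda>\<omega>. mirror_step (step_single D G t) (d\<l> (wi i t \<omega>) (fresh t \<omega> i)) (wi i t \<omega>))
      \<in> borel_measurable (past (Suc t))"
    using step i
    by (intro mirror_step_measurable v loss_distribution.sample_measurable(2)[OF distribution[OF i]]
        measurable_compose[OF fresh_past measurable_component_singleton])
      (auto simp: space_past intro: wi_W wi_S)
  then show ?case
    by (subst measurable_cong) (use run_wi[OF _ _ i] step space_past in auto)
qed

lemma wbi_adapted: "i \<in> {1..m} \<Longrightarrow> t \<ge> 1 \<Longrightarrow> wbi i t \<in> borel_measurable (past t)"
  unfolding wbi_def[abs_def] weighted_avg_def
  by (intro borel_measurable_sum borel_measurable_scaleR borel_measurable_const measurable_F_mono[OF _ wi_adapted]) auto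

context
  fixes A :: "'x measure" and \<pi> :: "'x \<Rightarrow> 's" and y :: "'x \<Rightarrow> nat \<Rightarrow> 'z" and t :: nat
  assumes t: "t \<ge> 1" and \<pi>: "\<pi> \<in> measurable A (past t)" and y: "y \<in> measurable A ZZ"
    and w_meas: "w t \<in> borel_measurable (past t)"
    and q_meas: "\<And>i. i \<in> {1..m} \<Longrightarrow> (\<lambda>\<omega>. q t \<omega> i) \<in> borel_measurable (past t)"
begin

lemma \<pi>_space: "x \<in> space A \<Longrightarrow> \<pi> x \<in> space M"
  using measurable_space[OF \<pi>] by (simp add: space_past)

lemma y_meas: "i \<in> {1..m} \<Longrightarrow> (\<lambda>x. y x i) \<in> measurable A Z"
  by (rule measurable_compose[OF y measurable_component_singleton])

text \<open>\<open>\<pi>\<close> supplies the past and \<open>y\<close> the draw. Two instances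
  occur: the identity with \<open>fresh t\<close> on \<open>past (Suc t)\<close>, for the
  recursions, and the two projections of \<open>past t \<Otimes>\<^sub>M ZZ\<close>, for the joint
  measurability of the martingale increments.\<close>

lemma w_comp: "(\<lambda>x. w t (\<pi> x)) \<in> borel_measurable A"
  and q_comp: "i \<in> {1..m} \<Longrightarrow> (\<lambda>x. q t (\<pi> x) i) \<in> borel_measurable A"
  and wbi_comp: "i \<in> {1..m} \<Longrightarrow> (\<lambda>x. wbi i t (\<pi> x)) \<in> borel_measurable A"
  by (rule measurable_compose[OF \<pi> w_meas], rule measurable_compose[OF \<pi> q_meas], assumption,
      rule measurable_compose[OF \<pi> wbi_adapted[OF _ t]])

lemma grad_w_comp: "(\<lambda>x. grad_w t (\<pi> x) (y x)) \<in> borel_measurable A"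
  unfolding grad_w_def
  by (intro borel_measurable_sum borel_measurable_scaleR q_comp y_meas w_comp w_W \<pi>_space t
      loss_distribution.sample_measurable(2)[OF distribution]) auto

lemma grad_q_comp: "i \<in> {1..m} \<Longrightarrow> (\<lambda>x. grad_q t (\<pi> x) (y x) i) \<in> borel_measurable A"
  unfolding grad_q_def
  by (intro borel_measurable_diff y_meas w_comp wbi_comp w_W wbi_W \<pi>_space t
      loss_distribution.sample_measurable(1)[OF distribution]) auto

lemma noise_w_comp: "(\<lambda>x. noise_w t (\<pi> x) (y x)) \<in> borel_measurable A"
  unfolding noise_w_def
  by (intro borel_measurable_sum borel_measurable_scaleR borel_measurable_diff q_comp y_meas w_comp w_W
      \<pi>_space t loss_distribution.sample_measurable(2)[OF distribution]
      loss_distribution.grad_risk_measurable[OF distribution]) auto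

lemma noise_q_comp: "i \<in> {1..m} \<Longrightarrow> (\<lambda>x. noise_q t (\<pi> x) (y x) i) \<in> borel_measurable A"
  unfolding noise_q_def
  by (intro borel_measurable_diff grad_q_comp w_comp wbi_comp w_W wbi_W \<pi>_space t
      loss_distribution.risk_measurable[OF distribution]) auto

end

text \<open>One joint induction, because the update of \<open>w\<close> uses \<open>q\<close> and
  the update of \<open>q\<close> uses \<open>w\<close>.\<close>

lemma iterates_adapted:
  assumes t: "t \<ge> 1"
  shows "w t \<in> borel_measurable (past t) \<and> (\<forall>i\<in>{1..m}. (\<lambda>\<omega>. q t \<omega> i) \<in> borel_measurable (past t))"
  using t
proof (induction t rule: dec_induct)
  case base
  have "w 1 \<in> borel_measurable (past 1)"
    by (subst measurable_cong[where g = "\<lambda>\<omega>. ow"]) (use run_1(2) space_past in auto)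
  moreover have "(\<lambda>\<omega>. q 1 \<omega> i) \<in> borel_measurable (past 1)" if "i \<in> {1..m}" for i
    by (subst measurable_cong[where g = "\<lambda>\<omega>. 1 / real m"]) (use run_1(3) space_past that in auto)
  ultimately show ?case by blast
next
  case (step t)
  note ih = conjunct1[OF step.IH] bspec[OF conjunct2[OF step.IH]]
  have id: "(\<lambda>\<omega>. \<omega>) \<in> measurable (past (Suc t)) (past t)"
    by (rule measurable_F_mono[of t "Suc t" "\<lambda>\<omega>. \<omega>"]) auto
  have fr: "fresh t \<in> measurable (past (Suc t)) ZZ" using step by (intro fresh_past) auto
  note comp = step.hyps(1) id fr ih
  have "(\<lambda>\<omega>. mirror_step (step_w D G m t) (grad_w t \<omega> (fresh t \<omega>)) (w t \<omega>)) \<in> borel_measurable (past (Suc t))"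
    using step by (intro mirror_step_measurable grad_w_comp[OF comp] w_comp[OF comp]) (auto simp: space_past intro: w_S)
  then have "w (Suc t) \<in> borel_measurable (past (Suc t))"
    by (subst measurable_cong) (use run_w step space_past in auto)
  moreover have "(\<lambda>\<omega>. q (Suc t) \<omega> i) \<in> borel_measurable (past (Suc t))" for i
  proof -
    have "(\<lambda>\<omega>. entropic_step m (step_q D G m t) (grad_q t \<omega> (fresh t \<omega>)) (q t \<omega>) i) \<in> borel_measurable (past (Suc t))"
      by (intro entropic_step_measurable grad_q_comp[OF comp] q_comp[OF comp])
    then show ?thesis
      by (subst measurable_cong) (use run_q step space_past in auto)
  qed
  ultimately show ?case by blast
qed

lemma w_adapted: "t \<ge> 1 \<Longrightarrow> w t \<in> borel_measurable (past t)"
  and q_adapted: "t \<ge> 1 \<Longrightarrow> i \<in> {1..m} \<Longrightarrow> (\<lambda>\<omega>. q t \<omega> i) \<in> borel_measurable (past t)"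
  using iterates_adapted by blast+

lemma ghosts_adapted:
  assumes t: "t \<ge> 1"
  shows "ghost_w t \<in> borel_measurable (past t)" "i \<in> {1..m} \<Longrightarrow> (\<lambda>\<omega>. ghost_q t \<omega> i) \<in> borel_measurable (past t)"
proof -
  have "ghost_w t \<in> borel_measurable (past t) \<and> (\<forall>i\<in>{1..m}. (\<lambda>\<omega>. ghost_q t \<omega> i) \<in> borel_measurable (past t))"
    using t
  proof (induction t rule: dec_induct)
    case base
    have "ghost_w 1 = (\<lambda>\<omega>. ow)" "ghost_q 1 = (\<lambda>\<omega> i. if i \<in> {1..m} then 1 / real m else 0)"
      by (auto simp: One_nat_def fun_eq_iff)
    then show ?case by simp
  next
    case (step t)
    have id: "(\<lambda>\<omega>. \<omega>) \<in> measurable (past (Suc t)) (past t)"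
      by (rule measurable_F_mono[of t "Suc t" "\<lambda>\<omega>. \<omega>"]) auto
    have fr: "fresh t \<in> measurable (past (Suc t)) ZZ" using step by (intro fresh_past) auto
    note comp = step.hyps(1) id fr w_adapted[OF step.hyps(1)] q_adapted[OF step.hyps(1)]
    have gw: "ghost_w (Suc t) = (\<lambda>\<omega>. mirror_step (step_w D G m t) (noise_w t \<omega> (fresh t \<omega>)) (ghost_w t \<omega>))"
      and gq: "ghost_q (Suc t) = (\<lambda>\<omega>. entropic_step m (step_q D G m t) (noise_q t \<omega> (fresh t \<omega>)) (ghost_q t \<omega>))"
      using step by auto
    have "ghost_w (Suc t) \<in> borel_measurable (past (Suc t))"
      unfolding gw using step
      by (intro mirror_step_measurable noise_w_comp[OF comp] measurable_F_mono[of t "Suc t"]) (auto intro: ghost_w_S)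
    moreover have "(\<lambda>\<omega>. ghost_q (Suc t) \<omega> i) \<in> borel_measurable (past (Suc t))" for i
      unfolding gq using step
      by (intro entropic_step_measurable noise_q_comp[OF comp] measurable_F_mono[of t "Suc t"]) auto
    ultimately show ?case by blast
  qed
  then show "ghost_w t \<in> borel_measurable (past t)" "i \<in> {1..m} \<Longrightarrow> (\<lambda>\<omega>. ghost_q t \<omega> i) \<in> borel_measurable (past t)"
    by blast+
qed

section \<open>Bounds on gradients and noise, and the martingale differences built from them\<close>

lemma simplex_combination_bound:
  assumes p: "p \<in> prob_simplex m" and a: "\<And>i. i \<in> {1..m} \<Longrightarrow> \<bar>a i \<bullet> x\<bar> \<le> c"
  shows "\<bar>(\<Sum>i=1..m. p i *\<^sub>R a i) \<bullet> x\<bar> \<le> c"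
proof -
  have "\<bar>(\<Sum>i=1..m. p i *\<^sub>R a i) \<bullet> x\<bar> \<le> (\<Sum>i=1..m. \<bar>p i * (a i \<bullet> x)\<bar>)"
    by (simp add: inner_sum_left sum_abs)
  also have "\<dots> \<le> (\<Sum>i=1..m. p i * c)"
    using a prob_simplexD(1)[OF p] by (intro sum_mono) (auto simp: abs_mult intro!: mult_left_mono)
  also have "\<dots> = c" using prob_simplexD(2)[OF p] by (simp add: sum_distrib_right[symmetric])
  finally show ?thesis .
qed

context
  fixes \<omega> :: 's and t :: nat and y :: "nat \<Rightarrow> 'z"
  assumes \<omega>: "\<omega> \<in> space M" and t: "t \<ge> 1" and y: "\<forall>i\<in>{1..m}. good (y i)"
begin

lemma good_bounds:
  assumes "i \<in> {1..m}" "u \<in> W"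
  shows "\<bar>d\<l> u (y i) \<bullet> x\<bar> \<le> G * N x" "0 \<le> \<l> u (y i)" "\<l> u (y i) \<le> 1"
  using y assms unfolding good_sample_def by auto

lemma grad_w_bound: "\<bar>grad_w t \<omega> y \<bullet> x\<bar> \<le> G * N x"
  unfolding grad_w_def
  by (intro simplex_combination_bound q_simplex good_bounds w_W \<omega> t)

lemma noise_bound:
  assumes i: "i \<in> {1..m}" and u: "u \<in> W"
  shows "\<bar>(grad_risk d\<l> (P i) u - d\<l> u (y i)) \<bullet> x\<bar> \<le> 2 * G * N x"
  using good_bounds(1)[OF i u, of x] loss_distribution.grad_risk_bound[OF distribution[OF i] u, of x]
  by (simp add: inner_diff_left)

lemma noise_w_bound: "\<bar>noise_w t \<omega> y \<bullet> x\<bar> \<le> 2 * G * N x"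
  unfolding noise_w_def
  by (intro simplex_combination_bound q_simplex noise_bound w_W \<omega> t)

lemma grad_q_bound: "i \<in> {1..m} \<Longrightarrow> \<bar>grad_q t \<omega> y i\<bar> \<le> 1"
  using good_bounds(2,3)[of i "w t \<omega>"] good_bounds(2,3)[of i "wbi i t \<omega>"] w_W[OF \<omega> t] wbi_W[OF \<omega> t]
  unfolding grad_q_def by fastforce

lemma noise_q_bound:
  assumes i: "i \<in> {1..m}"
  shows "\<bar>noise_q t \<omega> y i\<bar> \<le> 2"
  using grad_q_bound[OF i] loss_distribution.risk_bounds[OF distribution[OF i] w_W[OF \<omega> t]]
    loss_distribution.risk_bounds[OF distribution[OF i] wbi_W[OF \<omega> t i]]
  unfolding noise_q_def by linarith

end

text \<open>What remains of the noise once the comparison point has been replaced by the ghost: both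
  the iterate and the ghost are predictable, so the increment is centred.\<close>

definition mart :: "nat \<Rightarrow> 's \<Rightarrow> (nat \<Rightarrow> 'z) \<Rightarrow> real" where
  "mart t \<omega> y = r t * (noise_w t \<omega> y \<bullet> (w t \<omega> - ghost_w t \<omega>)
     + (\<Sum>i=1..m. noise_q t \<omega> y i * (ghost_q t \<omega> i - q t \<omega> i)))"

definition wopt :: "nat \<Rightarrow> 'a" where
  "wopt i = (SOME u. u \<in> W \<and> risk \<l> (P i) u = min_risk W \<l> (P i))"

text \<open>The comparison point \<open>wopt i\<close> is a fixed minimiser of one risk, so the
  noise against it is a martingale difference without a ghost.\<close>

definition mart_single :: "nat \<Rightarrow> nat \<Rightarrow> 's \<Rightarrow> (nat \<Rightarrow> 'z) \<Rightarrow> real" where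
  "mart_single i t \<omega> y = r t * ((grad_risk d\<l> (P i) (wi i t \<omega>) - d\<l> (wi i t \<omega>) (y i)) \<bullet> (wi i t \<omega> - wopt i))"

lemma wopt: "i \<in> {1..m} \<Longrightarrow> wopt i \<in> W \<and> risk \<l> (P i) (wopt i) = min_risk W \<l> (P i)"
  unfolding wopt_def by (rule someI_ex) (use loss_distribution.min_risk_attained[OF distribution] in blast)

text \<open>\<open>(x + 1)^2 \<le> 2 * (x^2 + 1)\<close> at \<open>x = sqrt 2 * D * G\<close>, then
  \<open>1 \<le> 2 * ln m\<close> from \<open>m \<ge> 2\<close>. It merges the noise ranges of the
  two players into one multiple of \<open>K\<close>.\<close>

lemma noise_scale_le_K: "sqrt 2 * D * G + 1 \<le> sqrt 2 * K"
proof (rule power2_le_imp_le)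
  have "0 \<le> (sqrt 2 * D * G - 1)\<^sup>2" by simp
  then have "(sqrt 2 * D * G + 1)\<^sup>2 \<le> 2 * (2 * D\<^sup>2 * G\<^sup>2 + 1)"
    by (simp add: power2_sum power2_diff power_mult_distrib)
  also have "\<dots> \<le> 2 * K\<^sup>2" using ln_m by (simp add: K_power2)
  also have "\<dots> = (sqrt 2 * K)\<^sup>2" by (simp add: power_mult_distrib)
  finally show "(sqrt 2 * D * G + 1)\<^sup>2 \<le> (sqrt 2 * K)\<^sup>2" .
qed (use K_pos in simp)

text \<open>Noise times diameter for each player: \<open>2 * G\<close> times
  \<open>2 * sqrt 2 * D\<close>, and 2 times the l1 diameter 2 of the simplex.\<close>

lemma mart_bound:
  assumes \<omega>: "\<omega> \<in> space M" and t: "t \<ge> 1" and y: "\<forall>i\<in>{1..m}. good (y i)"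
  shows "\<bar>mart t \<omega> y\<bar> \<le> 4 * sqrt 2 * K * r t"
proof -
  have "\<bar>noise_w t \<omega> y \<bullet> (w t \<omega> - ghost_w t \<omega>)\<bar> \<le> 2 * G * N (w t \<omega> - ghost_w t \<omega>)"
    by (rule noise_w_bound[OF \<omega> t y])
  also have "\<dots> \<le> 2 * G * (2 * sqrt 2 * D)"
    using G_pos by (intro mult_left_mono N_diameter2 w_W[OF \<omega> t] ghost_w_W) auto
  finally have 1: "\<bar>noise_w t \<omega> y \<bullet> (w t \<omega> - ghost_w t \<omega>)\<bar> \<le> 4 * sqrt 2 * D * G" by (simp add: mult_ac)
  have "\<bar>\<Sum>i=1..m. noise_q t \<omega> y i * (ghost_q t \<omega> i - q t \<omega> i)\<bar>
      \<le> (\<Sum>i=1..m. \<bar>noise_q t \<omega> y i * (ghost_q t \<omega> i - q t \<omega> i)\<bar>)" by (rule sum_abs)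
  also have "\<dots> \<le> (\<Sum>i=1..m. 2 * \<bar>ghost_q t \<omega> i - q t \<omega> i\<bar>)"
    unfolding abs_mult by (intro sum_mono mult_right_mono noise_q_bound[OF \<omega> t y]) auto
  also have "\<dots> \<le> 4"
    using prob_simplex_l1_le_2[OF pos_simplexD(1)[OF ghost_q_pos_simplex] q_simplex[OF \<omega> t], of t]
    by (simp add: sum_distrib_left[symmetric])
  finally have "\<bar>noise_w t \<omega> y \<bullet> (w t \<omega> - ghost_w t \<omega>)
      + (\<Sum>i=1..m. noise_q t \<omega> y i * (ghost_q t \<omega> i - q t \<omega> i))\<bar> \<le> 4 * (sqrt 2 * D * G + 1)"
    using 1 by (simp add: distrib_left)
  also have "\<dots> \<le> 4 * (sqrt 2 * K)" using noise_scale_le_K by simp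
  finally have "r t * \<bar>noise_w t \<omega> y \<bullet> (w t \<omega> - ghost_w t \<omega>)
      + (\<Sum>i=1..m. noise_q t \<omega> y i * (ghost_q t \<omega> i - q t \<omega> i))\<bar> \<le> r t * (4 * (sqrt 2 * K))"
    by (intro mult_left_mono r_nonneg)
  then show ?thesis
    unfolding mart_def abs_mult using r_nonneg[of t] by (simp add: mult_ac)
qed

lemma mart_single_bound:
  assumes \<omega>: "\<omega> \<in> space M" and t: "t \<ge> 1" and y: "\<forall>i\<in>{1..m}. good (y i)" and i: "i \<in> {1..m}"
  shows "\<bar>mart_single i t \<omega> y\<bar> \<le> 4 * sqrt 2 * D * G * r t"
proof -
  let ?d = "wi i t \<omega> - wopt i"
  have "\<bar>(grad_risk d\<l> (P i) (wi i t \<omega>) - d\<l> (wi i t \<omega>) (y i)) \<bullet> ?d\<bar> \<le> 2 * G * N ?d"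
    by (rule noise_bound[OF \<omega> t y i wi_W[OF \<omega> t i]])
  also have "\<dots> \<le> 2 * G * (2 * sqrt 2 * D)"
    using G_pos wopt[OF i] by (intro mult_left_mono N_diameter2 wi_W[OF \<omega> t i]) auto
  finally have "r t * \<bar>(grad_risk d\<l> (P i) (wi i t \<omega>) - d\<l> (wi i t \<omega>) (y i)) \<bullet> ?d\<bar> \<le> r t * (2 * G * (2 * sqrt 2 * D))"
    by (intro mult_left_mono r_nonneg)
  then show ?thesis
    unfolding mart_single_def abs_mult using r_nonneg[of t] by (simp add: mult_ac)
qed

lemma mart_martingale_diff:
  assumes t: "t \<ge> 1" shows "martingale_diff t (4 * sqrt 2 * K * r t) (mart t)"
  unfolding martingale_diff_def
proof (intro conjI ballI)
  have \<pi>: "fst \<in> measurable (past t \<Otimes>\<^sub>M ZZ) (past t)" and y: "snd \<in> measurable (past t \<Otimes>\<^sub>M ZZ) ZZ" by auto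
  note comp = t \<pi> y w_adapted[OF t] q_adapted[OF t]
  have g: "(\<lambda>x. ghost_w t (fst x)) \<in> borel_measurable (past t \<Otimes>\<^sub>M ZZ)"
    and gq: "(\<lambda>x. ghost_q t (fst x) i) \<in> borel_measurable (past t \<Otimes>\<^sub>M ZZ)" if "i \<in> {1..m}" for i
    using measurable_compose[OF \<pi> ghosts_adapted(1)[OF t]] measurable_compose[OF \<pi> ghosts_adapted(2)[OF t that]] by auto
  have "(\<lambda>x. mart t (fst x) (snd x)) \<in> borel_measurable (past t \<Otimes>\<^sub>M ZZ)"
    unfolding mart_def
    by (intro borel_measurable_times borel_measurable_add borel_measurable_sum borel_measurable_inner
        borel_measurable_diff borel_measurable_const noise_w_comp[OF comp] noise_q_comp[OF comp]
        w_comp[OF comp] q_comp[OF comp] g[OF one_le_m(1)] gq)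
  then show "(\<lambda>(\<omega>, y). mart t \<omega> y) \<in> borel_measurable (past t \<Otimes>\<^sub>M ZZ)" by (simp add: case_prod_beta')
next
  fix \<omega> assume \<omega>: "\<omega> \<in> space M"
  show "AE y in distr M ZZ (fresh t). \<bar>mart t \<omega> y\<bar> \<le> 4 * sqrt 2 * K * r t"
    using AE_good_fresh[OF t] by eventually_elim (rule mart_bound[OF \<omega> t])
  let ?d = "w t \<omega> - ghost_w t \<omega>"
  \<comment> \<open>Everything in the increment that depends on the \<open>i\<close>-th sample, with
    \<open>\<omega>\<close> frozen. The increment is then the sum of mean minus value over the
    coordinates, as \<open>integral_centered_sum\<close> requires.\<close>
  define f where "f i z = r t * (q t \<omega> i * (d\<l> (w t \<omega>) z \<bullet> ?d)
      + (ghost_q t \<omega> i - q t \<omega> i) * (\<l> (w t \<omega>) z - \<l> (wbi i t \<omega>) z))" for i z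
  have f: "integrable (P i) (f i)"
    and int_f: "(\<integral>z. f i z \<partial>P i) = r t * (q t \<omega> i * (grad_risk d\<l> (P i) (w t \<omega>) \<bullet> ?d)
      + (ghost_q t \<omega> i - q t \<omega> i) * (risk \<l> (P i) (w t \<omega>) - risk \<l> (P i) (wbi i t \<omega>)))"
    if i: "i \<in> {1..m}" for i
  proof -
    note L = distribution[OF i]
    have int: "integrable (P i) (\<lambda>z. d\<l> (w t \<omega>) z \<bullet> ?d)" "integrable (P i) (\<l> (w t \<omega>))" "integrable (P i) (\<l> (wbi i t \<omega>))"
      using loss_distribution.integrable_grad[OF L w_W[OF \<omega> t]] loss_distribution.integrable_loss[OF L] w_W[OF \<omega> t] wbi_W[OF \<omega> t i]
      by auto
    then show "integrable (P i) (f i)" unfolding f_def[abs_def] by simp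
    show "(\<integral>z. f i z \<partial>P i) = r t * (q t \<omega> i * (grad_risk d\<l> (P i) (w t \<omega>) \<bullet> ?d)
      + (ghost_q t \<omega> i - q t \<omega> i) * (risk \<l> (P i) (w t \<omega>) - risk \<l> (P i) (wbi i t \<omega>)))"
      unfolding f_def loss_distribution.grad_risk_inner[OF L w_W[OF \<omega> t]] risk_def using int by simp
  qed
  have "mart t \<omega> y = (\<Sum>i=1..m. (\<integral>z. f i z \<partial>P i) - f i (y i))" for y
  proof -
    have "mart t \<omega> y = (\<Sum>i=1..m. r t * (q t \<omega> i * ((grad_risk d\<l> (P i) (w t \<omega>) - d\<l> (w t \<omega>) (y i)) \<bullet> ?d)
        + noise_q t \<omega> y i * (ghost_q t \<omega> i - q t \<omega> i)))"
      by (simp add: mart_def noise_w_def inner_sum_left sum.distrib[symmetric] sum_distrib_left)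
    also have "\<dots> = (\<Sum>i=1..m. (\<integral>z. f i z \<partial>P i) - f i (y i))"
      by (intro sum.cong refl, subst int_f) (auto simp: f_def noise_q_def grad_q_def inner_diff_left algebra_simps)
    finally show ?thesis .
  qed
  then show "(\<integral>y. mart t \<omega> y \<partial>distr M ZZ (fresh t)) = 0"
    using integral_centered_sum[OF t f] by simp
qed

lemma mart_single_martingale_diff:
  assumes t: "t \<ge> 1" and i: "i \<in> {1..m}"
  shows "martingale_diff t (4 * sqrt 2 * D * G * r t) (mart_single i t)"
  unfolding martingale_diff_def
proof (intro conjI ballI)
  note L = distribution[OF i]
  have \<pi>: "fst \<in> measurable (past t \<Otimes>\<^sub>M ZZ) (past t)" by auto
  have y: "(\<lambda>x. snd x i) \<in> measurable (past t \<Otimes>\<^sub>M ZZ) Z"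
    by (rule measurable_compose[OF measurable_snd measurable_component_singleton[OF i]])
  have wi: "(\<lambda>x. wi i t (fst x)) \<in> borel_measurable (past t \<Otimes>\<^sub>M ZZ)"
    using measurable_compose[OF \<pi> wi_adapted[OF i t]] by simp
  have W: "wi i t (fst x) \<in> W" if "x \<in> space (past t \<Otimes>\<^sub>M ZZ)" for x
    using that by (intro wi_W t i) (auto simp: space_pair_measure space_past)
  have "(\<lambda>x. mart_single i t (fst x) (snd x)) \<in> borel_measurable (past t \<Otimes>\<^sub>M ZZ)"
    unfolding mart_single_def
    by (intro borel_measurable_times borel_measurable_inner borel_measurable_diff borel_measurable_const wi W y
        loss_distribution.grad_risk_measurable[OF L] loss_distribution.sample_measurable(2)[OF L])
  then show "(\<lambda>(\<omega>, y). mart_single i t \<omega> y) \<in> borel_measurable (past t \<Otimes>\<^sub>M ZZ)" by (simp add: case_prod_beta')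
next
  fix \<omega> assume \<omega>: "\<omega> \<in> space M"
  interpret Q: prob_space "distr M ZZ (fresh t)" by (rule prob_space_distr) (rule fresh_measurable[OF t])
  show "AE y in distr M ZZ (fresh t). \<bar>mart_single i t \<omega> y\<bar> \<le> 4 * sqrt 2 * D * G * r t"
    using AE_good_fresh[OF t] by eventually_elim (rule mart_single_bound[OF \<omega> t _ i])
  let ?d = "wi i t \<omega> - wopt i"
  note L = distribution[OF i]
  have int: "integrable (P i) (\<lambda>z. d\<l> (wi i t \<omega>) z \<bullet> ?d)"
    using loss_distribution.integrable_grad[OF L wi_W[OF \<omega> t i]] by simp
  have "(\<integral>y. d\<l> (wi i t \<omega>) (y i) \<bullet> ?d \<partial>distr M ZZ (fresh t)) = grad_risk d\<l> (P i) (wi i t \<omega>) \<bullet> ?d"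
    unfolding loss_distribution.grad_risk_inner[OF L wi_W[OF \<omega> t i]] by (rule integrable_fresh(2)[OF t i int])
  then show "(\<integral>y. mart_single i t \<omega> y \<partial>distr M ZZ (fresh t)) = 0"
    unfolding mart_single_def inner_diff_left using integrable_fresh(1)[OF t i int] Q.prob_space by simp
qed

end

section \<open>Regret and the duality gap\<close>

context anytime_sa
begin

abbreviation A :: "nat \<Rightarrow> real" where "A t \<equiv> \<Sum>j=1..t. r j"
abbreviation H :: "nat \<Rightarrow> real" where "H t \<equiv> \<Sum>j=1..t. 1 / real j"

definition bias :: "nat \<Rightarrow> nat \<Rightarrow> 's \<Rightarrow> real" where
  "bias i t \<omega> = risk \<l> (P i) (wbi i t \<omega>) - min_risk W \<l> (P i)"

definition max_bias :: "nat \<Rightarrow> 's \<Rightarrow> real" where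
  "max_bias t \<omega> = Max ((\<lambda>i. bias i t \<omega>) ` {1..m})"

lemma bias_le_max_bias: "i \<in> {1..m} \<Longrightarrow> bias i t \<omega> \<le> max_bias t \<omega>"
  unfolding max_bias_def by (intro Max_ge) auto

lemma max_bias_attained: "\<exists>i\<in>{1..m}. max_bias t \<omega> = bias i t \<omega>"
proof -
  have "max_bias t \<omega> \<in> (\<lambda>i. bias i t \<omega>) ` {1..m}"
    unfolding max_bias_def using m1 by (intro Max_in) auto
  then show ?thesis by auto
qed

lemma bias_bounds:
  assumes "\<omega> \<in> space M" "t \<ge> 1" "i \<in> {1..m}"
  shows "0 \<le> bias i t \<omega>" "bias i t \<omega> \<le> 1"
  using loss_distribution.min_risk_le[OF distribution wbi_W, of i \<omega> t i]
    loss_distribution.risk_bounds(2)[OF distribution wbi_W, of i \<omega> t i]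
    loss_distribution.min_risk_nonneg[OF distribution, of i] assms
  unfolding bias_def by auto

text \<open>The two players have different step constants \<open>c\<close>; dividing them out leaves
  the common weights \<open>r j\<close>, so that their regrets can be added.\<close>

lemma unscale_regret:
  assumes c: "c > 0" and le: "(\<Sum>j=1..t. (c * r j) * x j) \<le> E + (\<Sum>j=1..t. (c * r j)\<^sup>2) * b\<^sup>2 / 2"
  shows "(\<Sum>j=1..t. r j * x j) \<le> E / c + c * b\<^sup>2 / 2 * H t"
proof -
  have "c * (\<Sum>j=1..t. r j * x j) = (\<Sum>j=1..t. (c * r j) * x j)" by (simp add: sum_distrib_left mult.assoc)
  also note le
  also have "(\<Sum>j=1..t. (c * r j)\<^sup>2) = c\<^sup>2 * H t"
    by (simp add: power_mult_distrib r_power2 sum_distrib_left)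
  also have "E + c\<^sup>2 * H t * b\<^sup>2 / 2 = c * (E / c + c * b\<^sup>2 / 2 * H t)"
    using c by (simp add: algebra_simps power2_eq_square)
  finally show ?thesis using c by simp
qed

context
  fixes \<omega> :: 's
  assumes \<omega>: "\<omega> \<in> space M" and good: "\<forall>t\<ge>1. \<forall>i\<in>{1..m}. good (fresh t \<omega> i)"
begin

lemma good_t: "t \<ge> 1 \<Longrightarrow> \<forall>i\<in>{1..m}. good (fresh t \<omega> i)"
  using good by blast

lemma regret_w:
  assumes u: "u \<in> W"
  shows "(\<Sum>j=1..t. r j * (grad_w j \<omega> (fresh j \<omega>) \<bullet> (w j \<omega> - u))) \<le> K / 2 + D\<^sup>2 * G\<^sup>2 / K * H t"
proof -
  have "(\<Sum>j=1..t. step_w D G m j * (grad_w j \<omega> (fresh j \<omega>) \<bullet> (w j \<omega> - u)))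
      \<le> D\<^sup>2 + (\<Sum>j=1..t. (step_w D G m j)\<^sup>2) * G\<^sup>2 / 2"
    using run_1(2)[OF \<omega>] run_w[OF \<omega>] grad_w_bound[OF \<omega> _ good_t] K_pos r_nonneg u
    by (intro mirror_descent_regret[where x = "\<lambda>j. w j \<omega>"]) (auto simp: step_w_r)
  then have "(\<Sum>j=1..t. r j * (grad_w j \<omega> (fresh j \<omega>) \<bullet> (w j \<omega> - u)))
      \<le> D\<^sup>2 / (2 * D\<^sup>2 / K) + 2 * D\<^sup>2 / K * G\<^sup>2 / 2 * H t"
    unfolding step_w_r using K_pos D_pos by (intro unscale_regret) auto
  then show ?thesis using K_pos D_pos by simp
qed

text \<open>The ghost is mirror descent run on the noise, so the deterministic regret bound applies
  on every good trajectory and for every comparison point at once. The range \<open>2 * G\<close> in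
  place of \<open>G\<close> gives the factor 4.\<close>

lemma regret_ghost_w:
  assumes u: "u \<in> W"
  shows "(\<Sum>j=1..t. r j * (noise_w j \<omega> (fresh j \<omega>) \<bullet> (ghost_w j \<omega> - u))) \<le> K / 2 + 4 * (D\<^sup>2 * G\<^sup>2 / K) * H t"
proof -
  have "(\<Sum>j=1..t. step_w D G m j * (noise_w j \<omega> (fresh j \<omega>) \<bullet> (ghost_w j \<omega> - u)))
      \<le> D\<^sup>2 + (\<Sum>j=1..t. (step_w D G m j)\<^sup>2) * (2 * G)\<^sup>2 / 2"
    using noise_w_bound[OF \<omega> _ good_t] K_pos r_nonneg u
    by (intro mirror_descent_regret[where x = "\<lambda>j. ghost_w j \<omega>"]) (auto simp: step_w_r One_nat_def)
  then have "(\<Sum>j=1..t. r j * (noise_w j \<omega> (fresh j \<omega>) \<bullet> (ghost_w j \<omega> - u)))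
      \<le> D\<^sup>2 / (2 * D\<^sup>2 / K) + 2 * D\<^sup>2 / K * (2 * G)\<^sup>2 / 2 * H t"
    unfolding step_w_r using K_pos D_pos by (intro unscale_regret) auto
  then show ?thesis using K_pos D_pos by (simp add: power_mult_distrib)
qed

lemma regret_q:
  assumes p: "p \<in> prob_simplex m"
  shows "(\<Sum>j=1..t. r j * (\<Sum>i=1..m. grad_q j \<omega> (fresh j \<omega>) i * (p i - q j \<omega> i))) \<le> K / 2 + ln (real m) / K * H t"
proof -
  have "(\<Sum>j=1..t. step_q D G m j * (\<Sum>i=1..m. grad_q j \<omega> (fresh j \<omega>) i * (p i - q j \<omega> i)))
      \<le> ln (real m) + (\<Sum>j=1..t. (step_q D G m j)\<^sup>2) * 1\<^sup>2 / 2"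
    using run_1(3)[OF \<omega>] run_q[OF \<omega>] grad_q_bound[OF \<omega> _ good_t] K_pos r_nonneg p m1 ln_m
    by (intro entropic_regret[where x = "\<lambda>j. q j \<omega>"]) (auto simp: step_q_r)
  then have "(\<Sum>j=1..t. r j * (\<Sum>i=1..m. grad_q j \<omega> (fresh j \<omega>) i * (p i - q j \<omega> i)))
      \<le> ln (real m) / (2 * ln (real m) / K) + 2 * ln (real m) / K * 1\<^sup>2 / 2 * H t"
    unfolding step_q_r using K_pos ln_m by (intro unscale_regret) auto
  then show ?thesis using K_pos ln_m by simp
qed

lemma regret_ghost_q:
  assumes p: "p \<in> prob_simplex m"
  shows "(\<Sum>j=1..t. r j * (\<Sum>i=1..m. noise_q j \<omega> (fresh j \<omega>) i * (p i - ghost_q j \<omega> i)))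
    \<le> K / 2 + 4 * (ln (real m) / K) * H t"
proof -
  have "(\<Sum>j=1..t. step_q D G m j * (\<Sum>i=1..m. noise_q j \<omega> (fresh j \<omega>) i * (p i - ghost_q j \<omega> i)))
      \<le> ln (real m) + (\<Sum>j=1..t. (step_q D G m j)\<^sup>2) * 2\<^sup>2 / 2"
    using noise_q_bound[OF \<omega> _ good_t] K_pos r_nonneg p m1 ln_m
    by (intro entropic_regret[where x = "\<lambda>j. ghost_q j \<omega>"]) (auto simp: step_q_r One_nat_def)
  then have "(\<Sum>j=1..t. r j * (\<Sum>i=1..m. noise_q j \<omega> (fresh j \<omega>) i * (p i - ghost_q j \<omega> i)))
      \<le> ln (real m) / (2 * ln (real m) / K) + 2 * ln (real m) / K * 2\<^sup>2 / 2 * H t"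
    unfolding step_q_r using K_pos ln_m by (intro unscale_regret) auto
  then show ?thesis using K_pos ln_m by simp
qed

text \<open>Online-to-batch conversion for a single risk: Jensen's inequality for the average, the
  subgradient inequality at each iterate, then the regret against \<open>wopt i\<close> plus the
  centred noise.\<close>

lemma bias_bound:
  assumes i: "i \<in> {1..m}" and t: "t \<ge> 1"
  shows "A t * bias i t \<omega> \<le> D * G * (1 + H t / 2) + (\<Sum>j=1..t. mart_single i j \<omega> (fresh j \<omega>))"
proof -
  note L = distribution[OF i]
  have opt: "wopt i \<in> W" "risk \<l> (P i) (wopt i) = min_risk W \<l> (P i)" using wopt[OF i] by auto
  let ?d = "\<lambda>j. wi i j \<omega> - wopt i"
  have "(\<Sum>j=1..t. step_single D G j * (d\<l> (wi i j \<omega>) (fresh j \<omega> i) \<bullet> ?d j))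
      \<le> D\<^sup>2 + (\<Sum>j=1..t. (step_single D G j)\<^sup>2) * G\<^sup>2 / 2"
  proof (intro mirror_descent_regret[where x = "\<lambda>j. wi i j \<omega>"])
    fix j y assume "j \<in> {1..t}"
    then have "j \<ge> 1" by simp
    then show "\<bar>d\<l> (wi i j \<omega>) (fresh j \<omega> i) \<bullet> y\<bar> \<le> G * N y"
      by (intro good_bounds(1)[OF \<omega> _ good_t i wi_W[OF \<omega> _ i]])
  qed (use run_1(1)[OF \<omega> i] run_wi[OF \<omega> _ i] opt G_pos D_pos r_nonneg in \<open>auto simp: step_single_r\<close>)
  then have "(\<Sum>j=1..t. r j * (d\<l> (wi i j \<omega>) (fresh j \<omega> i) \<bullet> ?d j)) \<le> D\<^sup>2 / (D / G) + D / G * G\<^sup>2 / 2 * H t"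
    unfolding step_single_r using G_pos D_pos by (intro unscale_regret) auto
  also have "\<dots> = D * G * (1 + H t / 2)"
    using G_pos D_pos by (simp add: power2_eq_square distrib_left)
  finally have regret: "(\<Sum>j=1..t. r j * (d\<l> (wi i j \<omega>) (fresh j \<omega> i) \<bullet> ?d j)) \<le> D * G * (1 + H t / 2)" .
  have "A t * risk \<l> (P i) (wbi i t \<omega>) \<le> (\<Sum>j=1..t. r j * risk \<l> (P i) (wi i j \<omega>))"
    unfolding wbi_eq
    by (intro weighted_avg_convex[OF t loss_distribution.risk_convex[OF L]] wi_W[OF \<omega> _ i]) auto
  then have "A t * bias i t \<omega> \<le> (\<Sum>j=1..t. r j * (risk \<l> (P i) (wi i j \<omega>) - risk \<l> (P i) (wopt i)))"
    by (simp add: bias_def opt right_diff_distrib sum_subtractf sum_distrib_right)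
  also have "\<dots> \<le> (\<Sum>j=1..t. r j * (grad_risk d\<l> (P i) (wi i j \<omega>) \<bullet> ?d j))"
    by (intro sum_mono mult_left_mono r_nonneg loss_distribution.risk_subgradient[OF L] opt wi_W[OF \<omega> _ i]) auto
  also have "\<dots> = (\<Sum>j=1..t. r j * (d\<l> (wi i j \<omega>) (fresh j \<omega> i) \<bullet> ?d j)) + (\<Sum>j=1..t. mart_single i j \<omega> (fresh j \<omega>))"
    unfolding mart_single_def sum.distrib[symmetric] by (intro sum.cong refl) (simp add: inner_diff_left algebra_simps)
  finally show ?thesis using regret by simp
qed

text \<open>The decomposition at the heart of the argument. The excess risk at \<open>w j\<close> is
  \<open>grad_q + noise_q + bias\<close>, and the exact gradient is observed gradient plus noise;
  convexity linearises the dependence on \<open>u\<close>, and the dependence on \<open>p\<close> is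
  linear already.\<close>

lemma gap_step:
  assumes j: "j \<ge> 1" and p: "p \<in> prob_simplex m" and u: "u \<in> W"
  defines "y \<equiv> fresh j \<omega>"
  shows "r j * (\<Sum>i=1..m. p i * (risk \<l> (P i) (w j \<omega>) - min_risk W \<l> (P i))
      - q j \<omega> i * (risk \<l> (P i) u - min_risk W \<l> (P i)))
    \<le> r j * (grad_w j \<omega> y \<bullet> (w j \<omega> - u)) + r j * (noise_w j \<omega> y \<bullet> (ghost_w j \<omega> - u))
      + r j * (\<Sum>i=1..m. grad_q j \<omega> y i * (p i - q j \<omega> i)) + r j * (\<Sum>i=1..m. noise_q j \<omega> y i * (p i - ghost_q j \<omega> i))
      + mart j \<omega> y + r j * max_bias j \<omega>"
proof -
  note qS = q_simplex[OF \<omega> j]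
  let ?R = "\<lambda>i. risk \<l> (P i)" and ?g = "\<lambda>i. grad_risk d\<l> (P i) (w j \<omega>)"
  have "p i * (?R i (w j \<omega>) - min_risk W \<l> (P i)) - q j \<omega> i * (?R i u - min_risk W \<l> (P i))
      \<le> q j \<omega> i * (?g i \<bullet> (w j \<omega> - u)) + grad_q j \<omega> y i * (p i - q j \<omega> i)
        + noise_q j \<omega> y i * (p i - q j \<omega> i) + p i * max_bias j \<omega>" if i: "i \<in> {1..m}" for i
  proof -
    have sub: "q j \<omega> i * (?R i (w j \<omega>) - ?R i u) \<le> q j \<omega> i * (?g i \<bullet> (w j \<omega> - u))"
      by (intro mult_left_mono loss_distribution.risk_subgradient[OF distribution[OF i]] u w_W[OF \<omega> j] prob_simplexD(1)[OF qS i])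
    have "bias i j \<omega> * (p i - q j \<omega> i) \<le> p i * bias i j \<omega>"
      using mult_nonneg_nonneg[OF bias_bounds(1)[OF \<omega> j i] prob_simplexD(1)[OF qS i]] by (simp add: algebra_simps)
    also have "\<dots> \<le> p i * max_bias j \<omega>"
      by (intro mult_left_mono bias_le_max_bias i prob_simplexD(1)[OF p i])
    finally have b: "bias i j \<omega> * (p i - q j \<omega> i) \<le> p i * max_bias j \<omega>" .
    have "?R i (w j \<omega>) - min_risk W \<l> (P i) = grad_q j \<omega> y i + noise_q j \<omega> y i + bias i j \<omega>"
      by (simp add: noise_q_def bias_def)
    then have "(p i - q j \<omega> i) * (?R i (w j \<omega>) - min_risk W \<l> (P i))
        = grad_q j \<omega> y i * (p i - q j \<omega> i) + noise_q j \<omega> y i * (p i - q j \<omega> i) + bias i j \<omega> * (p i - q j \<omega> i)"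
      by (simp add: algebra_simps)
    moreover have "p i * (?R i (w j \<omega>) - min_risk W \<l> (P i)) - q j \<omega> i * (?R i u - min_risk W \<l> (P i))
        = (p i - q j \<omega> i) * (?R i (w j \<omega>) - min_risk W \<l> (P i)) + q j \<omega> i * (?R i (w j \<omega>) - ?R i u)"
      by (simp add: algebra_simps)
    ultimately show ?thesis using sub b by linarith
  qed
  then have "(\<Sum>i=1..m. p i * (?R i (w j \<omega>) - min_risk W \<l> (P i)) - q j \<omega> i * (?R i u - min_risk W \<l> (P i)))
      \<le> (\<Sum>i=1..m. q j \<omega> i * (?g i \<bullet> (w j \<omega> - u)) + grad_q j \<omega> y i * (p i - q j \<omega> i)
        + noise_q j \<omega> y i * (p i - q j \<omega> i) + p i * max_bias j \<omega>)"
    by (rule sum_mono)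
  also have "\<dots> = (\<Sum>i=1..m. q j \<omega> i * (?g i \<bullet> (w j \<omega> - u))) + (\<Sum>i=1..m. grad_q j \<omega> y i * (p i - q j \<omega> i))
        + (\<Sum>i=1..m. noise_q j \<omega> y i * (p i - q j \<omega> i)) + max_bias j \<omega>"
    using prob_simplexD(2)[OF p] by (simp add: sum.distrib sum_distrib_right[symmetric])
  also have "(\<Sum>i=1..m. q j \<omega> i * (?g i \<bullet> (w j \<omega> - u))) = grad_w j \<omega> y \<bullet> (w j \<omega> - u) + noise_w j \<omega> y \<bullet> (w j \<omega> - u)"
    by (simp add: grad_w_def noise_w_def inner_sum_left inner_diff_left sum.distrib[symmetric] right_diff_distrib)
  \<comment> \<open>Insertion of the ghost: the part that depends on \<open>u\<close> becomes ghost
    regret, the rest goes into \<open>mart\<close>. The same is done for \<open>q\<close> two lines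
    below.\<close>
  also have "noise_w j \<omega> y \<bullet> (w j \<omega> - u) = noise_w j \<omega> y \<bullet> (ghost_w j \<omega> - u) + noise_w j \<omega> y \<bullet> (w j \<omega> - ghost_w j \<omega>)"
    by (simp add: inner_diff_right)
  also have "(\<Sum>i=1..m. noise_q j \<omega> y i * (p i - q j \<omega> i))
      = (\<Sum>i=1..m. noise_q j \<omega> y i * (p i - ghost_q j \<omega> i)) + (\<Sum>i=1..m. noise_q j \<omega> y i * (ghost_q j \<omega> i - q j \<omega> i))"
    by (simp add: sum.distrib[symmetric] algebra_simps)
  finally have "(\<Sum>i=1..m. p i * (?R i (w j \<omega>) - min_risk W \<l> (P i)) - q j \<omega> i * (?R i u - min_risk W \<l> (P i)))
      \<le> grad_w j \<omega> y \<bullet> (w j \<omega> - u) + noise_w j \<omega> y \<bullet> (ghost_w j \<omega> - u)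
        + (\<Sum>i=1..m. grad_q j \<omega> y i * (p i - q j \<omega> i)) + (\<Sum>i=1..m. noise_q j \<omega> y i * (p i - ghost_q j \<omega> i))
        + (noise_w j \<omega> y \<bullet> (w j \<omega> - ghost_w j \<omega>) + (\<Sum>i=1..m. noise_q j \<omega> y i * (ghost_q j \<omega> i - q j \<omega> i)))
        + max_bias j \<omega>" by simp
  from mult_left_mono[OF this r_nonneg[of j]] show ?thesis
    by (simp only: mart_def distrib_left)
qed

lemma gap_bound:
  assumes t: "t \<ge> 1" and p: "p \<in> prob_simplex m" and u: "u \<in> W"
  shows "A t * (excess_obj m W \<l> P (weighted_avg r (\<lambda>j. w j \<omega>) t) p
      - excess_obj m W \<l> P u (\<lambda>i. weighted_avg r (\<lambda>j. q j \<omega> i) t))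
    \<le> K * (2 + 5 / 2 * H t) + (\<Sum>j=1..t. mart j \<omega> (fresh j \<omega>)) + (\<Sum>j=1..t. r j * max_bias j \<omega>)"
proof -
  let ?R = "\<lambda>i. risk \<l> (P i)" and ?m = "\<lambda>i. min_risk W \<l> (P i)"
  have At: "A t > 0" by (rule r_sum_pos[OF t])
  have "A t * excess_obj m W \<l> P (weighted_avg r (\<lambda>j. w j \<omega>) t) p
      = (\<Sum>i=1..m. p i * (A t * ?R i (weighted_avg r (\<lambda>j. w j \<omega>) t) - A t * ?m i))"
    unfolding excess_obj_def sum_distrib_left by (intro sum.cong refl) (simp add: algebra_simps)
  also have "\<dots> \<le> (\<Sum>i=1..m. p i * ((\<Sum>j=1..t. r j * ?R i (w j \<omega>)) - A t * ?m i))"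
    using w_W[OF \<omega>]
    by (intro sum_mono mult_left_mono diff_right_mono prob_simplexD(1)[OF p]
        weighted_avg_convex[OF t loss_distribution.risk_convex[OF distribution]]) auto
  also have "\<dots> = (\<Sum>i=1..m. \<Sum>j=1..t. r j * (p i * (?R i (w j \<omega>) - ?m i)))"
    by (intro sum.cong refl)
      (simp add: sum_distrib_left sum_distrib_right sum_subtractf[symmetric] algebra_simps)
  finally have 1: "A t * excess_obj m W \<l> P (weighted_avg r (\<lambda>j. w j \<omega>) t) p
      \<le> (\<Sum>i=1..m. \<Sum>j=1..t. r j * (p i * (?R i (w j \<omega>) - ?m i)))" .
  have avg: "A t * weighted_avg r x t = (\<Sum>j=1..t. r j * x j)" for x :: "nat \<Rightarrow> real"
  proof -
    have "A t * weighted_avg r x t = (\<Sum>j=1..t. A t * (r j / A t * x j))"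
      unfolding weighted_avg_def real_scaleR_def by (rule sum_distrib_left)
    also have "\<dots> = (\<Sum>j=1..t. r j * x j)" using At by (intro sum.cong refl) simp
    finally show ?thesis .
  qed
  have "A t * excess_obj m W \<l> P u (\<lambda>i. weighted_avg r (\<lambda>j. q j \<omega> i) t)
      = (\<Sum>i=1..m. (A t * weighted_avg r (\<lambda>j. q j \<omega> i) t) * (?R i u - ?m i))"
    unfolding excess_obj_def by (simp only: sum_distrib_left mult.assoc)
  then have 2: "A t * excess_obj m W \<l> P u (\<lambda>i. weighted_avg r (\<lambda>j. q j \<omega> i) t)
      = (\<Sum>i=1..m. \<Sum>j=1..t. r j * (q j \<omega> i * (?R i u - ?m i)))"
    unfolding avg by (simp only: sum_distrib_right mult.assoc)
  have "A t * (excess_obj m W \<l> P (weighted_avg r (\<lambda>j. w j \<omega>) t) p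
      - excess_obj m W \<l> P u (\<lambda>i. weighted_avg r (\<lambda>j. q j \<omega> i) t))
      \<le> (\<Sum>i=1..m. \<Sum>j=1..t. r j * (p i * (?R i (w j \<omega>) - ?m i)))
        - (\<Sum>i=1..m. \<Sum>j=1..t. r j * (q j \<omega> i * (?R i u - ?m i)))"
    using 1 2 by (simp only: right_diff_distrib)
  also have "\<dots> = (\<Sum>j=1..t. r j * (\<Sum>i=1..m. p i * (?R i (w j \<omega>) - ?m i) - q j \<omega> i * (?R i u - ?m i)))"
    unfolding sum.swap[of _ "{1..m}"] sum_subtractf[symmetric] sum_distrib_left
    by (intro sum.cong refl) (simp add: right_diff_distrib)
  also have "\<dots> \<le> (\<Sum>j=1..t. r j * (grad_w j \<omega> (fresh j \<omega>) \<bullet> (w j \<omega> - u))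
      + r j * (noise_w j \<omega> (fresh j \<omega>) \<bullet> (ghost_w j \<omega> - u))
      + r j * (\<Sum>i=1..m. grad_q j \<omega> (fresh j \<omega>) i * (p i - q j \<omega> i))
      + r j * (\<Sum>i=1..m. noise_q j \<omega> (fresh j \<omega>) i * (p i - ghost_q j \<omega> i))
      + mart j \<omega> (fresh j \<omega>) + r j * max_bias j \<omega>)"
    by (intro sum_mono gap_step p u) auto
  also have "\<dots> \<le> (K / 2 + D\<^sup>2 * G\<^sup>2 / K * H t) + (K / 2 + 4 * (D\<^sup>2 * G\<^sup>2 / K) * H t)
      + (K / 2 + ln (real m) / K * H t) + (K / 2 + 4 * (ln (real m) / K) * H t)
      + (\<Sum>j=1..t. mart j \<omega> (fresh j \<omega>)) + (\<Sum>j=1..t. r j * max_bias j \<omega>)"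
    unfolding sum.distrib
    by (intro add_mono regret_w[OF u] regret_ghost_w[OF u] regret_q[OF p] regret_ghost_q[OF p] order_refl)
  \<comment> \<open>Four initial terms \<open>K / 2\<close> make \<open>2 * K\<close>. The harmonic
    terms carry \<open>1 + 4\<close> times \<open>D\<^sup>2 * G\<^sup>2 + ln m\<close>, which is
    half of \<open>K\<^sup>2\<close>; hence \<open>5 / 2\<close>.\<close>
  also have "(K / 2 + D\<^sup>2 * G\<^sup>2 / K * H t) + (K / 2 + 4 * (D\<^sup>2 * G\<^sup>2 / K) * H t)
      + (K / 2 + ln (real m) / K * H t) + (K / 2 + 4 * (ln (real m) / K) * H t)
      = 2 * K + 5 / 2 * (K\<^sup>2 / K) * H t"
    unfolding K_power2 by (simp add: algebra_simps add_divide_distrib)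
  also have "\<dots> = K * (2 + 5 / 2 * H t)"
    using K_pos by (simp add: power2_eq_square algebra_simps)
  finally show ?thesis .
qed

end

end

section \<open>Probabilistic bounds\<close>

context anytime_sa
begin

section \<open>Range and measurability of the duality gap\<close>

lemma simplex_vertex: "i \<in> {1..m} \<Longrightarrow> (\<lambda>k. if k = i then 1 else 0) \<in> prob_simplex m"
  by (auto simp: prob_simplex_def)

lemma prob_simplex_nonempty: "prob_simplex m \<noteq> {}"
  using simplex_vertex[OF one_le_m(1)] by blast

text \<open>A linear function on the simplex peaks at a vertex; the finite \<open>Max\<close> is
  then measurable in the point, unlike an uncountable supremum in general.\<close>

lemma SUP_prob_simplex: "(SUP p\<in>prob_simplex m. \<Sum>i=1..m. p i * a i) = Max (a ` {1..m})"
proof (rule antisym)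
  have le: "(\<Sum>i=1..m. p i * a i) \<le> Max (a ` {1..m})" if p: "p \<in> prob_simplex m" for p
  proof -
    have "(\<Sum>i=1..m. p i * a i) \<le> (\<Sum>i=1..m. p i * Max (a ` {1..m}))"
      by (intro sum_mono mult_left_mono Max_ge prob_simplexD(1)[OF p]) auto
    then show ?thesis using prob_simplexD(2)[OF p] by (simp add: sum_distrib_right[symmetric])
  qed
  then show "(SUP p\<in>prob_simplex m. \<Sum>i=1..m. p i * a i) \<le> Max (a ` {1..m})"
    by (intro cSUP_least prob_simplex_nonempty)
  have "Max (a ` {1..m}) \<in> a ` {1..m}" using m1 by (intro Max_in) auto
  then obtain i where i: "i \<in> {1..m}" "Max (a ` {1..m}) = a i" by auto
  have "(\<Sum>k=1..m. (if k = i then 1 else 0) * a k) = (\<Sum>k=1..m. if k = i then a k else 0)"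
    by (intro sum.cong refl) auto
  then have "a i = (\<Sum>k=1..m. (if k = i then 1 else 0) * a k)" using i by simp
  also have "\<dots> \<le> (SUP p\<in>prob_simplex m. \<Sum>i=1..m. p i * a i)"
    using le by (intro cSUP_upper[OF simplex_vertex[OF i(1)]] bdd_aboveI2)
  finally show "Max (a ` {1..m}) \<le> (SUP p\<in>prob_simplex m. \<Sum>i=1..m. p i * a i)" using i by simp
qed

lemma excess_obj_bounds:
  assumes p: "p \<in> prob_simplex m" and u: "u \<in> W"
  shows "0 \<le> excess_obj m W \<l> P u p" "excess_obj m W \<l> P u p \<le> 1"
proof -
  have b: "0 \<le> risk \<l> (P i) u - min_risk W \<l> (P i)" "risk \<l> (P i) u - min_risk W \<l> (P i) \<le> 1"
    if i: "i \<in> {1..m}" for i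
    using loss_distribution.min_risk_le[OF distribution[OF i] u] loss_distribution.risk_bounds(2)[OF distribution[OF i] u]
      loss_distribution.min_risk_nonneg[OF distribution[OF i]] by auto
  show "0 \<le> excess_obj m W \<l> P u p" unfolding excess_obj_def
    by (intro sum_nonneg mult_nonneg_nonneg b prob_simplexD(1)[OF p])
  have "excess_obj m W \<l> P u p \<le> (\<Sum>i=1..m. p i * 1)" unfolding excess_obj_def
    by (intro sum_mono mult_left_mono b prob_simplexD(1)[OF p])
  then show "excess_obj m W \<l> P u p \<le> 1" using prob_simplexD(2)[OF p] by simp
qed

lemma opt_error_le:
  assumes "\<And>p u. p \<in> prob_simplex m \<Longrightarrow> u \<in> W \<Longrightarrow> excess_obj m W \<l> P v p - excess_obj m W \<l> P u p' \<le> X"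
  shows "opt_error m W \<l> P v p' \<le> X"
proof -
  have "(SUP p\<in>prob_simplex m. excess_obj m W \<l> P v p) - X \<le> excess_obj m W \<l> P u p'" if u: "u \<in> W" for u
  proof -
    have "(SUP p\<in>prob_simplex m. excess_obj m W \<l> P v p) \<le> X + excess_obj m W \<l> P u p'"
      using assms[OF _ u] by (intro cSUP_least prob_simplex_nonempty) (simp add: diff_le_eq)
    then show ?thesis by simp
  qed
  then have "(SUP p\<in>prob_simplex m. excess_obj m W \<l> P v p) - X \<le> (INF u\<in>W. excess_obj m W \<l> P u p')"
    by (intro cINF_greatest W_ne)
  then show ?thesis by (simp add: opt_error_def)
qed

lemma opt_error_abs_le_1:
  assumes v: "v \<in> W" and p': "p' \<in> prob_simplex m"
  shows "\<bar>opt_error m W \<l> P v p'\<bar> \<le> 1"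
proof -
  let ?S = "SUP p\<in>prob_simplex m. excess_obj m W \<l> P v p" and ?I = "INF u\<in>W. excess_obj m W \<l> P u p'"
  note b = excess_obj_bounds
  obtain p where p: "p \<in> prob_simplex m" using prob_simplex_nonempty by blast
  have "excess_obj m W \<l> P v p \<le> ?S" using b(2)[OF _ v] by (intro cSUP_upper p bdd_aboveI2)
  then have "0 \<le> ?S" using b(1)[OF p v] by linarith
  moreover have "?S \<le> 1" using b(2)[OF _ v] by (intro cSUP_least prob_simplex_nonempty)
  moreover have "0 \<le> ?I" using b(1)[OF p'] by (intro cINF_greatest W_ne)
  moreover have "?I \<le> excess_obj m W \<l> P v p'" using b(1)[OF p'] by (intro cINF_lower v bdd_belowI2)
  then have "?I \<le> 1" using b(2)[OF p' v] by linarith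
  ultimately show ?thesis unfolding opt_error_def by linarith
qed

definition wbar :: "nat \<Rightarrow> 's \<Rightarrow> 'a" where
  "wbar t \<omega> = weighted_avg (step_w D G m) (\<lambda>j. w j \<omega>) t"

definition qbar :: "nat \<Rightarrow> 's \<Rightarrow> nat \<Rightarrow> real" where
  "qbar t \<omega> i = weighted_avg (step_q D G m) (\<lambda>j. q j \<omega> i) t"

lemma wbar_eq: "wbar t \<omega> = weighted_avg r (\<lambda>j. w j \<omega>) t"
  unfolding wbar_def step_w_r[abs_def] using D_pos K_pos by (intro weighted_avg_scale) auto

lemma qbar_eq: "qbar t \<omega> = (\<lambda>i. weighted_avg r (\<lambda>j. q j \<omega> i) t)"
  unfolding qbar_def[abs_def] step_q_r[abs_def] using ln_m K_pos
  by (intro ext weighted_avg_scale) auto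

lemma wbar_W: "\<omega> \<in> space M \<Longrightarrow> t \<ge> 1 \<Longrightarrow> wbar t \<omega> \<in> W"
  unfolding wbar_eq by (intro weighted_avg_W w_W) auto

lemma qbar_simplex:
  assumes \<omega>: "\<omega> \<in> space M" and t: "t \<ge> 1"
  shows "qbar t \<omega> \<in> prob_simplex m"
proof -
  have At: "A t > 0" by (rule r_sum_pos[OF t])
  have c: "0 \<le> r j / A t" for j using At r_nonneg by simp
  have qbar: "qbar t \<omega> i = (\<Sum>j=1..t. r j / A t * q j \<omega> i)" for i by (simp add: qbar_eq weighted_avg_def)
  have "(\<Sum>i=1..m. qbar t \<omega> i) = (\<Sum>j=1..t. r j / A t * (\<Sum>i=1..m. q j \<omega> i))"
    unfolding qbar sum_distrib_left by (rule sum.swap)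
  also have "\<dots> = (\<Sum>j=1..t. r j / A t)"
    using prob_simplexD(2)[OF q_simplex[OF \<omega>]] by (intro sum.cong refl) simp
  also have "\<dots> = 1" using At by (simp add: sum_divide_distrib[symmetric])
  finally have "(\<Sum>i=1..m. qbar t \<omega> i) = 1" .
  moreover have "0 \<le> qbar t \<omega> i" if "i \<in> {1..m}" for i
    unfolding qbar using that prob_simplexD(1)[OF q_simplex[OF \<omega>]] c
    by (intro sum_nonneg mult_nonneg_nonneg) auto
  moreover have "qbar t \<omega> i = 0" if "i \<notin> {1..m}" for i
    unfolding qbar using that prob_simplexD(3)[OF q_simplex[OF \<omega>]] by (intro sum.neutral) auto
  ultimately show ?thesis unfolding prob_simplex_def by blast
qed

lemma wbar_measurable: "wbar t \<in> borel_measurable M"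
  unfolding wbar_def[abs_def] weighted_avg_def
  by (intro borel_measurable_sum borel_measurable_scaleR borel_measurable_const measurable_F_M[OF w_adapted]) auto

lemma qbar_measurable: "i \<in> {1..m} \<Longrightarrow> (\<lambda>\<omega>. qbar t \<omega> i) \<in> borel_measurable M"
  unfolding qbar_def weighted_avg_def
  by (intro borel_measurable_sum borel_measurable_scaleR borel_measurable_const measurable_F_M[OF q_adapted]) auto

abbreviation err :: "nat \<Rightarrow> 's \<Rightarrow> real" where "err t \<omega> \<equiv> opt_error m W \<l> P (wbar t \<omega>) (qbar t \<omega>)"

text \<open>Continuity lets a dense subset stand in for \<open>W\<close>; taken countable, it makes
  the infimum in the duality gap measurable.\<close>

lemma INF_dense:
  fixes f :: "'a \<Rightarrow> real"
  assumes f: "continuous_on W f" "\<And>u. u \<in> W \<Longrightarrow> 0 \<le> f u" and T: "T \<noteq> {}" "T \<subseteq> W" "W \<subseteq> closure T"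
  shows "(INF u\<in>W. f u) = (INF u\<in>T. f u)"
proof (rule antisym)
  have bdd: "bdd_below (f ` W)" "bdd_below (f ` T)" using f(2) T by (auto intro!: bdd_belowI2[of _ 0])
  show "(INF u\<in>W. f u) \<le> (INF u\<in>T. f u)" using T bdd by (intro cINF_superset_mono) auto
  show "(INF u\<in>T. f u) \<le> (INF u\<in>W. f u)"
  proof (rule cINF_greatest[OF W_ne])
    fix u assume u: "u \<in> W"
    then obtain x where x: "\<And>n. x n \<in> T" "x \<longlonglongrightarrow> u" using T(3) closure_sequential[of u T] by blast
    have "(\<lambda>n. f (x n)) \<longlonglongrightarrow> f u"
      using f(1) x u T unfolding continuous_on_sequentially by (auto simp: o_def)
    then show "(INF u\<in>T. f u) \<le> f u"
      using cINF_lower[OF bdd(2) x(1)] by (intro LIMSEQ_le_const) auto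
  qed
qed

lemma err_measurable:
  assumes t: "t \<ge> 1" shows "err t \<in> borel_measurable M"
proof -
  obtain T where T: "countable T" "T \<subseteq> W" "W \<subseteq> closure T" using separable[of W] by blast
  have T_ne: "T \<noteq> {}" using T W_ne by auto
  have cont: "continuous_on W (\<lambda>u. excess_obj m W \<l> P u p)" for p
    unfolding excess_obj_def
    by (intro continuous_intros loss_distribution.continuous_on_risk[OF distribution]) auto
  have eq: "err t \<omega> = Max ((\<lambda>i. risk \<l> (P i) (wbar t \<omega>) - min_risk W \<l> (P i)) ` {1..m})
      - (INF u\<in>T. excess_obj m W \<l> P u (qbar t \<omega>))" if \<omega>: "\<omega> \<in> space M" for \<omega>
    unfolding opt_error_def
    using INF_dense[OF cont excess_obj_bounds(1)[OF qbar_simplex[OF \<omega> t]] T_ne T(2,3)]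
      SUP_prob_simplex[of "\<lambda>i. risk \<l> (P i) (wbar t \<omega>) - min_risk W \<l> (P i)"]
    by (simp add: excess_obj_def)
  moreover have "(\<lambda>\<omega>. Max ((\<lambda>i. risk \<l> (P i) (wbar t \<omega>) - min_risk W \<l> (P i)) ` {1..m})) \<in> borel_measurable M"
    using wbar_W t
    by (intro borel_measurable_Max borel_measurable_diff wbar_measurable borel_measurable_const
        loss_distribution.risk_measurable[OF distribution]) auto
  moreover have "(\<lambda>\<omega>. INF u\<in>T. excess_obj m W \<l> P u (qbar t \<omega>)) \<in> borel_measurable M"
    unfolding excess_obj_def
    by (intro borel_measurable_cINF_real T(1) borel_measurable_sum borel_measurable_times qbar_measurable
        borel_measurable_const)
  ultimately show ?thesis
    by (subst measurable_cong[OF eq]) (auto simp only: intro: borel_measurable_diff)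
qed

lemma integrable_err: "t \<ge> 1 \<Longrightarrow> integrable M (err t)"
  using opt_error_abs_le_1 wbar_W qbar_simplex
  by (intro integrable_const_bound[where B = 1] AE_I2 err_measurable) auto

lemma bias_measurable: "t \<ge> 1 \<Longrightarrow> i \<in> {1..m} \<Longrightarrow> bias i t \<in> borel_measurable M"
  unfolding bias_def[abs_def]
  using wbi_W
  by (intro borel_measurable_diff loss_distribution.risk_measurable[OF distribution] measurable_F_M[OF wbi_adapted]) auto

lemma integrable_max_bias: "t \<ge> 1 \<Longrightarrow> integrable M (max_bias t)"
proof (rule integrable_const_bound[where B = 1])
  assume t: "t \<ge> 1"
  show "AE \<omega> in M. norm (max_bias t \<omega>) \<le> 1"
  proof (rule AE_I2)
    fix \<omega> assume \<omega>: "\<omega> \<in> space M"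
    obtain i where i: "i \<in> {1..m}" "max_bias t \<omega> = bias i t \<omega>" using max_bias_attained by blast
    then show "norm (max_bias t \<omega>) \<le> 1" using bias_bounds[OF \<omega> t i(1)] by simp
  qed
  show "max_bias t \<in> borel_measurable M"
    unfolding max_bias_def[abs_def] by (intro borel_measurable_Max bias_measurable t) auto
qed

abbreviation mart_sum :: "nat \<Rightarrow> 's \<Rightarrow> real" where
  "mart_sum t \<omega> \<equiv> \<Sum>j=1..t. mart j \<omega> (fresh j \<omega>)"
abbreviation mart_single_sum :: "nat \<Rightarrow> nat \<Rightarrow> 's \<Rightarrow> real" where
  "mart_single_sum i t \<omega> \<equiv> \<Sum>j=1..t. mart_single i j \<omega> (fresh j \<omega>)"

lemma variance_proxy:
  assumes t: "t \<ge> 1" shows "(\<Sum>j=1..t. (4 * sqrt 2 * c * r j)\<^sup>2) \<le> 32 * c\<^sup>2 * (1 + ln (real t))"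
proof -
  have "(\<Sum>j=1..t. (4 * sqrt 2 * c * r j)\<^sup>2) = 32 * c\<^sup>2 * H t"
    by (simp add: power_mult_distrib r_power2 sum_distrib_left)
  also have "\<dots> \<le> 32 * c\<^sup>2 * (1 + ln (real t))" by (intro mult_left_mono sum_inverse_le t) auto
  finally show ?thesis .
qed

lemma mart_sum_subgaussian: "t \<ge> 1 \<Longrightarrow> subgaussian (mart_sum t) (32 * K\<^sup>2 * (1 + ln (real t)))"
  by (rule subgaussian_mono[OF azuma_subgaussian[OF mart_martingale_diff] variance_proxy])

lemma mart_single_sum_subgaussian:
  assumes t: "t \<ge> 1" and i: "i \<in> {1..m}"
  shows "subgaussian (mart_single_sum i t) (32 * (D * G)\<^sup>2 * (1 + ln (real t)))"
proof (rule subgaussian_mono)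
  show "subgaussian (mart_single_sum i t) (\<Sum>j=1..t. (4 * sqrt 2 * D * G * r j)\<^sup>2)"
    by (rule azuma_subgaussian) (rule mart_single_martingale_diff[OF _ i])
  show "(\<Sum>j=1..t. (4 * sqrt 2 * D * G * r j)\<^sup>2) \<le> 32 * (D * G)\<^sup>2 * (1 + ln (real t))"
    using variance_proxy[OF t, of "D * G"] by (simp only: mult.assoc)
qed

text \<open>\<open>2 * 32 = 8^2\<close> is the origin of the 8 in the final bound; the 16 is the
  same 8 after the factor \<open>4 * D * G\<close> of the bias is written as
  \<open>2 * D * G\<close> times 2.\<close>

lemma sqrt_variance_proxy:
  fixes c x y :: real
  assumes "0 \<le> c" shows "sqrt (2 * (32 * c\<^sup>2 * x) * y) = 8 * c * sqrt (x * y)"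
proof -
  have "2 * (32 * c\<^sup>2 * x) * y = (8 * c)\<^sup>2 * (x * y)" by (simp add: power2_eq_square)
  then show ?thesis using assms by (simp add: real_sqrt_mult)
qed

lemma err_bound_AE:
  "AE \<omega> in M. \<forall>t\<ge>1. A t * err t \<omega> \<le> K * (2 + 5 / 2 * H t) + mart_sum t \<omega> + (\<Sum>j=1..t. r j * max_bias j \<omega>)"
  using AE_good_samples AE_space
proof eventually_elim
  case (elim \<omega>)
  show ?case
  proof (intro allI impI)
    fix t :: nat assume t: "t \<ge> 1"
    let ?X = "K * (2 + 5 / 2 * H t) + mart_sum t \<omega> + (\<Sum>j=1..t. r j * max_bias j \<omega>)"
    have At: "A t > 0" by (rule r_sum_pos[OF t])
    have "err t \<omega> \<le> ?X / A t"
    proof (rule opt_error_le)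
      fix p u assume "p \<in> prob_simplex m" "u \<in> W"
      then have "A t * (excess_obj m W \<l> P (wbar t \<omega>) p - excess_obj m W \<l> P u (qbar t \<omega>)) \<le> ?X"
        unfolding wbar_eq qbar_eq by (intro gap_bound elim t)
      then show "excess_obj m W \<l> P (wbar t \<omega>) p - excess_obj m W \<l> P u (qbar t \<omega>) \<le> ?X / A t"
        using At by (simp add: pos_le_divide_eq mult.commute)
    qed
    then show "A t * err t \<omega> \<le> ?X" using At by (simp add: pos_le_divide_eq mult.commute)
  qed
qed

lemma bias_bound_AE:
  "AE \<omega> in M. \<forall>t\<ge>1. \<forall>i\<in>{1..m}. A t * bias i t \<omega> \<le> D * G * (1 + H t / 2) + mart_single_sum i t \<omega>"
  using AE_good_samples AE_space by eventually_elim (use bias_bound in blast)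

text \<open>Turns \<open>\<Sum> r j * bias\<close> into a harmonic sum, because
  \<open>A j * bias\<close> is what has been bounded; this produces the extra factor
  \<open>1 + ln t\<close>.\<close>

lemma r_div_A: "j \<ge> 1 \<Longrightarrow> r j / A j \<le> 4 * (1 / real j)"
proof -
  assume j: "j \<ge> 1"
  have "sqrt (real j) / 4 \<le> A j" using sqrt_le_avg_den[OF j] avg_den_le_sum[of j] by (simp add: r_def)
  then have "r j / A j \<le> r j / (sqrt (real j) / 4)" using j r_nonneg by (intro divide_left_mono) (auto intro!: mult_pos_pos r_sum_pos)
  also have "\<dots> = 4 * (1 / real j)" by (simp add: r_def)
  finally show ?thesis .
qed

text \<open>Purely numerical, so that it serves twice: for means, where \<open>v\<close> is 0, and
  along one trajectory, where \<open>v\<close> is the martingale sum.\<close>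

lemma assemble_bound:
  assumes t: "t \<ge> 1" and e: "A t * e \<le> K * (2 + 5 / 2 * H t) + v + (\<Sum>j=1..t. r j * b j)"
    and v: "v \<le> V" "0 \<le> V" and \<beta>: "0 \<le> \<beta>" and b: "\<And>j. j \<in> {1..t} \<Longrightarrow> A j * b j \<le> D * G * \<beta>"
  shows "e \<le> 1 / (2 * (sqrt (real t + 1) - 1)) * (K * (5 + 3 * ln (real t)) + V + 4 * D * G * \<beta> * (1 + ln (real t)))"
proof -
  let ?L = "ln (real t)"
  let ?X = "K * (5 + 3 * ?L) + V + 4 * D * G * \<beta> * (1 + ?L)"
  have L: "0 \<le> ?L" using t by simp
  have Ht: "H t \<le> 1 + ?L" by (rule sum_inverse_le[OF t])
  have At: "A t > 0" by (rule r_sum_pos[OF t])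
  \<comment> \<open>\<open>2 + 5 / 2 * (1 + ?L)\<close> is \<open>9 / 2 + 5 / 2 * ?L\<close>,
    rounded up.\<close>
  have "K * (2 + 5 / 2 * H t) \<le> K * (5 + 3 * ?L)"
    using K_pos Ht L by (intro mult_left_mono) auto
  moreover have "(\<Sum>j=1..t. r j * b j) \<le> 4 * D * G * \<beta> * (1 + ?L)"
  proof -
    have "r j * b j \<le> D * G * \<beta> * (4 * (1 / real j))" if j: "j \<in> {1..t}" for j
    proof -
      have Aj: "A j > 0" using j by (intro r_sum_pos) auto
      have "r j * b j = (r j / A j) * (A j * b j)" using Aj by simp
      also have "\<dots> \<le> (r j / A j) * (D * G * \<beta>)"
        using Aj r_nonneg by (intro mult_left_mono b j) auto
      also have "\<dots> \<le> (4 * (1 / real j)) * (D * G * \<beta>)"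
        using D_pos G_pos \<beta> j by (intro mult_right_mono r_div_A) auto
      finally show ?thesis by (simp add: mult.commute)
    qed
    then have "(\<Sum>j=1..t. r j * b j) \<le> (\<Sum>j=1..t. D * G * \<beta> * (4 * (1 / real j)))" by (rule sum_mono)
    also have "\<dots> = 4 * D * G * \<beta> * H t" by (simp add: sum_distrib_left mult_ac)
    also have "\<dots> \<le> 4 * D * G * \<beta> * (1 + ?L)" using D_pos G_pos \<beta> Ht by (intro mult_left_mono) auto
    finally show ?thesis .
  qed
  ultimately have "A t * e \<le> ?X" using e v by linarith
  then have "e \<le> ?X / A t" using At by (simp add: pos_le_divide_eq mult.commute)
  also have "\<dots> \<le> ?X / avg_den t"
    using avg_den_le_sum[of t] avg_den_pos[OF t] K_pos L v D_pos G_pos \<beta>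
    by (intro divide_left_mono) (auto simp: r_def intro!: add_nonneg_nonneg mult_nonneg_nonneg)
  finally show ?thesis by (simp add: avg_den_def)
qed

text \<open>The largest bias is dominated by one of \<open>m\<close> subgaussian sums. The choice
  \<open>l = s / v\<close> minimises \<open>ln m / l + l * v / 2\<close>, with minimum
  \<open>s\<close>; \<open>m \<ge> 2\<close> keeps \<open>s\<close> positive.\<close>

lemma expectation_max_bias:
  assumes j: "j \<ge> 1"
  shows "A j * expectation (max_bias j) \<le> D * G * (1 + H j / 2 + 8 * sqrt ((1 + ln (real j)) * ln (real m)))"
proof -
  let ?c = "D * G * (1 + H j / 2)"
  define v where "v = 32 * (D * G)\<^sup>2 * (1 + ln (real j))"
  define s where "s = sqrt (2 * v * ln (real m))"
  have L: "0 \<le> ln (real j)" using j by simp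
  then have v: "v > 0" using D_pos G_pos by (simp add: v_def)
  have s: "s > 0" and s2: "s\<^sup>2 = 2 * v * ln (real m)" using v ln_m by (auto simp: s_def)
  have int: "integrable M (\<lambda>\<omega>. A j * max_bias j \<omega> - ?c)" using integrable_max_bias[OF j] by simp
  have "AE \<omega> in M. \<exists>i\<in>{1..m}. A j * max_bias j \<omega> - ?c \<le> mart_single_sum i j \<omega>"
    using bias_bound_AE
  proof eventually_elim
    case (elim \<omega>)
    obtain i where i: "i \<in> {1..m}" "max_bias j \<omega> = bias i j \<omega>" using max_bias_attained by blast
    then have "A j * max_bias j \<omega> - ?c \<le> mart_single_sum i j \<omega>" using elim j by (simp add: diff_le_eq add.commute)
    then show ?case using i by blast
  qed
  then have "expectation (\<lambda>\<omega>. A j * max_bias j \<omega> - ?c) \<le> ln (real (card {1..m})) / (s / v) + s / v * v / 2"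
    using s v unfolding v_def
    by (intro expectation_max_subgaussian[OF _ _ mart_single_sum_subgaussian[OF j] int]) (use one_le_m in auto)
  also have "\<dots> = s\<^sup>2 / (2 * s) + s / 2" using v s2 by simp
  also have "\<dots> = s" using s by (simp add: power2_eq_square)
  also have "s = 8 * (D * G) * sqrt ((1 + ln (real j)) * ln (real m))"
    unfolding s_def v_def using D_pos G_pos by (intro sqrt_variance_proxy) auto
  finally show ?thesis
    using integrable_max_bias[OF j] prob_space by (simp add: algebra_simps)
qed

lemma expectation_err:
  assumes t: "t \<ge> 1" shows "expectation (err t) \<le> expectation_bound D G m t"
proof -
  let ?L = "ln (real t)"
  \<comment> \<open>Half of the bracket in the stated bound, so that
    \<open>4 * D * G * \<beta>\<close> reproduces it; the factors \<open>1 + sqrt (ln m)\<close> and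
    \<open>sqrt 2\<close> are slack in it.\<close>
  define \<beta> where "\<beta> = (3 + ?L) / 2 + 8 * ((1 + sqrt (ln (real m))) * sqrt (2 * (1 + ?L)))"
  have L: "0 \<le> ?L" using t by simp
  let ?c = "K * (2 + 5 / 2 * H t)"
  have ib: "integrable M (\<lambda>\<omega>. \<Sum>j=1..t. r j * max_bias j \<omega>)"
    using integrable_max_bias by (intro Bochner_Integration.integrable_sum integrable_mult_right) auto
  have int: "integrable M (\<lambda>\<omega>. A t * err t \<omega> - ?c - (\<Sum>j=1..t. r j * max_bias j \<omega>))"
    using integrable_err[OF t] ib by simp
  have "AE \<omega> in M. A t * err t \<omega> - ?c - (\<Sum>j=1..t. r j * max_bias j \<omega>) \<le> mart_sum t \<omega>"
    using err_bound_AE by eventually_elim (use t in \<open>simp add: algebra_simps\<close>)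
  from expectation_subgaussian_le_0[OF mart_sum_subgaussian[OF t] int this]
  have "A t * expectation (err t) - ?c - (\<Sum>j=1..t. r j * expectation (max_bias j)) \<le> 0"
    using integrable_err[OF t] integrable_max_bias ib prob_space
    by (subst (asm) Bochner_Integration.integral_diff) (auto simp: Bochner_Integration.integral_sum)
  then have e: "A t * expectation (err t) \<le> ?c + 0 + (\<Sum>j=1..t. r j * expectation (max_bias j))" by simp
  have "expectation (err t) \<le> 1 / (2 * (sqrt (real t + 1) - 1)) * (K * (5 + 3 * ?L) + 0 + 4 * D * G * \<beta> * (1 + ?L))"
  proof (rule assemble_bound[OF t e])
    show "0 \<le> \<beta>" using L ln_m by (simp add: \<beta>_def)
    fix j assume j: "j \<in> {1..t}"
    then have j1: "j \<ge> 1" and Lj: "0 \<le> ln (real j)" "ln (real j) \<le> ?L" by auto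
    have "H j \<le> 1 + ?L" using sum_inverse_le[OF j1] Lj by linarith
    moreover have "sqrt ((1 + ln (real j)) * ln (real m)) \<le> (1 + sqrt (ln (real m))) * sqrt (2 * (1 + ?L))"
    proof -
      have "sqrt ((1 + ln (real j)) * ln (real m)) = sqrt (ln (real m)) * sqrt (1 + ln (real j))"
        by (simp add: real_sqrt_mult mult.commute)
      also have "\<dots> \<le> (1 + sqrt (ln (real m))) * sqrt (2 * (1 + ?L))"
        using Lj ln_m by (intro mult_mono) auto
      finally show ?thesis .
    qed
    moreover have "1 + h / 2 + 8 * x \<le> (3 + l) / 2 + 8 * y" if "h \<le> 1 + l" "x \<le> y" for h l x y :: real
      using that by (simp add: field_simps)
    ultimately have "1 + H j / 2 + 8 * sqrt ((1 + ln (real j)) * ln (real m)) \<le> \<beta>" unfolding \<beta>_def by blast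
    then have "D * G * (1 + H j / 2 + 8 * sqrt ((1 + ln (real j)) * ln (real m))) \<le> D * G * \<beta>"
      using D_pos G_pos by (intro mult_left_mono) auto
    then show "A j * expectation (max_bias j) \<le> D * G * \<beta>" using expectation_max_bias[OF j1] by linarith
  qed simp_all
  also have "4 * D * G * \<beta> * (1 + ?L) = 2 * D * G * (3 + ?L + 16 * (1 + sqrt (ln (real m))) * sqrt (2 * (1 + ?L))) * (1 + ?L)"
    by (simp add: \<beta>_def algebra_simps)
  finally show ?thesis by (simp add: expectation_bound_def K_def mult.commute)
qed

lemma high_prob_err:
  assumes \<delta>: "0 < \<delta>" "\<delta> < 1 / 2"
  shows "1 - 2 * \<delta> \<le> prob {\<omega> \<in> space M. \<forall>t\<ge>1. err t \<omega> \<le> high_prob_bound D G \<delta> m t}"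
proof -
  \<comment> \<open>Chosen so that \<open>exp (- a t)\<close> is \<open>\<delta> / (2 * t^2)\<close>
    and \<open>exp (- b t)\<close> is \<open>\<delta> / (2 * m * t^2)\<close>: one main deviation
    and \<open>m\<close> auxiliary ones make round \<open>t\<close> bad with probability at most
    \<open>\<delta> / t^2\<close>.\<close>
  define a where "a t = ln (2 * (real t)\<^sup>2 / \<delta>)" for t :: nat
  define b where "b t = ln (2 * real m * (real t)\<^sup>2 / \<delta>)" for t :: nat
  define bad1 where "bad1 t = {\<omega> \<in> space M. sqrt (2 * (32 * K\<^sup>2 * (1 + ln (real t))) * a t) < mart_sum t \<omega>}" for t
  define bad2 where "bad2 t i = {\<omega> \<in> space M.
    sqrt (2 * (32 * (D * G)\<^sup>2 * (1 + ln (real t))) * b t) < mart_single_sum i t \<omega>}" for t i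
  \<comment> \<open>\<open>bad n\<close> belongs to round \<open>n + 1\<close>, to match a series
    indexed from 0.\<close>
  define bad where "bad n = bad1 (Suc n) \<union> (\<Union>i\<in>{1..m}. bad2 (Suc n) i)" for n
  let ?E = "{\<omega> \<in> space M. \<forall>t\<ge>1. err t \<omega> \<le> high_prob_bound D G \<delta> m t}"
  have t2: "1 \<le> (real t)\<^sup>2" if "t \<ge> 1" for t :: nat using that by simp
  have ab: "0 < a t" "0 < b t" if t: "t \<ge> 1" for t
  proof -
    have 1: "\<delta> < 2 * (real t)\<^sup>2" using t2[OF t] \<delta> by linarith
    moreover have "2 * (real t)\<^sup>2 \<le> 2 * real m * (real t)\<^sup>2" using m by (intro mult_right_mono) auto
    ultimately show "0 < a t" "0 < b t" using \<delta> unfolding a_def b_def by (auto intro!: ln_gt_zero simp: field_simps)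
  qed
  have ev1: "bad1 t \<in> events" and ev2: "i \<in> {1..m} \<Longrightarrow> bad2 t i \<in> events" if "t \<ge> 1" for t i
    using subgaussian_measurable[OF mart_sum_subgaussian[OF that]]
      subgaussian_measurable[OF mart_single_sum_subgaussian[OF that]]
    unfolding bad1_def bad2_def by auto
  have ev: "bad n \<in> events" for n unfolding bad_def using ev1 ev2 by (intro sets.Un sets.finite_UN) auto
  have p: "prob (bad n) \<le> \<delta> * (1 / (real n + 1)\<^sup>2)" for n
  proof -
    let ?t = "Suc n"
    have t: "?t \<ge> 1" by simp
    have L: "0 < 1 + ln (real ?t)" using ln_ge_zero[of "real ?t"] by linarith
    have "prob (bad1 ?t) \<le> exp (- a ?t)"
      unfolding bad1_def using K_pos L ab[OF t] by (intro subgaussian_tail mart_sum_subgaussian t mult_pos_pos) auto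
    also have "\<dots> = \<delta> / (2 * (real n + 1)\<^sup>2)"
      using \<delta> by (simp add: a_def exp_minus add.commute)
    finally have p1: "prob (bad1 ?t) \<le> \<delta> / (2 * (real n + 1)\<^sup>2)" .
    have p2: "prob (bad2 ?t i) \<le> \<delta> / (2 * real m * (real n + 1)\<^sup>2)" if i: "i \<in> {1..m}" for i
    proof -
      have "prob (bad2 ?t i) \<le> exp (- b ?t)"
        unfolding bad2_def using D_pos G_pos L ab[OF t]
        by (intro subgaussian_tail mart_single_sum_subgaussian t i mult_pos_pos) auto
      also have "\<dots> = \<delta> / (2 * real m * (real n + 1)\<^sup>2)"
        using \<delta> m by (simp add: b_def exp_minus add.commute)
      finally show ?thesis .
    qed
    have "prob (bad n) \<le> prob (bad1 ?t) + prob (\<Union>i\<in>{1..m}. bad2 ?t i)"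
      unfolding bad_def using ev1[OF t] ev2[OF t] by (intro measure_Un_le sets.finite_UN) auto
    also have "prob (\<Union>i\<in>{1..m}. bad2 ?t i) \<le> (\<Sum>i=1..m. prob (bad2 ?t i))"
      using ev2[OF t] by (intro finite_measure_subadditive_finite) auto
    also have "\<dots> \<le> (\<Sum>i=1..m. \<delta> / (2 * real m * (real n + 1)\<^sup>2))" by (intro sum_mono p2)
    also have "\<dots> = \<delta> / (2 * (real n + 1)\<^sup>2)" using m by simp
    finally show ?thesis using p1 by (simp add: field_simps)
  qed
  have sq: "(\<lambda>n. \<delta> * (1 / (real n + 1)\<^sup>2)) sums (\<delta> * (pi\<^sup>2 / 6))"
    using inverse_squares_sums by (intro sums_mult) (simp add: add.commute)
  have summ: "summable (\<lambda>n. prob (bad n))"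
    by (rule summable_comparison_test_ev[OF _ sums_summable[OF sq]]) (use p in auto)
  have "prob (\<Union>n. bad n) \<le> (\<Sum>n. prob (bad n))"
    using ev by (intro finite_measure_subadditive_countably summ) auto
  also have "\<dots> \<le> \<delta> * (pi\<^sup>2 / 6)"
    using suminf_le[OF p summ sums_summable[OF sq]] sums_unique[OF sq] by simp
  \<comment> \<open>The sum of the inverse squares, \<open>pi\<^sup>2 / 6\<close>, is rounded up to
    2; this is the 2 in the confidence level.\<close>
  also have "\<dots> \<le> \<delta> * 2"
  proof (intro mult_left_mono)
    have "pi \<le> 16 / 5" using pi_approx by simp
    then have "pi\<^sup>2 \<le> (16 / 5)\<^sup>2" by (intro power_mono) auto
    then show "pi\<^sup>2 / 6 \<le> 2" by (simp add: power2_eq_square)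
  qed (use \<delta> in simp)
  finally have bad: "prob (\<Union>n. bad n) \<le> 2 * \<delta>" by simp
  have E: "?E \<in> events"
  proof -
    have all: "(\<forall>t\<ge>1. R t) \<longleftrightarrow> (\<forall>n. R (Suc n))" for R :: "nat \<Rightarrow> bool"
      by (auto simp: One_nat_def Suc_le_eq gr0_conv_Suc)
    show ?thesis
      unfolding all using err_measurable
      by (intro sets.sets_Collect_countable_All borel_measurable_le borel_measurable_const) auto
  qed
  \<comment> \<open>Inclusion up to a null set, because the regret bounds themselves hold only
    almost surely.\<close>
  have "AE \<omega> in M. \<omega> \<in> space M - (\<Union>n. bad n) \<longrightarrow> \<omega> \<in> ?E"
    using err_bound_AE bias_bound_AE
  proof eventually_elim
    case (elim \<omega>)
    show ?case
    proof safe
      fix t :: nat assume \<omega>: "\<omega> \<in> space M" "\<omega> \<notin> (\<Union>n. bad n)" and t: "t \<ge> 1"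
      let ?L = "ln (real t)"
      have nb1: "\<omega> \<notin> bad1 j" and nb2: "i \<in> {1..m} \<Longrightarrow> \<omega> \<notin> bad2 j i" if "j \<ge> 1" for j i
        using \<omega>(2) that by (cases j; auto simp: bad_def)+
      have L: "0 \<le> ?L" using t by simp
      define \<beta> where "\<beta> = (3 + ?L) / 2 + 8 * sqrt ((1 + ?L) * b t)"
      have "mart_sum t \<omega> \<le> sqrt (2 * (32 * K\<^sup>2 * (1 + ?L)) * a t)"
        using nb1[OF t] \<omega> by (auto simp: bad1_def)
      also have "\<dots> = 8 * K * sqrt ((1 + ?L) * a t)"
        using K_pos by (intro sqrt_variance_proxy) simp
      finally have V: "mart_sum t \<omega> \<le> 8 * K * sqrt ((1 + ?L) * a t)" .
      have "err t \<omega> \<le> 1 / (2 * (sqrt (real t + 1) - 1))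
          * (K * (5 + 3 * ?L) + 8 * K * sqrt ((1 + ?L) * a t) + 4 * D * G * \<beta> * (1 + ?L))"
      proof (rule assemble_bound[OF t _ V])
        show "A t * err t \<omega> \<le> K * (2 + 5 / 2 * H t) + mart_sum t \<omega> + (\<Sum>j=1..t. r j * max_bias j \<omega>)"
          using elim(1) t by blast
        show "0 \<le> 8 * K * sqrt ((1 + ?L) * a t)" "0 \<le> \<beta>"
          using K_pos L ab[OF t] by (auto simp: \<beta>_def)
        fix j assume j: "j \<in> {1..t}"
        then have j1: "j \<ge> 1" and Lj: "0 \<le> ln (real j)" "ln (real j) \<le> ?L" by auto
        obtain i where i: "i \<in> {1..m}" "max_bias j \<omega> = bias i j \<omega>" using max_bias_attained by blast
        \<comment> \<open>The bound at \<open>t\<close> contains the biases of all rounds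
          \<open>j \<le> t\<close> and so uses the deviation events of each of them; monotonicity
          replaces \<open>b j\<close> by \<open>b t\<close>.\<close>
        have bj: "b j \<le> b t"
          unfolding b_def using j \<delta> m by (intro ln_mono divide_right_mono mult_left_mono power_mono) auto
        have "mart_single_sum i j \<omega> \<le> sqrt (2 * (32 * (D * G)\<^sup>2 * (1 + ln (real j))) * b j)"
          using nb2[OF j1 i(1)] \<omega> by (auto simp: bad2_def)
        also have "\<dots> = 8 * (D * G) * sqrt ((1 + ln (real j)) * b j)"
          using D_pos G_pos by (intro sqrt_variance_proxy) simp
        also have "\<dots> \<le> 8 * (D * G) * sqrt ((1 + ?L) * b t)"
          using D_pos G_pos Lj bj ab[OF j1] by (intro mult_left_mono real_sqrt_le_mono mult_mono) auto
        finally have U: "mart_single_sum i j \<omega> \<le> 8 * (D * G) * sqrt ((1 + ?L) * b t)" .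
        have "H j \<le> 1 + ?L" using sum_inverse_le[OF j1] Lj by linarith
        then have "D * G * (1 + H j / 2) \<le> D * G * ((3 + ?L) / 2)"
          using D_pos G_pos by (intro mult_left_mono) auto
        moreover have "A j * bias i j \<omega> \<le> D * G * (1 + H j / 2) + mart_single_sum i j \<omega>"
          using elim(2) j1 i(1) by blast
        ultimately have "A j * bias i j \<omega> \<le> D * G * ((3 + ?L) / 2) + 8 * (D * G) * sqrt ((1 + ?L) * b t)"
          using U by linarith
        also have "\<dots> = D * G * \<beta>" unfolding \<beta>_def by (simp add: distrib_left)
        finally show "A j * max_bias j \<omega> \<le> D * G * \<beta>" using i(2) by simp
      qed
      also have "\<dots> = high_prob_bound D G \<delta> m t"
        unfolding high_prob_bound_def K_def[symmetric] a_def b_def \<beta>_def by (simp add: algebra_simps)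
      finally show "err t \<omega> \<le> high_prob_bound D G \<delta> m t" .
    qed
  qed
  then have "prob (space M - (\<Union>n. bad n)) \<le> prob ?E"
    by (rule finite_measure_mono_AE[OF _ E])
  moreover have "prob (space M - (\<Union>n. bad n)) = 1 - prob (\<Union>n. bad n)"
    using ev by (intro prob_compl) auto
  ultimately show ?thesis using bad by simp
qed

end

theorem theorem2:
  fixes m :: nat
    and N :: "'a::euclidean_space \<Rightarrow> real"
    and W :: "'a set"
    and Z :: "'z measure"
    and P :: "nat \<Rightarrow> 'z measure"
    and \<l> :: "'a \<Rightarrow> 'z \<Rightarrow> real"
    and d\<l> :: "'a \<Rightarrow> 'z \<Rightarrow> 'a"
    and \<nu> :: "'a \<Rightarrow> real"
    and d\<nu> :: "'a \<Rightarrow> 'a"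
    and ow :: 'a
    and D G :: real
    and M :: "'s measure"
    and zs :: "nat \<Rightarrow> nat \<Rightarrow> 's \<Rightarrow> 'z"
    and wi :: "nat \<Rightarrow> nat \<Rightarrow> 's \<Rightarrow> 'a"
    and w :: "nat \<Rightarrow> 's \<Rightarrow> 'a"
    and q :: "nat \<Rightarrow> 's \<Rightarrow> nat \<Rightarrow> real"
  defines "wbar \<equiv> \<lambda>t \<omega>. weighted_avg (step_w D G m) (\<lambda>j. w j \<omega>) t"
    and "qbar \<equiv> \<lambda>t \<omega> i. weighted_avg (step_q D G m) (\<lambda>j. q j \<omega> i) t"
  assumes m: "m \<ge> 2" and DG: "D > 0" "G > 0"
    and norm: "is_norm N"
    and W: "W \<noteq> {}" "closed W"
    and P: "\<And>i. i \<in> {1..m} \<Longrightarrow> prob_space (P i)"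
      "\<And>i. i \<in> {1..m} \<Longrightarrow> sets (P i) = sets Z"
    and loss_measurable:
      "(\<lambda>(u, z). \<l> u z) \<in> borel_measurable (restrict_space borel W \<Otimes>\<^sub>M Z)"
    and grad_measurable:
      "(\<lambda>(u, z). d\<l> u z) \<in> borel_measurable (restrict_space borel W \<Otimes>\<^sub>M Z)"
    and grad: "\<And>u z. u \<in> W \<Longrightarrow> z \<in> space Z \<Longrightarrow>
      ((\<lambda>v. \<l> v z) has_derivative (\<lambda>h. d\<l> u z \<bullet> h)) (at u within W)"
    and dgf: "distance_generating N W \<nu> d\<nu>"
    and ow: "is_arg_min \<nu> (\<lambda>u. u \<in> W) ow"
    and convex: "convex W" "\<And>i. i \<in> {1..m} \<Longrightarrow> convex_on W (risk \<l> (P i))"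
    and diameter: "\<And>u. u \<in> W \<Longrightarrow> bregman \<nu> d\<nu> u ow \<le> D\<^sup>2"
    and grad_bound: "\<And>i. i \<in> {1..m} \<Longrightarrow> AE z in P i. \<forall>u\<in>W. dual_norm N (d\<l> u z) \<le> G"
    and loss_bound: "\<And>i. i \<in> {1..m} \<Longrightarrow> AE z in P i. \<forall>u\<in>W. 0 \<le> \<l> u z \<and> \<l> u z \<le> 1"
    and M: "prob_space M"
    and samples_indep:
      "prob_space.indep_vars M (\<lambda>_. Z) (\<lambda>(t, i). zs t i) ({1..} \<times> {1..m})"
    and samples_distr: "\<And>t i. t \<ge> 1 \<Longrightarrow> i \<in> {1..m} \<Longrightarrow> distr M Z (zs t i) = P i"
    and run: "\<And>\<omega>. \<omega> \<in> space M \<Longrightarrow>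
      anytime_sa_trajectory m W \<l> d\<l> \<nu> d\<nu> ow
        (\<lambda>i. step_single D G) (step_w D G m) (step_q D G m)
        (\<lambda>t i. zs t i \<omega>) (\<lambda>i t. wi i t \<omega>) (\<lambda>t. w t \<omega>) (\<lambda>t. q t \<omega>)"
  shows
    "(\<forall>t\<ge>1. integrable M (\<lambda>\<omega>. opt_error m W \<l> P (wbar t \<omega>) (qbar t \<omega>)) \<and>
        (\<integral>\<omega>. opt_error m W \<l> P (wbar t \<omega>) (qbar t \<omega>) \<partial>M) \<le> expectation_bound D G m t) \<and>
     (\<forall>\<delta>. 0 < \<delta> \<and> \<delta> < 1/2 \<longrightarrow>
        measure M {\<omega> \<in> space M. \<forall>t\<ge>1.
            opt_error m W \<l> P (wbar t \<omega>) (qbar t \<omega>) \<le> high_prob_bound D G \<delta> m t}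
          \<ge> 1 - 2 * \<delta>) \<and>
     (\<lambda>(m', t). expectation_bound D G m' t)
        \<in> O[principal ({2..} \<times> {2..})](\<lambda>(m', t). rate m' t) \<and>
     (\<forall>\<delta>. 0 < \<delta> \<and> \<delta> < 1/2 \<longrightarrow>
        (\<lambda>(m', t). high_prob_bound D G \<delta> m' t)
          \<in> O[principal ({2..} \<times> {2..})](\<lambda>(m', t). rate m' t))"
proof -
  have mirror: "mirror_map N W \<nu> d\<nu> ow D"
    by unfold_locales (use norm W convex(1) dgf ow diameter DG in auto)
  have distribution: "loss_distribution N W \<nu> d\<nu> ow D Z (P i) \<l> d\<l> G" if i: "i \<in> {1..m}" for i
    by (intro loss_distribution.intro mirror loss_distribution_axioms.intro P[OF i] loss_measurable
        grad_measurable grad grad_bound[OF i] loss_bound[OF i] convex(2)[OF i] DG)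
  interpret sa: anytime_sa N W \<nu> d\<nu> ow D M m Z P \<l> d\<l> G zs wi w q
    by (intro anytime_sa.intro mirror M anytime_sa_axioms.intro m distribution samples_indep samples_distr run)
  have err: "opt_error m W \<l> P (wbar t \<omega>) (qbar t \<omega>)
      = opt_error m W \<l> P (sa.wbar t \<omega>) (sa.qbar t \<omega>)" for t \<omega>
    by (simp add: wbar_def qbar_def sa.wbar_def sa.qbar_def[abs_def])
  show ?thesis
    unfolding err
    using sa.integrable_err sa.expectation_err sa.high_prob_err expectation_bound_bigo[OF DG]
      high_prob_bound_bigo[OF DG] by blast
qed

end
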